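(* Let $\Omega\subset\mathbb{R}^N$ be a bounded domain, let $1<p\le 2$ with $p<N$, let $0<\lambda<\mathcal{H}^p$ where $\mathcal{H}=\frac{N-p}{p}$, and let $f,g\in L^1(\Omega)$ with $g\ge 0$. Suppose there are constants $M>0$ and $K>1$ such that $$|f(x)|\le M g(x)\quad\text{and}\quad K\frac{\lambda}{|x|^p}\le g(x)\quad\text{for a.e. }x\in\Omega.$$ Then the Dirichlet problem $$\begin{cases}-\operatorname{div}(|Du|^{p-2}Du)+g(x)u=\dfrac{\lambda}{|x|^p}|u|^{p-2}u+f & \text{in }\Omega,\\ u=0 & \text{on }\partial\Omega,\end{cases}$$ has a bounded weak solution $u\in W_0^{1,p}(\Omega)\cap L^\infty(\Omega)$.
   Context: $W_0^{1,p}(\Omega)$ is the closure of $C_0^\infty(\Omega)$ in the usual Sobolev space $W^{1,p}(\Omega)$. The expressions $|u|^{p-2}u$ and $|Du|^{p-2}Du$ are understood to be $0$ where $u=0$, respectively $Du=0$. A weak solution is $u\in W_0^{1,p}(\Omega)$ such that $g(x)u\in L^1(\Omega)$ and, for every $\varphi\in W_0^{1,p}(\Omega)\cap L^\infty(\Omega)$, $$\int_\Omega |Du|^{p-2}Du\cdot D\varphi+\int_\Omega g(x)u\,\varphi=\int_\Omega\frac{\lambda}{|x|^p}|u|^{p-2}u\,\varphi+\int_\Omega f\varphi .$$ *)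

theory Defs
  imports "HOL-Analysis.Analysis"
begin

text \<open>
  Functions on \<open>\<Omega>\<close> are total functions on the ambient Euclidean space of which only the values on
  \<open>\<Omega>\<close> (up to a null set) matter; all integrals are Lebesgue integrals over \<open>\<Omega>\<close>.
\<close>

fun cont_diff :: "nat \<Rightarrow> ('a::euclidean_space \<Rightarrow> real) \<Rightarrow> bool" where
  "cont_diff 0 f \<longleftrightarrow> continuous_on UNIV f"
| "cont_diff (Suc k) f \<longleftrightarrow>
     (\<forall>x. f differentiable (at x)) \<and>
     (\<forall>i\<in>Basis. cont_diff k (\<lambda>x. frechet_derivative f (at x) i))"

definition test_functions :: "'a::euclidean_space set \<Rightarrow> ('a \<Rightarrow> real) set" where
  "test_functions \<Omega> =
     {\<phi>. (\<forall>k. cont_diff k \<phi>) \<and> compact (closure {x. \<phi> x \<noteq> 0}) \<and> closure {x. \<phi> x \<noteq> 0} \<subseteq> \<Omega>}"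

definition Lp_functions ::
    "'a::euclidean_space set \<Rightarrow> real \<Rightarrow> ('a \<Rightarrow> 'b::euclidean_space) set" where
  "Lp_functions \<Omega> p =
     {u. u \<in> borel_measurable (lebesgue_on \<Omega>) \<and>
         integrable (lebesgue_on \<Omega>) (\<lambda>x. norm (u x) powr p)}"

definition Linfty_functions :: "'a::euclidean_space set \<Rightarrow> ('a \<Rightarrow> real) set" where
  "Linfty_functions \<Omega> =
     {u. u \<in> borel_measurable (lebesgue_on \<Omega>) \<and> (\<exists>C. AE x in lebesgue_on \<Omega>. \<bar>u x\<bar> \<le> C)}"

definition has_weak_gradient ::
    "'a::euclidean_space set \<Rightarrow> ('a \<Rightarrow> real) \<Rightarrow> ('a \<Rightarrow> 'a) \<Rightarrow> bool" where
  "has_weak_gradient \<Omega> u G \<longleftrightarrow>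
     (\<forall>S. compact S \<and> S \<subseteq> \<Omega> \<longrightarrow>
        u absolutely_integrable_on S \<and> G absolutely_integrable_on S) \<and>
     (\<forall>\<phi>\<in>test_functions \<Omega>. \<forall>i\<in>Basis.
        (LINT x|lebesgue_on \<Omega>. u x * frechet_derivative \<phi> (at x) i) =
        - (LINT x|lebesgue_on \<Omega>. (G x \<bullet> i) * \<phi> x))"

text \<open>On an open set the weak gradient is unique up to null sets, so the choice is immaterial below.\<close>

definition weak_gradient ::
    "'a::euclidean_space set \<Rightarrow> ('a \<Rightarrow> real) \<Rightarrow> 'a \<Rightarrow> 'a" where
  "weak_gradient \<Omega> u = (SOME G. has_weak_gradient \<Omega> u G)"

definition sobolev_space :: "'a::euclidean_space set \<Rightarrow> real \<Rightarrow> ('a \<Rightarrow> real) set" where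
  "sobolev_space \<Omega> p =
     {u \<in> Lp_functions \<Omega> p. \<exists>G\<in>Lp_functions \<Omega> p. has_weak_gradient \<Omega> u G}"

definition sobolev_norm :: "'a::euclidean_space set \<Rightarrow> real \<Rightarrow> ('a \<Rightarrow> real) \<Rightarrow> real" where
  "sobolev_norm \<Omega> p u =
     ((LINT x|lebesgue_on \<Omega>. \<bar>u x\<bar> powr p) +
      (LINT x|lebesgue_on \<Omega>. norm (weak_gradient \<Omega> u x) powr p)) powr (1 / p)"

definition sobolev_space_0 :: "'a::euclidean_space set \<Rightarrow> real \<Rightarrow> ('a \<Rightarrow> real) set" where
  "sobolev_space_0 \<Omega> p =
     {u \<in> sobolev_space \<Omega> p.
        \<forall>\<epsilon>>0. \<exists>\<phi>\<in>test_functions \<Omega>. sobolev_norm \<Omega> p (\<lambda>x. u x - \<phi> x) < \<epsilon>}"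

text \<open>
  \<open>power_field p v\<close> is \<open>|v|\<^sup>p\<^sup>-\<^sup>2 v\<close>, which is \<open>0\<close> at \<open>v = 0\<close> for every \<open>p\<close>; it is used both for
  scalars and for gradients.
\<close>

definition power_field :: "real \<Rightarrow> 'b::real_normed_vector \<Rightarrow> 'b" where
  "power_field p v = (norm v powr (p - 2)) *\<^sub>R v"

text \<open>
  For \<open>1 < p < N\<close>, \<open>f \<in> L\<^sup>1(\<Omega>)\<close> and bounded open \<open>\<Omega>\<close>, each of the four integrands is
  automatically integrable: the first by Hoelder's inequality, the second and the last because \<open>\<phi>\<close> is
  bounded, and the singular one by Hardy's inequality. Hence the value \<open>0\<close> that Bochner integrals
  take on non-integrable functions plays no role. The value \<open>lam / 0 = 0\<close> at the origin concerns a
  null set only.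
\<close>

definition weak_solution ::
    "'a::euclidean_space set \<Rightarrow> real \<Rightarrow> real \<Rightarrow> ('a \<Rightarrow> real) \<Rightarrow> ('a \<Rightarrow> real) \<Rightarrow>
     ('a \<Rightarrow> real) \<Rightarrow> bool" where
  "weak_solution \<Omega> p lam f g u \<longleftrightarrow>
     u \<in> sobolev_space_0 \<Omega> p \<and>
     integrable (lebesgue_on \<Omega>) (\<lambda>x. g x * u x) \<and>
     (\<forall>\<phi> \<in> sobolev_space_0 \<Omega> p \<inter> Linfty_functions \<Omega>.
        (LINT x|lebesgue_on \<Omega>. power_field p (weak_gradient \<Omega> u x) \<bullet> weak_gradient \<Omega> \<phi> x) +
        (LINT x|lebesgue_on \<Omega>. g x * u x * \<phi> x) =
        (LINT x|lebesgue_on \<Omega>. lam / norm x powr p * power_field p (u x) * \<phi> x) +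
        (LINT x|lebesgue_on \<Omega>. f x * \<phi> x))"

end

theory Submission
  imports Defs "HOL-Complex_Analysis.Great_Picard" "HOL-Computational_Algebra.Polynomial"
begin

text \<open>
  The hypothesis \<open>K lam / |x|\<^sup>p \<le> g\<close> with \<open>g \<in> L\<^sup>1\<close> makes the singular coefficient integrable, so on
  uniformly bounded functions all lower order terms of the energy
  \<open>J u = \<integral> |Du|\<^sup>p / p + \<integral> (g u\<^sup>2 / 2 - (lam / |x|\<^sup>p) |u|\<^sup>p / p - f u)\<close>
  are dominated by a multiple of \<open>g\<close>. Because \<open>p \<le> 2\<close>,
  \<open>|f| \<le> M g\<close> and \<open>K > 1\<close>, the lower order integrand is monotone in \<open>|u|\<close> beyond a constant level, so
  a smooth truncation at that level does not increase \<open>J\<close>. Hence \<open>J\<close> has a uniformly bounded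
  minimizing sequence of test functions. By compactness a subsequence converges almost everywhere;
  comparing the energy of midpoints with the infimum and using uniform convexity of \<open>|v|\<^sup>p\<close>, the
  gradients converge strongly in \<open>L\<^sup>p\<close>. The limit is bounded, and its Euler-Lagrange equation is
  the weak formulation.
\<close>

subsection \<open>Smooth functions\<close>

text \<open>Two obstacles shape the argument. The data \<open>f\<close> and \<open>g\<close> are
  merely in L^1, so the energy is well behaved only on bounded functions; and the singular term
  enters with a negative sign, so \<open>J\<close> need not be convex and weak lower semicontinuity
  is not at hand. Both are met by separating the two parts of \<open>J\<close>. On functions bounded
  by a fixed constant the lower order part is Lipschitz for the distance \<integral> g |u - v|,
  which vanishes under bounded almost everywhere convergence. Its lack of convexity thus costs only
  a vanishing error in the midpoint comparison, and the gradient part must account for the rest.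
  Strong convergence of gradients then does double duty: the limit lies in the closure of the test
  functions, and its energy equals the infimum. The energy is never differentiated; one-sided
  inequalities from the convexity of |v|^p suffice, since the direction of a variation can be
  reversed. Throughout, L^p estimates are phrased for integrals of p-th powers, with a small
  multiple of one power plus a large multiple of another in place of Hoelder's and Minkowski's
  inequalities.\<close>

definition smooth :: "('a::euclidean_space \<Rightarrow> real) \<Rightarrow> bool" where
  "smooth f \<longleftrightarrow> (\<forall>k. cont_diff k f)"

lemma smoothD [dest]: "smooth f \<Longrightarrow> cont_diff k f"
  by (simp add: smooth_def)

lemma smooth_imp_differentiable: "smooth f \<Longrightarrow> f differentiable (at x)"
  using smoothD[of f "Suc 0"] by simp

lemma smooth_imp_continuous: "smooth f \<Longrightarrow> continuous_on S f"
  using smoothD[of f 0] by (auto intro: continuous_on_subset)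

lemma smooth_has_derivative:
  "smooth f \<Longrightarrow> (f has_derivative frechet_derivative f (at x)) (at x)"
  using smooth_imp_differentiable frechet_derivative_works by blast

lemma smooth_partial:
  "smooth f \<Longrightarrow> i \<in> Basis \<Longrightarrow> smooth (\<lambda>x. frechet_derivative f (at x) i)"
  unfolding smooth_def using cont_diff.simps(2) by blast

lemma cont_diff_Suc_imp: "cont_diff (Suc k) f \<Longrightarrow> cont_diff k f"
proof (induction k arbitrary: f)
  case 0
  then show ?case
    by (auto simp: continuous_on_eq_continuous_at intro!: differentiable_imp_continuous_within)
next
  case (Suc k)
  then show ?case by (metis cont_diff.simps(2))
qed

lemma frechet_derivative_eqI:
  "(f has_derivative f') (at x) \<Longrightarrow> frechet_derivative f (at x) = f'"
  using frechet_derivative_at by force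

lemma cont_diff_const: "cont_diff k (\<lambda>x. c)"
proof (induction k arbitrary: c)
  case (Suc k)
  have "frechet_derivative (\<lambda>x::'a. c) (at x) = (\<lambda>_. 0)" for x
    by (rule frechet_derivative_eqI) (rule has_derivative_const)
  with Suc show ?case by simp
qed simp

lemma cont_diff_add: "cont_diff k f \<Longrightarrow> cont_diff k g \<Longrightarrow> cont_diff k (\<lambda>x. f x + g x)"
proof (induction k arbitrary: f g)
  case 0
  then show ?case by (auto intro: continuous_intros)
next
  case (Suc k)
  have "frechet_derivative (\<lambda>x. f x + g x) (at x) =
      (\<lambda>h. frechet_derivative f (at x) h + frechet_derivative g (at x) h)" for x
    using Suc.prems by (intro frechet_derivative_eqI has_derivative_add)
      (auto simp flip: frechet_derivative_works)
  with Suc show ?case by simp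
qed

lemma cont_diff_mult: "cont_diff k f \<Longrightarrow> cont_diff k g \<Longrightarrow> cont_diff k (\<lambda>x. f x * g x)"
proof (induction k arbitrary: f g)
  case 0
  then show ?case by (auto intro: continuous_intros)
next
  case (Suc k)
  have "frechet_derivative (\<lambda>x. f x * g x) (at x) =
      (\<lambda>h. f x * frechet_derivative g (at x) h + frechet_derivative f (at x) h * g x)" for x
    using Suc.prems by (intro frechet_derivative_eqI has_derivative_mult)
      (auto simp flip: frechet_derivative_works)
  moreover have "cont_diff k f" "cont_diff k g"
    using Suc.prems by (simp_all only: cont_diff_Suc_imp)
  ultimately show ?case using Suc by (simp add: cont_diff_add)
qed

lemma frechet_derivative_compose_real:
  fixes h :: "real \<Rightarrow> real"
  assumes "(h has_real_derivative h') (at (f x))" "f differentiable (at x)"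
  shows "((\<lambda>x. h (f x)) has_derivative (\<lambda>v. h' * frechet_derivative f (at x) v)) (at x)"
proof -
  have f: "(f has_derivative frechet_derivative f (at x)) (at x)"
    using assms(2) by (simp only: frechet_derivative_works)
  have "(h has_derivative (*) h') (at (f x))"
    using assms(1) by (simp only: has_field_derivative_def)
  from has_derivative_compose[OF f this] show ?thesis .
qed

lemma smooth_real_deriv:
  fixes h :: "real \<Rightarrow> real"
  assumes "h differentiable (at t)"
  shows "(h has_real_derivative frechet_derivative h (at t) 1) (at t)"
proof -
  have d: "(h has_derivative frechet_derivative h (at t)) (at t)"
    using assms by (simp only: frechet_derivative_works)
  then have "linear (frechet_derivative h (at t))"
    by (rule has_derivative_linear)
  then have "frechet_derivative h (at t) v = frechet_derivative h (at t) 1 * v" for v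
    using linear_cmul[of "frechet_derivative h (at t)" v 1] by simp
  then have "frechet_derivative h (at t) = (*) (frechet_derivative h (at t) 1)"
    by (rule ext)
  with d show ?thesis unfolding has_field_derivative_def by metis
qed

text \<open>Induction with \<open>h\<close> generalised and \<open>f\<close> fixed: a partial
  derivative of the composite is \<open>h' (f x)\<close> times one of \<open>f\<close>, and the
  induction hypothesis for \<open>h'\<close> covers the first factor.\<close>

lemma cont_diff_compose:
  fixes h :: "real \<Rightarrow> real"
  shows "cont_diff k h \<Longrightarrow> cont_diff k f \<Longrightarrow> cont_diff k (\<lambda>x. h (f x))"
proof (induction k arbitrary: h)
  case 0
  then show ?case by (auto intro: continuous_on_compose2)
next
  case (Suc k)
  define h' where "h' = (\<lambda>t. frechet_derivative h (at t) 1)"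
  have h': "(h has_real_derivative h' t) (at t)" for t
    unfolding h'_def using Suc.prems by (intro smooth_real_deriv) auto
  have d: "((\<lambda>x. h (f x)) has_derivative (\<lambda>v. h' (f x) * frechet_derivative f (at x) v)) (at x)" for x
    using Suc.prems by (intro frechet_derivative_compose_real h') auto
  have "cont_diff k h'" using Suc.prems(1) by (simp add: h'_def)
  moreover have "cont_diff k f" using Suc.prems(2) by (rule cont_diff_Suc_imp)
  ultimately have "cont_diff k (\<lambda>x. h' (f x))" by (rule Suc.IH)
  then have "cont_diff k (\<lambda>x. h' (f x) * frechet_derivative f (at x) i)" if "i \<in> Basis" for i
    using Suc.prems(2) that by (simp add: cont_diff_mult)
  moreover have "(\<lambda>x. h (f x)) differentiable (at x)" for x
    using d differentiable_def by blast
  ultimately show ?case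
    by (simp add: frechet_derivative_eqI[OF d])
qed

lemma cont_diff_linear: 
  assumes "bounded_linear f"
  shows "cont_diff k f"
proof (cases k)
  case 0
  then show ?thesis using assms by (simp add: linear_continuous_on)
next
  case (Suc n)
  have d: "(f has_derivative f) (at x)" for x
    using assms by (simp add: bounded_linear_imp_has_derivative)
  have "(\<lambda>x. frechet_derivative f (at x) i) = (\<lambda>x. f i)" for i
    by (simp add: frechet_derivative_eqI[OF d])
  with Suc show ?thesis using differentiableI[OF d] by (simp add: cont_diff_const)
qed

lemma smooth_const: "smooth (\<lambda>x. c)"
  and smooth_add: "smooth f \<Longrightarrow> smooth g \<Longrightarrow> smooth (\<lambda>x. f x + g x)"
  and smooth_mult: "smooth f \<Longrightarrow> smooth g \<Longrightarrow> smooth (\<lambda>x. f x * g x)"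
  and smooth_linear: "bounded_linear f \<Longrightarrow> smooth f"
  and smooth_compose: "smooth h \<Longrightarrow> smooth f \<Longrightarrow> smooth (\<lambda>x. h (f x))"
  by (simp_all add: smooth_def cont_diff_const cont_diff_add cont_diff_mult cont_diff_linear
      cont_diff_compose)

lemma smooth_diff: "smooth f \<Longrightarrow> smooth g \<Longrightarrow> smooth (\<lambda>x. f x - g x)"
  using smooth_add[of f "\<lambda>x. (-1) * g x"] smooth_mult[OF smooth_const[of "-1"], of g] by simp

lemma smooth_prod:
  "finite I \<Longrightarrow> (\<And>i. i \<in> I \<Longrightarrow> smooth (f i)) \<Longrightarrow> smooth (\<lambda>x. \<Prod>i\<in>I. f i x)"
  by (induction rule: finite_induct) (auto intro: smooth_const smooth_mult)

lemma frechet_derivative_real: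
  fixes h :: "real \<Rightarrow> real"
  shows "(h has_real_derivative d) (at t) \<Longrightarrow> frechet_derivative h (at t) = (\<lambda>v. d * v)"
  by (rule frechet_derivative_eqI) (simp add: has_field_derivative_def)

lemma smooth_antiderivative:
  fixes h :: "real \<Rightarrow> real"
  assumes "\<And>t. (h has_real_derivative h' t) (at t)" and "smooth h'"
  shows "smooth h"
  unfolding smooth_def
proof
  fix k
  have "cont_diff (Suc k) h"
    using assms by (auto simp: frechet_derivative_real[OF assms(1)] smooth_def
        intro: differentiableI has_field_derivative_imp_has_derivative)
  then show "cont_diff k h" by (rule cont_diff_Suc_imp)
qed

subsection \<open>Smooth cut-off functions\<close>

text \<open>The polynomial parameter makes the family closed under differentiation, as an induction
  on the order of differentiability requires; \<open>flat_exp 1\<close> is the classical flat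
  function e^(-1/t).\<close>

definition flat_exp :: "real poly \<Rightarrow> real \<Rightarrow> real" where
  "flat_exp P t = (if t > 0 then poly P (1 / t) * exp (- (1 / t)) else 0)"

lemma poly_exp_tendsto_0: "((\<lambda>s. poly P s * exp (- s)) \<longlongrightarrow> (0::real)) at_top"
proof -
  have "((\<lambda>s. \<Sum>i\<le>degree P. coeff P i * (s ^ i / exp s)) \<longlongrightarrow> (\<Sum>i\<le>degree P. coeff P i * 0)) at_top"
    by (intro tendsto_intros tendsto_power_div_exp_0)
  moreover have "poly P s * exp (- s) = (\<Sum>i\<le>degree P. coeff P i * (s ^ i / exp s))" for s
    by (simp add: poly_altdef exp_minus field_simps sum_distrib_left sum_distrib_right)
  ultimately show ?thesis by simp
qed

lemma flat_exp_tendsto_0: "((\<lambda>t. poly P (1 / t) * exp (- (1 / t))) \<longlongrightarrow> (0::real)) (at_right 0)"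
  using filterlim_compose[OF poly_exp_tendsto_0 filterlim_inverse_at_top_right]
  by (simp add: inverse_eq_divide)

text \<open>With s = 1/t one has d/dt = - s^2 d/ds, which turns P(s) e^(-s) into s^2 (P - P')(s)
  e^(-s); the factor \<open>[:0, 0, 1:]\<close> is s^2. At t = 0 the difference quotient from the
  right is again in the family, with polynomial s P(s), and tends to 0.\<close>

lemma flat_exp_deriv:
  "(flat_exp P has_real_derivative flat_exp ([:0, 0, 1:] * (P - pderiv P)) t) (at t)"
proof -
  consider "t > 0" | "t < 0" | "t = 0" by linarith
  then show ?thesis
  proof cases
    case 1
    have "((\<lambda>t. poly P (1 / t) * exp (- (1 / t))) has_real_derivative
        flat_exp ([:0, 0, 1:] * (P - pderiv P)) t) (at t)"
      using 1 by (auto intro!: derivative_eq_intros poly_DERIV[THEN DERIV_chain2]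
          simp: flat_exp_def field_simps power2_eq_square)
    moreover have "eventually (\<lambda>s. poly P (1 / s) * exp (- (1 / s)) = flat_exp P s) (nhds t)"
      using 1 eventually_nhds_in_open[of "{0<..}" t]
      by (auto elim!: eventually_mono simp: flat_exp_def)
    ultimately show ?thesis by (subst DERIV_cong_ev[symmetric]) auto
  next
    case 2
    have "eventually (\<lambda>s. 0 = flat_exp P s) (nhds t)"
      using 2 eventually_nhds_in_open[of "{..<0}" t]
      by (auto elim!: eventually_mono simp: flat_exp_def)
    moreover have "((\<lambda>t. 0) has_real_derivative flat_exp ([:0, 0, 1:] * (P - pderiv P)) t) (at t)"
      using 2 by (simp add: flat_exp_def)
    ultimately show ?thesis by (subst DERIV_cong_ev[symmetric]) auto
  next
    case 3
    have "((\<lambda>h. flat_exp P h / h) \<longlongrightarrow> 0) (at_right 0)"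
    proof (rule Lim_transform_eventually[OF flat_exp_tendsto_0[of "[:0, 1:] * P"]])
      show "\<forall>\<^sub>F x in at_right 0. poly ([:0, 1:] * P) (1 / x) * exp (- (1 / x)) = flat_exp P x / x"
        by (rule eventually_at_right_less[THEN eventually_mono]) (auto simp: flat_exp_def)
    qed
    moreover have "((\<lambda>h. flat_exp P h / h) \<longlongrightarrow> 0) (at_left 0)"
      by (rule tendsto_eventually) (auto simp: flat_exp_def eventually_at_filter)
    ultimately have "((\<lambda>h. flat_exp P h / h) \<longlongrightarrow> 0) (at 0)"
      using filterlim_split_at by blast
    then show ?thesis using 3 by (simp add: DERIV_def flat_exp_def)
  qed
qed

lemma smooth_flat_exp: "smooth (flat_exp P)"
proof -
  have "cont_diff k (flat_exp P)" for k
  proof (induction k arbitrary: P)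
    case 0
    have "isCont (flat_exp P) x" for x
      by (rule DERIV_isCont[OF flat_exp_deriv])
    then show ?case by (simp add: continuous_on_eq_continuous_at)
  next
    case (Suc k)
    have "flat_exp P differentiable (at x)" for x
      by (rule differentiableI[OF has_field_derivative_imp_has_derivative[OF flat_exp_deriv]])
    then show ?case
      using Suc by (simp add: frechet_derivative_real[OF flat_exp_deriv])
  qed
  then show ?thesis by (simp add: smooth_def)
qed

lemma antiderivative_exists:
  fixes h :: "real \<Rightarrow> real"
  assumes "continuous_on UNIV h"
  obtains H where "\<And>t. (H has_real_derivative h t) (at t)" "H 0 = 0"
proof -
  have "\<And>x. isCont h x" using assms by (simp add: continuous_on_eq_continuous_at)
  then obtain H where H: "\<And>t. (H has_vector_derivative h t) (at t)"
    using einterval_antiderivative[of "-\<infinity>" "\<infinity>" h] by auto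
  show ?thesis
  proof
    show "((\<lambda>t. H t - H 0) has_real_derivative h t) (at t)" for t
      using H[of t] by (auto simp: has_real_derivative_iff_has_vector_derivative intro!: derivative_eq_intros)
  qed simp
qed

lemma zero_derivative_imp_eq:
  fixes H :: "real \<Rightarrow> real"
  assumes "\<And>t. (H has_real_derivative h t) (at t)" "s \<le> t" "\<And>x. s < x \<Longrightarrow> x < t \<Longrightarrow> h x = 0"
  shows "H t = H s"
proof (cases "s = t")
  case False
  have "continuous_on {s..t} H"
    by (rule DERIV_continuous_on[where D=h]) (rule has_field_derivative_at_within[OF assms(1)])
  moreover have "(H has_real_derivative 0) (at x)" if "s < x" "x < t" for x
    using assms(1)[of x] assms(3)[OF that] by simp
  ultimately show ?thesis using False assms(2) by (intro DERIV_isconst_end) auto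
qed simp

text \<open>The step is the normalised antiderivative of a bump \<open>B\<close> that is positive on
  (0, 1) and zero elsewhere. The mean value theorem on [0, 1] shows that the normalising constant
  \<open>H 1\<close> is positive.\<close>

lemma smooth_step_exists:
  obtains S :: "real \<Rightarrow> real" where "smooth S" "\<And>t. 0 \<le> S t" "\<And>t. S t \<le> 1"
    "\<And>t. t \<le> 0 \<Longrightarrow> S t = 0" "\<And>t. t \<ge> 1 \<Longrightarrow> S t = 1"
proof -
  define B where "B t = flat_exp 1 t * flat_exp 1 (1 - t)" for t
  have B: "smooth B" unfolding B_def
    by (intro smooth_mult smooth_flat_exp smooth_compose[OF smooth_flat_exp] smooth_diff
        smooth_const smooth_linear bounded_linear_ident)
  have B0: "B t \<ge> 0" for t by (simp add: B_def flat_exp_def)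
  have Bz: "B t = 0" if "t \<le> 0 \<or> t \<ge> 1" for t using that by (auto simp: B_def flat_exp_def)
  have Bp: "B t > 0" if "0 < t" "t < 1" for t using that by (auto simp: B_def flat_exp_def)
  obtain H where H: "\<And>t. (H has_real_derivative B t) (at t)" and H0: "H 0 = 0"
    using antiderivative_exists[OF smooth_imp_continuous[OF B]] by blast
  have mono: "H s \<le> H t" if "s \<le> t" for s t
    by (rule DERIV_nonneg_imp_nondecreasing[OF that]) (use H B0 in blast)
  have low: "H t = 0" if "t \<le> 0" for t
    using zero_derivative_imp_eq[OF H that] Bz H0 by simp
  have high: "H t = H 1" if "t \<ge> 1" for t
    using zero_derivative_imp_eq[OF H that] Bz by simp
  obtain z where "0 < z" "z < 1" "H 1 - H 0 = (1 - 0) * B z"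
    using MVT2[of 0 1 H B] H zero_less_one by blast
  then have H1: "H 1 > 0" using Bp H0 by simp
  show ?thesis
  proof
    show "smooth (\<lambda>t. (1 / H 1) * H t)"
      by (intro smooth_mult smooth_const smooth_antiderivative[OF H B])
    show "0 \<le> (1 / H 1) * H t" for t
      using H1 mono[of 0 t] low[of t] H0 by (cases "t \<le> 0") simp_all
    show "(1 / H 1) * H t \<le> 1" for t
      using H1 mono[of t 1] high[of t] by (cases "t \<le> 1") simp_all
    show "(1 / H 1) * H t = 0" if "t \<le> 0" for t using low[OF that] by simp
    show "(1 / H 1) * H t = 1" if "t \<ge> 1" for t using high[OF that] H1 by simp
  qed
qed

text \<open>A smooth stand-in for the Lipschitz truncation at level \<open>k\<close>, so that
  composing with it keeps test functions test functions. \<open>\<psi>\<close> is the antiderivative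
  of a plateau \<open>\<eta>\<close> that is 1 on [-k, k] and 0 where |t| >= k + 1; the smoothing
  needs this room, hence the bound k + 1 instead of k. The range of \<open>\<eta>\<close> ensures
  that truncation never enlarges a gradient.\<close>

lemma smooth_truncation_exists:
  fixes k :: real assumes "k \<ge> 0"
  obtains \<psi> \<eta> :: "real \<Rightarrow> real" where "smooth \<psi>" "\<And>t. (\<psi> has_real_derivative \<eta> t) (at t)"
    "continuous_on UNIV \<eta>" "\<And>t. 0 \<le> \<eta> t" "\<And>t. \<eta> t \<le> 1" "\<And>t. \<bar>t\<bar> \<le> k \<Longrightarrow> \<eta> t = 1"
    "\<And>t. \<bar>t\<bar> \<le> k \<Longrightarrow> \<psi> t = t" "\<And>t. t \<ge> k \<Longrightarrow> k \<le> \<psi> t \<and> \<psi> t \<le> t"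
    "\<And>t. t \<le> - k \<Longrightarrow> t \<le> \<psi> t \<and> \<psi> t \<le> - k" "\<And>t. \<bar>\<psi> t\<bar> \<le> k + 1"
proof -
  obtain S :: "real \<Rightarrow> real" where S: "smooth S" "\<And>t. 0 \<le> S t" "\<And>t. S t \<le> 1"
    "\<And>t. t \<le> 0 \<Longrightarrow> S t = 0" "\<And>t. t \<ge> 1 \<Longrightarrow> S t = 1"
    using smooth_step_exists by blast
  define \<eta> where "\<eta> t = (1 - S (t - k)) * (1 - S (- t - k))" for t
  have lin: "smooth (\<lambda>t::real. - t)"
    by (intro smooth_linear bounded_linear_minus bounded_linear_ident)
  have eta: "smooth \<eta>" unfolding \<eta>_def
    by (intro smooth_mult smooth_diff smooth_const smooth_compose[OF S(1)] lin
        smooth_linear bounded_linear_ident)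
  have eta0: "0 \<le> \<eta> t" "\<eta> t \<le> 1" for t
    using S(2,3) by (auto simp: \<eta>_def intro: mult_le_one)
  have eta1: "\<eta> t = 1" if "\<bar>t\<bar> \<le> k" for t using that S(4) by (simp add: \<eta>_def)
  have eta2: "\<eta> t = 0" if "\<bar>t\<bar> \<ge> k + 1" for t using that S(5) by (auto simp: \<eta>_def abs_if split: if_splits)
  obtain \<psi> where psi: "\<And>t. (\<psi> has_real_derivative \<eta> t) (at t)" and psi0: "\<psi> 0 = 0"
    using antiderivative_exists[OF smooth_imp_continuous[OF eta]] by blast
  have mono: "\<psi> s \<le> \<psi> t" if "s \<le> t" for s t
    by (rule DERIV_nonneg_imp_nondecreasing[OF that]) (use psi eta0 in blast)
  have lip: "\<psi> t - \<psi> s \<le> t - s" if "s \<le> t" for s t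
  proof -
    have "s - \<psi> s \<le> t - \<psi> t"
      using that psi eta0 by (intro DERIV_nonneg_imp_nondecreasing[of s t "\<lambda>t. t - \<psi> t"])
        (auto intro!: derivative_eq_intros exI)
    then show ?thesis by simp
  qed
  have const: "\<psi> t = \<psi> s" if "s \<le> t" "k + 1 \<le> s \<or> t \<le> - (k + 1)" for s t
    using that by (intro zero_derivative_imp_eq[OF psi] eta2) auto
  have id: "\<psi> t = t" if "\<bar>t\<bar> \<le> k" for t
  proof -
    have "((\<lambda>t. \<psi> t - t) has_real_derivative \<eta> t - 1) (at t)" for t
      by (intro derivative_intros psi)
    then have "\<psi> b - b = \<psi> a - a" if "a \<le> b" "- k \<le> a" "b \<le> k" for a b
      using that eta1 by (intro zero_derivative_imp_eq[of "\<lambda>t. \<psi> t - t" "\<lambda>t. \<eta> t - 1" a b]) auto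
    from this[of 0 t] this[of t 0] show ?thesis using that psi0 by (cases "t < 0") auto
  qed
  have up: "k \<le> \<psi> t \<and> \<psi> t \<le> t" if "t \<ge> k" for t
    using mono[OF that] lip[OF that] id[of k] assms by auto
  have dn: "t \<le> \<psi> t \<and> \<psi> t \<le> - k" if "t \<le> - k" for t
    using mono[OF that] lip[OF that] id[of "- k"] assms by auto
  have ends: "\<bar>\<psi> (k + 1)\<bar> \<le> k + 1" "\<bar>\<psi> (- k - 1)\<bar> \<le> k + 1"
    using up[of "k + 1"] dn[of "- k - 1"] assms by linarith+
  have bnd: "\<bar>\<psi> t\<bar> \<le> k + 1" for t
  proof -
    consider "t \<ge> k + 1" | "t \<le> - k - 1" | "- k - 1 \<le> t" "t \<le> k + 1" by linarith
    then show ?thesis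
    proof cases
      case 1
      then show ?thesis using const[of "k + 1" t] ends(1) by simp
    next
      case 2
      then show ?thesis using const[of t "- k - 1"] ends(2) by simp
    next
      case 3
      then show ?thesis using mono[of "- k - 1" t] mono[of t "k + 1"] ends by linarith
    qed
  qed
  show ?thesis
  proof (rule that[of \<psi> \<eta>])
    show "smooth \<psi>" by (rule smooth_antiderivative[OF psi eta])
    show "continuous_on UNIV \<eta>" by (rule smooth_imp_continuous[OF eta])
  qed (use psi eta0 eta1 id up dn bnd in blast)+
qed

section \<open>Gradients of smooth functions\<close>

definition grad :: "('a::euclidean_space \<Rightarrow> real) \<Rightarrow> 'a \<Rightarrow> 'a" where
  "grad f x = (\<Sum>i\<in>Basis. frechet_derivative f (at x) i *\<^sub>R i)"

lemma grad_inner: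
  fixes f :: "'a::euclidean_space \<Rightarrow> real"
  assumes "f differentiable (at x)"
  shows "frechet_derivative f (at x) v = grad f x \<bullet> v"
proof -
  have lin: "linear (frechet_derivative f (at x))"
    using assms linear_frechet_derivative by blast
  have "frechet_derivative f (at x) v
      = frechet_derivative f (at x) (\<Sum>i\<in>Basis. (v \<bullet> i) *\<^sub>R i)"
    by (simp only: euclidean_representation)
  also have "\<dots> = (\<Sum>i\<in>Basis. (v \<bullet> i) * frechet_derivative f (at x) i)"
    using lin by (simp add: linear_sum linear_cmul)
  also have "\<dots> = grad f x \<bullet> v"
    unfolding grad_def by (simp add: inner_sum_right mult.commute inner_commute)
  finally show ?thesis .
qed

lemma grad_eqI:
  fixes f :: "'a::euclidean_space \<Rightarrow> real"
  assumes "(f has_derivative (\<lambda>v. G \<bullet> v)) (at x)"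
  shows "grad f x = G"
  unfolding grad_def frechet_derivative_eqI[OF assms] by (rule euclidean_representation)

lemma smooth_has_grad:
  assumes "smooth f"
  shows "(f has_derivative (\<lambda>v. grad f x \<bullet> v)) (at x)"
proof -
  have "frechet_derivative f (at x) = (\<lambda>v. grad f x \<bullet> v)"
    by (rule ext) (rule grad_inner[OF smooth_imp_differentiable[OF assms]])
  then show ?thesis using smooth_has_derivative[OF assms, of x] by (simp only:)
qed

lemma grad_add: "smooth f \<Longrightarrow> smooth g \<Longrightarrow> grad (\<lambda>x. f x + g x) x = grad f x + grad g x"
  by (rule grad_eqI) (auto intro!: derivative_eq_intros smooth_has_grad simp: inner_add_left)

lemma grad_cmult: "smooth f \<Longrightarrow> grad (\<lambda>x. c * f x) x = c *\<^sub>R grad f x"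
  by (rule grad_eqI) (auto intro!: derivative_eq_intros smooth_has_grad)

lemma grad_mult:
  "smooth f \<Longrightarrow> smooth g \<Longrightarrow> grad (\<lambda>x. f x * g x) x = f x *\<^sub>R grad g x + g x *\<^sub>R grad f x"
  by (rule grad_eqI) (auto intro!: derivative_eq_intros smooth_has_grad simp: inner_add_left)

lemma grad_compose:
  fixes h :: "real \<Rightarrow> real"
  assumes "(h has_real_derivative h') (at (f x))" "smooth f"
  shows "grad (\<lambda>x. h (f x)) x = h' *\<^sub>R grad f x"
  by (rule grad_eqI)
    (use frechet_derivative_compose_real[of h h' f x, OF assms(1) smooth_imp_differentiable[OF assms(2)]]
      in \<open>simp add: grad_inner smooth_imp_differentiable assms\<close>)

lemma continuous_grad: "smooth f \<Longrightarrow> continuous_on S (grad f)"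
  unfolding grad_def
  by (intro continuous_intros smooth_imp_continuous smooth_partial)

lemma grad_zero_outside:
  assumes "closed C" "\<And>x. x \<notin> C \<Longrightarrow> f x = 0" "x \<notin> C"
  shows "grad f x = 0"
proof (rule grad_eqI)
  have "((\<lambda>x. 0::real) has_derivative (\<lambda>v. 0)) (at x)" by simp
  then have "(f has_derivative (\<lambda>v. 0)) (at x)"
    by (rule has_derivative_transform_within_open[where s="- C"]) (use assms in auto)
  then show "(f has_derivative (\<lambda>v. 0 \<bullet> v)) (at x)" by simp
qed

lemma line_derivative:
  assumes "smooth f"
  shows "((\<lambda>t. f (x + t *\<^sub>R v)) has_real_derivative grad f (x + t *\<^sub>R v) \<bullet> v) (at t)"
proof -
  have "((\<lambda>t. x + t *\<^sub>R v) has_derivative (\<lambda>h. h *\<^sub>R v)) (at t)"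
    by (auto intro!: derivative_eq_intros)
  from has_derivative_compose[OF this smooth_has_grad[OF assms]]
  have "((\<lambda>t. f (x + t *\<^sub>R v)) has_derivative (\<lambda>h. grad f (x + t *\<^sub>R v) \<bullet> (h *\<^sub>R v))) (at t)" .
  moreover have "(\<lambda>h. grad f (x + t *\<^sub>R v) \<bullet> (h *\<^sub>R v)) = (*) (grad f (x + t *\<^sub>R v) \<bullet> v)"
    by (rule ext) simp
  ultimately show ?thesis by (simp only: has_field_derivative_def)
qed

subsection \<open>Test functions\<close>

lemma test_functions_iff:
  "\<phi> \<in> test_functions \<Omega> \<longleftrightarrow> smooth \<phi> \<and> (\<exists>C. compact C \<and> C \<subseteq> \<Omega> \<and> (\<forall>x. x \<notin> C \<longrightarrow> \<phi> x = 0))"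
proof safe
  assume "\<phi> \<in> test_functions \<Omega>"
  then show "smooth \<phi>" "\<exists>C. compact C \<and> C \<subseteq> \<Omega> \<and> (\<forall>x. x \<notin> C \<longrightarrow> \<phi> x = 0)"
    using closure_subset[of "{x. \<phi> x \<noteq> 0}"]
    by (auto simp: test_functions_def smooth_def intro!: exI[of _ "closure {x. \<phi> x \<noteq> 0}"])
next
  fix C assume C: "smooth \<phi>" "compact C" "C \<subseteq> \<Omega>" "\<forall>x. x \<notin> C \<longrightarrow> \<phi> x = 0"
  have "closure {x. \<phi> x \<noteq> 0} \<subseteq> C"
    using C by (intro closure_minimal) (auto intro: compact_imp_closed)
  moreover from this have "compact (closure {x. \<phi> x \<noteq> 0})"
    using compact_Int_closed[OF C(2) closed_closure, of "{x. \<phi> x \<noteq> 0}"] by (simp add: Int_absorb1)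
  ultimately show "\<phi> \<in> test_functions \<Omega>"
    using C by (auto simp: test_functions_def smooth_def)
qed

lemma test_functionsE:
  assumes "\<phi> \<in> test_functions \<Omega>"
  obtains C where "smooth \<phi>" "compact C" "C \<subseteq> \<Omega>" "\<And>x. x \<notin> C \<Longrightarrow> \<phi> x = 0" "\<And>x. x \<notin> C \<Longrightarrow> grad \<phi> x = 0"
  using assms grad_zero_outside compact_imp_closed unfolding test_functions_iff by metis

lemma test_functions_smooth: "\<phi> \<in> test_functions \<Omega> \<Longrightarrow> smooth \<phi>"
  by (simp add: test_functions_iff)

lemma test_functions_zero: "(\<lambda>x. 0) \<in> test_functions \<Omega>"
  by (auto simp: test_functions_iff smooth_const intro!: exI[of _ "{}"])

lemma test_functions_add:
  assumes "\<phi> \<in> test_functions \<Omega>" "\<psi> \<in> test_functions \<Omega>"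
  shows "(\<lambda>x. \<phi> x + \<psi> x) \<in> test_functions \<Omega>"
proof -
  obtain C where C: "smooth \<phi>" "compact C" "C \<subseteq> \<Omega>" "\<And>x. x \<notin> C \<Longrightarrow> \<phi> x = 0"
      "\<And>x. x \<notin> C \<Longrightarrow> grad \<phi> x = 0"
    using assms(1) by (rule test_functionsE) blast
  obtain D where D: "smooth \<psi>" "compact D" "D \<subseteq> \<Omega>" "\<And>x. x \<notin> D \<Longrightarrow> \<psi> x = 0"
      "\<And>x. x \<notin> D \<Longrightarrow> grad \<psi> x = 0"
    using assms(2) by (rule test_functionsE) blast
  show ?thesis unfolding test_functions_iff
    using C D by (intro conjI smooth_add exI[of _ "C \<union> D"]) (auto simp: compact_Un)
qed

lemma test_functions_mult:
  assumes "\<phi> \<in> test_functions \<Omega>" "smooth \<psi>"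
  shows "(\<lambda>x. \<psi> x * \<phi> x) \<in> test_functions \<Omega>"
proof -
  obtain C where C: "smooth \<phi>" "compact C" "C \<subseteq> \<Omega>" "\<And>x. x \<notin> C \<Longrightarrow> \<phi> x = 0"
      "\<And>x. x \<notin> C \<Longrightarrow> grad \<phi> x = 0"
    using assms(1) by (rule test_functionsE) blast
  show ?thesis unfolding test_functions_iff
    using C assms(2) by (intro conjI smooth_mult exI[of _ C]) simp_all
qed

lemma test_functions_cmult:
  "\<phi> \<in> test_functions \<Omega> \<Longrightarrow> (\<lambda>x. c * \<phi> x) \<in> test_functions \<Omega>"
  using test_functions_mult[OF _ smooth_const] .

lemma test_functions_compose:
  fixes h :: "real \<Rightarrow> real"
  assumes "\<phi> \<in> test_functions \<Omega>" "smooth h" "h 0 = 0"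
  shows "(\<lambda>x. h (\<phi> x)) \<in> test_functions \<Omega>"
proof -
  obtain C where C: "smooth \<phi>" "compact C" "C \<subseteq> \<Omega>" "\<And>x. x \<notin> C \<Longrightarrow> \<phi> x = 0"
      "\<And>x. x \<notin> C \<Longrightarrow> grad \<phi> x = 0"
    using assms(1) by (rule test_functionsE) blast
  have "smooth (\<lambda>x. h (\<phi> x))" using assms(2) C(1) by (rule smooth_compose)
  then show ?thesis unfolding test_functions_iff
    using C assms(3) by (intro conjI exI[of _ C]) simp_all
qed

lemma compact_support_bounded:
  fixes f :: "'a::euclidean_space \<Rightarrow> 'b::real_normed_vector"
  assumes "continuous_on UNIV f" "compact C" "\<And>x. x \<notin> C \<Longrightarrow> f x = 0"
  obtains B where "B > 0" "\<And>x. norm (f x) \<le> B"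
proof -
  have "bounded (f ` C)"
    using assms by (meson compact_continuous_image compact_imp_bounded continuous_on_subset subset_UNIV)
  then obtain B where "B > 0" "\<forall>x\<in>C. norm (f x) \<le> B" unfolding bounded_pos by auto
  moreover from this have "norm (f x) \<le> B" for x
    using assms(3)[of x] by (cases "x \<in> C") auto
  ultimately show ?thesis using that by blast
qed

lemma test_functions_bounded:
  assumes "\<phi> \<in> test_functions \<Omega>"
  obtains B where "B > 0" "\<And>x. \<bar>\<phi> x\<bar> \<le> B" "\<And>x. norm (grad \<phi> x) \<le> B"
proof -
  obtain C where C: "smooth \<phi>" "compact C" "C \<subseteq> \<Omega>" "\<And>x. x \<notin> C \<Longrightarrow> \<phi> x = 0" "\<And>x. x \<notin> C \<Longrightarrow> grad \<phi> x = 0"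
    using assms by (rule test_functionsE) blast
  obtain B1 where "B1 > 0" "\<And>x. norm (\<phi> x) \<le> B1"
    using compact_support_bounded[OF smooth_imp_continuous[OF C(1)] C(2,4)] by blast
  moreover obtain B2 where "B2 > 0" "\<And>x. norm (grad \<phi> x) \<le> B2"
    using compact_support_bounded[OF continuous_grad[OF C(1)] C(2,5)] by blast
  ultimately show ?thesis
    by (intro that[of "max B1 B2"]) (auto simp: le_max_iff_disj)
qed

lemma compact_support_integrable:
  fixes f :: "'a::euclidean_space \<Rightarrow> 'b::euclidean_space"
  assumes "continuous_on UNIV f" "compact C" "\<And>x. x \<notin> C \<Longrightarrow> f x = 0"
  shows "integrable lborel f"
proof -
  have "integrable lborel (\<lambda>x. indicator C x *\<^sub>R f x)"
    using assms by (intro borel_integrable_compact) (auto intro: continuous_on_subset)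
  moreover have "(\<lambda>x. indicator C x *\<^sub>R f x) = f"
    using assms(3) by (auto simp: indicator_def)
  ultimately show ?thesis by simp
qed

lemma integrable_lebesgue_on_iff_lborel:
  fixes f :: "'a::euclidean_space \<Rightarrow> 'b::euclidean_space"
  assumes "f \<in> borel_measurable borel" "\<Omega> \<in> sets lebesgue" "\<And>x. x \<notin> \<Omega> \<Longrightarrow> f x = 0"
  shows "integrable (lebesgue_on \<Omega>) f \<longleftrightarrow> integrable lborel f"
    and "integral\<^sup>L (lebesgue_on \<Omega>) f = integral\<^sup>L lborel f"
proof -
  have eq: "(\<lambda>x. indicator \<Omega> x *\<^sub>R f x) = f" using assms(3) by (auto simp: indicator_def)
  have m: "f \<in> borel_measurable lborel" using assms(1) by simp
  show "integrable (lebesgue_on \<Omega>) f \<longleftrightarrow> integrable lborel f"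
    using assms(2) integrable_completion[OF m] by (subst integrable_restrict_space) (auto simp: eq)
  show "integral\<^sup>L (lebesgue_on \<Omega>) f = integral\<^sup>L lborel f"
    using assms(2) integral_completion[OF m] by (subst integral_restrict_space) (auto simp: eq)
qed

lemma integral_lborel_translation:
  fixes f :: "'a::euclidean_space \<Rightarrow> 'b::{banach, second_countable_topology}"
  assumes "f \<in> borel_measurable borel"
  shows "(LINT x|lborel. f (z + x)) = integral\<^sup>L lborel f"
proof -
  have "integral\<^sup>L (distr lborel borel ((+) z)) f = (LINT x|lborel. f (z + x))"
    using assms by (intro integral_distr) auto
  then show ?thesis by (simp add: lborel_distr_plus)
qed

lemma nn_integral_lborel_translation:
  fixes f :: "'a::euclidean_space \<Rightarrow> ennreal"
  assumes "f \<in> borel_measurable borel"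
  shows "(\<integral>\<^sup>+x. f (z + x) \<partial>lborel) = integral\<^sup>N lborel f"
proof -
  have "integral\<^sup>N (distr lborel borel ((+) z)) f = (\<integral>\<^sup>+x. f (z + x) \<partial>lborel)"
    using assms by (intro nn_integral_distr) auto
  then show ?thesis by (simp add: lborel_distr_plus)
qed

text \<open>The difference quotients of \<open>w\<close> have integral zero by translation invariance.\<close>

lemma integral_partial_eq_0:
  fixes w :: "'a::euclidean_space \<Rightarrow> real"
  assumes w: "smooth w" and C: "compact C" "\<And>x. x \<notin> C \<Longrightarrow> w x = 0"
  shows "(LINT x|lborel. grad w x \<bullet> v) = 0"
proof -
  have gz: "grad w x = 0" if "x \<notin> C" for x
    using grad_zero_outside[OF compact_imp_closed[OF C(1)] C(2) that] .
  obtain B where B: "B > 0" "\<And>x. norm (grad w x) \<le> B"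
    using compact_support_bounded[OF continuous_grad[OF w] C(1) gz] by blast
  obtain R where R: "\<And>x. x \<in> C \<Longrightarrow> norm x \<le> R"
    using compact_imp_bounded[OF C(1)] unfolding bounded_iff by blast
  define D where "D n x = real (Suc n) * (w (x + (1 / real (Suc n)) *\<^sub>R v) - w x)" for n x
  have meas [measurable]: "w \<in> borel_measurable borel" "grad w \<in> borel_measurable borel"
    using smooth_imp_continuous[OF w] continuous_grad[OF w] borel_measurable_continuous_onI by blast+
  have wint: "integrable lborel w"
    by (rule compact_support_integrable[OF smooth_imp_continuous[OF w] C])
  have "(\<lambda>n. integral\<^sup>L lborel (D n)) \<longlonglongrightarrow> (LINT x|lborel. grad w x \<bullet> v)"
  proof (rule integral_dominated_convergence)
    \<comment> \<open>The support of \<open>w\<close> lies within distance \<open>R\<close> of the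
      origin and the increments have length at most |v|, so all difference quotients vanish outside
      this ball; inside it the mean value theorem bounds them by B |v|.\<close>
    show "integrable lborel (\<lambda>x. B * norm v * indicator (cball 0 (R + norm v)) x :: real)"
      by (intro integrable_mult_right integrable_real_indicator)
        (simp_all add: emeasure_bounded_finite[unfolded infinity_ennreal_def])
    show "AE x in lborel. (\<lambda>n. D n x) \<longlonglongrightarrow> grad w x \<bullet> v"
    proof (rule AE_I2)
      fix x
      have "((\<lambda>h. (w (x + h *\<^sub>R v) - w x) / h) \<longlongrightarrow> grad w x \<bullet> v) (at 0)"
        using line_derivative[OF w, of x v 0] by (simp add: DERIV_def)
      moreover have "filterlim (\<lambda>n. 1 / real (Suc n)) (at 0) sequentially"
        by (intro filterlim_atI lim_1_over_n[THEN LIMSEQ_Suc]) auto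
      ultimately have "(\<lambda>n. (w (x + (1 / real (Suc n)) *\<^sub>R v) - w x) / (1 / real (Suc n))) \<longlonglongrightarrow> grad w x \<bullet> v"
        by (rule filterlim_compose)
      then show "(\<lambda>n. D n x) \<longlonglongrightarrow> grad w x \<bullet> v"
        by (simp add: D_def mult.commute)
    qed
    show "AE x in lborel. norm (D n x) \<le> B * norm v * indicator (cball 0 (R + norm v)) x" for n
    proof (rule AE_I2)
      fix x
      let ?h = "1 / real (Suc n)"
      show "norm (D n x) \<le> B * norm v * indicator (cball 0 (R + norm v)) x"
      proof (cases "x \<in> cball 0 (R + norm v)")
        case True
        obtain z where "w (x + ?h *\<^sub>R v) - w (x + 0 *\<^sub>R v) = (?h - 0) * (grad w (x + z *\<^sub>R v) \<bullet> v)"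
          using MVT2[of 0 ?h "\<lambda>t. w (x + t *\<^sub>R v)" "\<lambda>t. grad w (x + t *\<^sub>R v) \<bullet> v"]
            line_derivative[OF w, of x v] by auto
        then have "D n x = grad w (x + z *\<^sub>R v) \<bullet> v" by (simp add: D_def)
        also have "\<bar>\<dots>\<bar> \<le> norm (grad w (x + z *\<^sub>R v)) * norm v" by (rule Cauchy_Schwarz_ineq2)
        also have "\<dots> \<le> B * norm v" by (intro mult_right_mono B) simp
        finally show ?thesis using True by simp
      next
        case False
        have "norm (?h *\<^sub>R v) \<le> norm v"
          by (simp add: divide_le_eq mult_le_cancel_left1)
        moreover have "norm x \<le> norm (x + ?h *\<^sub>R v) + norm (?h *\<^sub>R v)"
          using norm_triangle_ineq4[of "x + ?h *\<^sub>R v" "?h *\<^sub>R v"] by simp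
        ultimately have "x + ?h *\<^sub>R v \<notin> C" "x \<notin> C"
          using False R[of "x + ?h *\<^sub>R v"] R[of x] norm_ge_zero[of v] by auto
        then show ?thesis using C(2) False by (simp add: D_def)
      qed
    qed
  qed (simp_all add: D_def[abs_def])
  moreover have "integral\<^sup>L lborel (D n) = 0" for n
  proof -
    have "(LINT x|lborel. w ((1 / real (Suc n)) *\<^sub>R v + x)) = integral\<^sup>L lborel w"
      by (rule integral_lborel_translation) simp
    moreover have "integrable lborel (\<lambda>x. w ((1 / real (Suc n)) *\<^sub>R v + x))"
    proof (rule compact_support_integrable)
      show "continuous_on UNIV (\<lambda>x. w ((1 / real (Suc n)) *\<^sub>R v + x))"
        by (intro continuous_on_compose2[OF smooth_imp_continuous[OF w, of UNIV]] continuous_intros) auto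
      show "compact ((\<lambda>x. x - (1 / real (Suc n)) *\<^sub>R v) ` C)"
        using C(1) by (intro compact_continuous_image continuous_intros) auto
      show "w ((1 / real (Suc n)) *\<^sub>R v + x) = 0" if "x \<notin> (\<lambda>x. x - (1 / real (Suc n)) *\<^sub>R v) ` C" for x
        using that by (intro C(2)) (metis add_diff_cancel_left' image_eqI)
    qed
    ultimately show ?thesis
      using wint by (simp add: D_def[abs_def] add.commute Bochner_Integration.integral_diff)
  qed
  ultimately show ?thesis by (simp add: LIMSEQ_const_iff)
qed

text \<open>The product of the two functions is smooth with compact support, so its directional
  derivative integrates to zero over the whole space. As \<open>\<phi>\<close> vanishes outside the
  domain, the integrals over \<open>\<Omega>\<close> and over the whole space agree.\<close>

lemma integration_by_parts:
  assumes "\<Omega> \<in> sets lebesgue" and \<phi>: "\<phi> \<in> test_functions \<Omega>" and \<psi>: "smooth \<psi>"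
  shows "(LINT x|lebesgue_on \<Omega>. \<psi> x * (grad \<phi> x \<bullet> v)) = - (LINT x|lebesgue_on \<Omega>. (grad \<psi> x \<bullet> v) * \<phi> x)"
proof -
  obtain C where C: "smooth \<phi>" "compact C" "C \<subseteq> \<Omega>" "\<And>x. x \<notin> C \<Longrightarrow> \<phi> x = 0" "\<And>x. x \<notin> C \<Longrightarrow> grad \<phi> x = 0"
    using \<phi> by (rule test_functionsE) blast
  have c1: "continuous_on UNIV (\<lambda>x. \<psi> x * (grad \<phi> x \<bullet> v))" 
    and c2: "continuous_on UNIV (\<lambda>x. (grad \<psi> x \<bullet> v) * \<phi> x)"
    by (intro continuous_intros smooth_imp_continuous continuous_grad C(1) \<psi>)+
  note i1 = compact_support_integrable[OF c1 C(2)] and i2 = compact_support_integrable[OF c2 C(2)]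
  have "(LINT x|lborel. grad (\<lambda>x. \<psi> x * \<phi> x) x \<bullet> v) = 0"
    by (rule integral_partial_eq_0[OF smooth_mult[OF \<psi> C(1)] C(2)]) (simp add: C)
  then have "(LINT x|lborel. \<psi> x * (grad \<phi> x \<bullet> v) + (grad \<psi> x \<bullet> v) * \<phi> x) = 0"
    by (simp add: grad_mult \<psi> C(1) inner_add_left mult.commute add.commute)
  then have "(LINT x|lborel. \<psi> x * (grad \<phi> x \<bullet> v)) = - (LINT x|lborel. (grad \<psi> x \<bullet> v) * \<phi> x)"
    using i1 i2 C by (simp add: Bochner_Integration.integral_add)
  moreover have out: "\<phi> x = 0" "grad \<phi> x = 0" if "x \<notin> \<Omega>" for x
    using that C(3) by (auto intro: C)
  moreover have "(LINT x|lebesgue_on \<Omega>. \<psi> x * (grad \<phi> x \<bullet> v)) = (LINT x|lborel. \<psi> x * (grad \<phi> x \<bullet> v))"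
    using assms(1) c1 by (intro integrable_lebesgue_on_iff_lborel borel_measurable_continuous_onI) (simp_all add: out)
  moreover have "(LINT x|lebesgue_on \<Omega>. (grad \<psi> x \<bullet> v) * \<phi> x) = (LINT x|lborel. (grad \<psi> x \<bullet> v) * \<phi> x)"
    using assms(1) c2 by (intro integrable_lebesgue_on_iff_lborel borel_measurable_continuous_onI) (simp_all add: out)
  ultimately show ?thesis by simp
qed

subsection \<open>Power inequalities\<close>

lemma norm_power_field: "norm (power_field p v) = norm v powr (p - 1)"
proof (cases "v = 0")
  case False
  have "norm (power_field p v) = norm v powr (p - 2) * norm v powr 1"
    by (simp add: power_field_def)
  also have "\<dots> = norm v powr ((p - 2) + 1)" by (simp only: powr_add)
  also have "\<dots> = norm v powr (p - 1)" by simp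
  finally show ?thesis .
qed (simp add: power_field_def)

lemma power_field_inner_self: "power_field p v \<bullet> v = norm v powr p"
proof (cases "v = 0")
  case False
  have "power_field p v \<bullet> v = norm v powr (p - 2) * norm v powr 2"
    using False by (simp add: power_field_def power2_norm_eq_inner)
  also have "\<dots> = norm v powr ((p - 2) + 2)" by (simp only: powr_add)
  also have "\<dots> = norm v powr p" by simp
  finally show ?thesis .
qed (simp add: power_field_def)

text \<open>Young's inequality for |w| and |v|^(p-1), with \<open>q\<close> the conjugate exponent,
  combined with Cauchy-Schwarz. This is the convexity of |v|^p in subgradient form; it later yields
  the Lipschitz bound for powers and the one-sided expansions of both the singular term and the
  Dirichlet integral.\<close>

lemma norm_powr_subgradient:
  fixes v w :: "'a::real_inner"
  assumes "1 < p"
  shows "norm v powr p + p * (power_field p v \<bullet> (w - v)) \<le> norm w powr p"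
proof -
  define q where "q = p / (p - 1)"
  have "q > 1" "1 / p + 1 / q = 1" using assms by (auto simp: q_def field_simps)
  then have "norm w * norm v powr (p - 1) \<le> norm w powr p / p + (norm v powr (p - 1)) powr q / q"
    using assms by (intro Youngs_inequality) auto
  also have "(norm v powr (p - 1)) powr q = norm v powr p"
    using assms by (simp add: powr_powr q_def)
  finally have "p * (norm w * norm v powr (p - 1)) \<le> p * (norm w powr p / p + norm v powr p / q)"
    using assms by (intro mult_left_mono) auto
  also have "\<dots> = norm w powr p + (p - 1) * norm v powr p"
    using assms by (simp add: q_def field_simps)
  finally have "p * (norm w * norm v powr (p - 1)) \<le> norm w powr p + (p - 1) * norm v powr p" .
  moreover have "p * (power_field p v \<bullet> w) \<le> p * (norm v powr (p - 1) * norm w)"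
    using assms norm_cauchy_schwarz[of "power_field p v" w]
    by (intro mult_left_mono) (auto simp: norm_power_field)
  ultimately show ?thesis
    by (simp add: inner_diff_right power_field_inner_self algebra_simps)
qed

text \<open>The mean value theorem on the two halves of [x, y], together with strict monotonicity of
  the derivative p z^(p-1), which holds since p > 1.\<close>

lemma powr_midpoint_less:
  fixes x y p :: real
  assumes "1 < p" "0 \<le> x" "x < y"
  shows "((x + y) / 2) powr p < (x powr p + y powr p) / 2"
proof -
  define m where "m = (x + y) / 2"
  have m: "x < m" "m < y" using assms by (auto simp: m_def)
  have mvt: "\<exists>z>a. z < b \<and> b powr p - a powr p = (p * z powr (p - 1)) * (b - a)"
    if "0 \<le> a" "a < b" for a b
  proof -
    have "continuous_on {a..b} (\<lambda>t. t powr p)"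
      using that assms by (intro continuous_on_powr' continuous_intros) auto
    moreover have "((\<lambda>t. t powr p) has_derivative (*) (p * z powr (p - 1))) (at z)"
      if "a < z" "z < b" for z
      using has_real_derivative_powr[of z p] that \<open>0 \<le> a\<close>
      by (simp add: has_field_derivative_def)
    ultimately obtain z where "a < z" "z < b" "b powr p - a powr p = (p * z powr (p - 1)) * (b - a)"
      using mvt[of a b "\<lambda>t. t powr p" "\<lambda>z. (*) (p * z powr (p - 1))"] \<open>a < b\<close> by blast
    then show ?thesis by blast
  qed
  obtain z1 where z1: "x < z1" "z1 < m" "m powr p - x powr p = (p * z1 powr (p - 1)) * (m - x)"
    using mvt[of x m] assms m by blast
  obtain z2 where z2: "m < z2" "z2 < y" "y powr p - m powr p = (p * z2 powr (p - 1)) * (y - m)"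
    using mvt[of m y] assms m by fastforce
  have "z1 powr (p - 1) < z2 powr (p - 1)"
    using assms z1 z2 by (intro powr_less_mono2) auto
  then have "(p * z1 powr (p - 1)) * (m - x) < (p * z2 powr (p - 1)) * (m - x)"
    using assms m by (intro mult_strict_right_mono) auto
  moreover have "y - m = m - x" by (simp add: m_def field_simps)
  ultimately have "m powr p - x powr p < y powr p - m powr p" using z1(3) z2(3) by simp
  then show ?thesis by (simp add: m_def field_simps)
qed

text \<open>The defect in the midpoint convexity of |v|^p. Its integral over the gradients of two
  almost minimizers is the quantity that the energy comparison controls.\<close>

definition convexity_gap :: "real \<Rightarrow> 'a::real_inner \<Rightarrow> 'a \<Rightarrow> real" where
  "convexity_gap p a b = (norm a powr p + norm b powr p) / 2 - norm ((1 / 2) *\<^sub>R (a + b)) powr p"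

text \<open>For equal norms the parallelogram law makes the midpoint strictly shorter; for different
  norms the triangle inequality reduces the claim to strict convexity of the scalar power.\<close>

lemma convexity_gap_pos:
  assumes "1 < p" "a \<noteq> b"
  shows "convexity_gap p a b > 0"
proof (cases "norm a = norm b")
  case True
  have "(norm (a + b))\<^sup>2 + (norm (a - b))\<^sup>2 = 2 * (norm a)\<^sup>2 + 2 * (norm b)\<^sup>2"
    by (simp add: power2_norm_eq_inner inner_add_left inner_add_right inner_diff_left inner_diff_right)
  moreover have "(norm (a - b))\<^sup>2 > 0" using assms by simp
  moreover have "(2 * norm a)\<^sup>2 = 2 * (norm a)\<^sup>2 + 2 * (norm b)\<^sup>2"
    by (simp add: power_mult_distrib True)
  ultimately have "(norm (a + b))\<^sup>2 < (2 * norm a)\<^sup>2"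
    by linarith
  then have "norm (a + b) < 2 * norm a" by (rule power2_less_imp_less) simp
  then have "norm ((1 / 2) *\<^sub>R (a + b)) powr p < norm a powr p"
    using assms by (intro powr_less_mono2) auto
  then show ?thesis using True by (simp add: convexity_gap_def)
next
  case False
  have "norm ((1 / 2) *\<^sub>R (a + b)) \<le> (norm a + norm b) / 2"
    using norm_triangle_ineq[of a b] by simp
  then have "norm ((1 / 2) *\<^sub>R (a + b)) powr p \<le> ((norm a + norm b) / 2) powr p"
    using assms by (intro powr_mono2) auto
  also have "\<dots> < (norm a powr p + norm b powr p) / 2"
    using powr_midpoint_less[OF assms(1), of "norm a" "norm b"]
      powr_midpoint_less[OF assms(1), of "norm b" "norm a"] False
    by (cases "norm a < norm b") (auto simp: add.commute)
  finally show ?thesis by (simp add: convexity_gap_def)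
qed

lemma convexity_gap_nonneg:
  assumes "1 < p"
  shows "convexity_gap p a b \<ge> 0"
proof (cases "a = b")
  case True
  have "(1 / 2) *\<^sub>R (b + b) = b" by (simp flip: scaleR_2)
  with True show ?thesis by (simp add: convexity_gap_def)
next
  case False
  show ?thesis using convexity_gap_pos[OF assms False] by (rule less_imp_le)
qed

lemma continuous_on_norm_powr:
  fixes f :: "'a::topological_space \<Rightarrow> 'b::real_normed_vector"
  assumes "0 < p" "continuous_on S f"
  shows "continuous_on S (\<lambda>x. norm (f x) powr p)"
  using assms by (intro continuous_on_powr' continuous_on_norm continuous_on_const) auto

text \<open>By homogeneity it suffices to bound the gap from below on a compact subset of the unit sphere.\<close>

lemma uniform_convexity:
  fixes p \<epsilon> :: real
  assumes "1 < p" "0 < \<epsilon>"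
  obtains C where "C \<ge> 0" "\<And>a b :: 'a::euclidean_space.
    norm (a - b) powr p \<le> \<epsilon> * (norm a powr p + norm b powr p) + C * convexity_gap p a b"
proof -
  define gap where "gap z = convexity_gap p (fst z) (snd z)" for z :: "'a \<times> 'a"
  define h where "h z = norm (fst z - snd z) powr p - \<epsilon> * (norm (fst z) powr p + norm (snd z) powr p)"
    for z :: "'a \<times> 'a"
  \<comment> \<open>Where \<open>h\<close> is negative the epsilon term alone suffices, so only the
    points of \<open>S\<close> need a lower bound for the gap. On the diagonal \<open>h\<close> is
    negative except at the origin; hence the compact set \<open>S\<close> avoids the diagonal and
    the gap is positive on it.\<close>
  define S where "S = sphere 0 1 \<inter> {z. h z \<ge> 0}"
  have ch: "continuous_on UNIV h" unfolding h_def
    using assms by (intro continuous_intros continuous_on_norm_powr) auto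
  have cg: "continuous_on UNIV gap" unfolding gap_def convexity_gap_def
    using assms by (intro continuous_intros continuous_on_norm_powr) auto
  have "closed {z. h z \<ge> 0}"
    using ch by (intro closed_Collect_le continuous_on_const)
  then have S: "compact S" unfolding S_def by (intro compact_Int_closed compact_sphere)
  have gap0: "gap z > 0" if "z \<in> S" for z
  proof -
    have "z \<noteq> 0" using that by (auto simp: S_def)
    have "fst z \<noteq> snd z"
    proof
      assume eq: "fst z = snd z"
      with \<open>z \<noteq> 0\<close> have "fst z \<noteq> 0" "snd z \<noteq> 0" by (auto simp: prod_eq_iff)
      then have "\<epsilon> * (norm (fst z) powr p + norm (snd z) powr p) > 0"
        using assms by (intro mult_pos_pos add_pos_pos) auto
      then show False using that eq assms by (auto simp: S_def h_def)
    qed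
    then show ?thesis unfolding gap_def by (rule convexity_gap_pos[OF assms(1)])
  qed
  obtain \<delta> where \<delta>: "\<delta> > 0" "\<And>z. z \<in> S \<Longrightarrow> \<delta> \<le> gap z"
  proof (cases "S = {}")
    case False
    obtain z where "z \<in> S" "\<forall>y\<in>S. gap z \<le> gap y"
      using continuous_attains_inf[OF S False continuous_on_subset[OF cg]] by blast
    then show ?thesis using that[of "gap z"] gap0 by blast
  qed (use that[of 1] in simp)
  \<comment> \<open>For r = |(a, b)| homogeneity gives a gap of at least \<delta> r^p, while |a - b|
    <= 2 r; this is the origin of the constant 2^p / \<delta>.\<close>
  show ?thesis
  proof (rule that[of "2 powr p / \<delta>"])
    show "2 powr p / \<delta> \<ge> 0" using \<delta> by simp
    fix a b :: 'a
    have gap_nn: "convexity_gap p a b \<ge> 0" by (rule convexity_gap_nonneg[OF assms(1)])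
    show "norm (a - b) powr p \<le> \<epsilon> * (norm a powr p + norm b powr p) + 2 powr p / \<delta> * convexity_gap p a b"
    proof (cases "h (a, b) \<ge> 0 \<and> (a, b) \<noteq> 0")
      case True
      define r where "r = norm (a, b)"
      have r: "r > 0" using True by (simp add: r_def)
      have sc: "norm ((1 / r) *\<^sub>R x) powr p = (1 / r) powr p * norm x powr p" for x :: 'a
        using r by (simp add: powr_mult divide_inverse)
      have h_sc: "h ((1 / r) *\<^sub>R (a, b)) = (1 / r) powr p * h (a, b)"
        unfolding h_def scaleR_Pair fst_conv snd_conv scaleR_diff_right[symmetric] sc
        by (simp add: right_diff_distrib distrib_left)
      have "(1 / r) *\<^sub>R (a, b) \<in> S"
      proof -
        have "norm ((1 / r) *\<^sub>R (a, b)) = 1"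
          unfolding norm_scaleR r_def[symmetric] using r by simp
        then show ?thesis unfolding S_def using h_sc True by (simp del: scaleR_Pair)
      qed
      then have "\<delta> \<le> gap ((1 / r) *\<^sub>R (a, b))" by (rule \<delta>)
      also have "\<dots> = (1 / r) powr p * convexity_gap p a b"
      proof -
        have "(1 / 2) *\<^sub>R ((1 / r) *\<^sub>R a + (1 / r) *\<^sub>R b) = (1 / r) *\<^sub>R ((1 / 2) *\<^sub>R (a + b))"
          by (simp add: scaleR_add_right mult.commute)
        then show ?thesis
          unfolding gap_def convexity_gap_def scaleR_Pair fst_conv snd_conv
          by (simp only: sc) (simp add: right_diff_distrib distrib_left)
      qed
      finally have "\<delta> * r powr p \<le> (1 / r) powr p * convexity_gap p a b * r powr p"
        using r by (intro mult_right_mono) auto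
      also have "\<dots> = convexity_gap p a b"
        using r by (simp add: powr_divide)
      finally have *: "\<delta> * r powr p \<le> convexity_gap p a b" .
      have "norm (a - b) \<le> norm a + norm b" by (rule norm_triangle_ineq4)
      also have "\<dots> \<le> 2 * r"
        using norm_fst_le[of a b] norm_snd_le[of b a] by (simp add: r_def)
      finally have "norm (a - b) powr p \<le> (2 * r) powr p"
        using assms by (intro powr_mono2) auto
      also have "\<dots> = 2 powr p / \<delta> * (\<delta> * r powr p)"
        using r \<delta> by (simp add: powr_mult)
      also have "\<dots> \<le> 2 powr p / \<delta> * convexity_gap p a b"
        using * \<delta> by (intro mult_left_mono) auto
      finally show ?thesis using assms by (smt (verit) mult_nonneg_nonneg powr_ge_zero)
    next
      case False
      have "2 powr p / \<delta> * convexity_gap p a b \<ge> 0" using gap_nn \<delta> by simp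
      moreover have "norm (a - b) powr p \<le> \<epsilon> * (norm a powr p + norm b powr p)"
        using False assms by (auto simp: h_def zero_prod_def)
      ultimately show ?thesis by linarith
    qed
  qed
qed

lemma powr_add_le_two:
  fixes x y p :: real
  assumes "0 < p" "0 \<le> x" "0 \<le> y"
  shows "(x + y) powr p \<le> 2 powr p * (x powr p + y powr p)"
proof -
  have "(x + y) powr p \<le> (2 * max x y) powr p"
    using assms by (intro powr_mono2) auto
  also have "\<dots> = 2 powr p * (max x y) powr p" using assms by (simp add: powr_mult)
  also have "\<dots> \<le> 2 powr p * (x powr p + y powr p)"
    by (intro mult_left_mono) (auto simp: max_def)
  finally show ?thesis .
qed

lemma norm_powr_add_le:
  "0 < p \<Longrightarrow> norm (a + b) powr p \<le> 2 powr p * (norm a powr p + norm b powr p)"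
  using powr_add_le_two[of p "norm a" "norm b"] norm_triangle_ineq[of a b]
  by (smt (verit) norm_ge_zero powr_mono2)

text \<open>Split according to whether y <= \<delta> x, where (1 + \<delta>)^p = 1 + \<epsilon>: a
  small \<open>y\<close> is absorbed by the factor 1 + \<epsilon>, and otherwise x < y / \<delta>,
  so that \<open>y\<close> pays for everything.\<close>

lemma powr_add_le_eps:
  fixes p \<epsilon> :: real
  assumes "0 < p" "0 < \<epsilon>"
  obtains C where "C \<ge> 0" "\<And>x y. 0 \<le> x \<Longrightarrow> 0 \<le> y \<Longrightarrow> (x + y) powr p \<le> (1 + \<epsilon>) * x powr p + C * y powr p"
proof -
  define \<delta> where "\<delta> = (1 + \<epsilon>) powr (1 / p) - 1"
  have "1 powr (1 / p) < (1 + \<epsilon>) powr (1 / p)" using assms by (intro powr_less_mono2) auto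
  then have \<delta>: "\<delta> > 0" by (simp add: \<delta>_def)
  have \<delta>p: "(1 + \<delta>) powr p = 1 + \<epsilon>" using assms by (simp add: \<delta>_def powr_powr)
  show ?thesis
  proof (rule that[of "(1 / \<delta> + 1) powr p"])
    fix x y :: real assume xy: "0 \<le> x" "0 \<le> y"
    show "(x + y) powr p \<le> (1 + \<epsilon>) * x powr p + (1 / \<delta> + 1) powr p * y powr p"
    proof (cases "y \<le> \<delta> * x")
      case True
      then have "(x + y) powr p \<le> ((1 + \<delta>) * x) powr p"
        using xy assms by (intro powr_mono2) (auto simp: algebra_simps)
      also have "\<dots> = (1 + \<epsilon>) * x powr p" using xy \<delta> \<delta>p by (simp add: powr_mult)
      finally show ?thesis by (smt (verit) mult_nonneg_nonneg powr_ge_zero)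
    next
      case False
      then have "(x + y) powr p \<le> ((1 / \<delta> + 1) * y) powr p"
        using xy assms \<delta> by (intro powr_mono2) (auto simp: field_simps)
      also have "\<dots> = (1 / \<delta> + 1) powr p * y powr p" using xy \<delta> by (simp add: powr_mult)
      finally show ?thesis using assms by (smt (verit) mult_nonneg_nonneg powr_ge_zero)
    qed
  qed simp
qed

lemma norm_powr_difference_eps:
  fixes p \<epsilon> :: real
  assumes "0 < p" "0 < \<epsilon>"
  obtains C where "C \<ge> 0" "\<And>a b :: 'a::real_normed_vector.
    \<bar>norm a powr p - norm b powr p\<bar> \<le> \<epsilon> * norm b powr p + C * norm (a - b) powr p"
proof -
  obtain C where C: "C \<ge> 0" "\<And>x y. 0 \<le> x \<Longrightarrow> 0 \<le> y \<Longrightarrow> (x + y) powr p \<le> (1 + \<epsilon>) * x powr p + C * y powr p"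
    using powr_add_le_eps[OF assms] by blast
  have "\<bar>norm a powr p - norm b powr p\<bar> \<le> \<epsilon> * norm b powr p + C * norm (a - b) powr p" for a b :: 'a
  proof -
    have ab: "norm a powr p \<le> (norm b + norm (a - b)) powr p"
      using assms norm_triangle_sub[of a b] by (intro powr_mono2) auto
    have ba: "norm b powr p \<le> (norm a + norm (a - b)) powr p"
      using assms norm_triangle_sub[of b a] by (intro powr_mono2) (auto simp: norm_minus_commute)
    show ?thesis
    proof (cases "norm a \<le> norm b")
      case True
      then have "norm a powr p \<le> norm b powr p" using assms by (intro powr_mono2) auto
      moreover from this have "\<epsilon> * norm a powr p \<le> \<epsilon> * norm b powr p" using assms by simp
      ultimately show ?thesis using ba C(2)[of "norm a" "norm (a - b)"] by (simp add: algebra_simps)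
    next
      case False
      then have "norm b powr p \<le> norm a powr p" using assms by (intro powr_mono2) auto
      then show ?thesis using ab C(2)[of "norm b" "norm (a - b)"] by (simp add: algebra_simps)
    qed
  qed
  with C(1) show ?thesis using that by blast
qed

text \<open>Young's inequality with an explicit constant, by comparing |d| with \<epsilon> |v| in
  the product |v|^(p-1) |d|: the smaller of the two is replaced by the larger. It takes the place of
  Hoelder's inequality in the limit arguments.\<close>

lemma power_field_inner_eps:
  fixes v d :: "'a::real_inner"
  assumes "1 < p" "0 < \<epsilon>"
  shows "\<bar>power_field p v \<bullet> d\<bar> \<le> \<epsilon> * norm v powr p + \<epsilon> powr (1 - p) * norm d powr p"
proof -
  have "\<bar>power_field p v \<bullet> d\<bar> \<le> norm v powr (p - 1) * norm d"
    using Cauchy_Schwarz_ineq2[of "power_field p v" d] by (simp add: norm_power_field)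
  also have "\<dots> \<le> \<epsilon> * norm v powr p + \<epsilon> powr (1 - p) * norm d powr p"
  proof (cases "norm d \<le> \<epsilon> * norm v")
    case True
    then have "norm v powr (p - 1) * norm d \<le> norm v powr (p - 1) * (\<epsilon> * norm v)"
      by (intro mult_left_mono) auto
    also have "\<dots> = \<epsilon> * (norm v powr (p - 1) * norm v powr 1)" by simp
    also have "\<dots> = \<epsilon> * norm v powr p" by (simp only: powr_add[symmetric]) simp
    finally show ?thesis by (smt (verit) mult_nonneg_nonneg powr_ge_zero)
  next
    case False
    then have "norm v powr (p - 1) * norm d \<le> (norm d / \<epsilon>) powr (p - 1) * norm d"
      using assms by (intro mult_right_mono powr_mono2) (auto simp: field_simps)
    also have "\<dots> = (norm d powr (p - 1) * norm d powr 1) / \<epsilon> powr (p - 1)"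
      using assms by (simp add: powr_divide)
    also have "\<dots> = norm d powr p * \<epsilon> powr (- (p - 1))"
      by (simp only: powr_add[symmetric] powr_minus divide_inverse) simp
    finally show ?thesis using assms by (smt (verit) mult.commute mult_nonneg_nonneg powr_ge_zero)
  qed
  finally show ?thesis .
qed

text \<open>The preceding inequality at v = 1. On a finite measure space it serves as the embedding
  of L^p into L^1.\<close>

lemma le_eps_plus_powr:
  fixes d :: real
  assumes "1 < p" "0 < \<epsilon>" "0 \<le> d"
  shows "d \<le> \<epsilon> + \<epsilon> powr (1 - p) * d powr p"
  using power_field_inner_eps[OF assms(1,2), of "1::real" d] assms(3)
  by (simp add: power_field_def)

subsection \<open>Convergence in the mean of order \<open>p\<close>\<close>

text \<open>The common last step of the convergence proofs below: \<open>K\<close> is a fixed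
  integral, \<open>C\<close> may depend on \<epsilon>, and \<open>d\<close> is the integral of the
  p-th power of a difference.\<close>

lemma tendsto_of_eps_bound:
  fixes a d :: "nat \<Rightarrow> real"
  assumes "\<And>\<epsilon>. \<epsilon> > 0 \<Longrightarrow> \<exists>C. \<forall>n. \<bar>a n - l\<bar> \<le> \<epsilon> * K + C * d n" and d: "d \<longlonglongrightarrow> 0"
  shows "a \<longlonglongrightarrow> l"
proof (rule LIMSEQ_I)
  fix r :: real assume r: "r > 0"
  define \<epsilon> where "\<epsilon> = r / (2 * (\<bar>K\<bar> + 1))"
  have e: "\<epsilon> > 0" using r by (simp add: \<epsilon>_def add_nonneg_pos)
  then obtain C where C: "\<And>n. \<bar>a n - l\<bar> \<le> \<epsilon> * K + C * d n" using assms(1) by blast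
  have "\<epsilon> * K \<le> \<epsilon> * (\<bar>K\<bar> + 1)" using e by (intro mult_left_mono) auto
  also have "\<dots> = r / 2" by (simp add: \<epsilon>_def field_simps)
  finally have K: "\<epsilon> * K \<le> r / 2" .
  have "(\<lambda>n. C * d n) \<longlonglongrightarrow> C * 0" by (intro tendsto_intros d)
  then have "(\<lambda>n. C * d n) \<longlonglongrightarrow> 0" by simp
  from LIMSEQ_D[OF this, of "r / 2"] r obtain N where "\<And>n. n \<ge> N \<Longrightarrow> \<bar>C * d n\<bar> < r / 2" by auto
  then have "norm (a n - l) < r" if "n \<ge> N" for n
    using C[of n] K that by (smt (verit) field_sum_of_halves real_norm_def)
  then show "\<exists>N. \<forall>n\<ge>N. norm (a n - l) < r" by blast
qed

locale Lp = finite_measure M for M :: "'c measure" + fixes p :: real assumes p: "1 < p"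
begin

definition Lp_fun :: "('c \<Rightarrow> 'b::euclidean_space) \<Rightarrow> bool" where
  "Lp_fun u \<longleftrightarrow> u \<in> borel_measurable M \<and> integrable M (\<lambda>x. norm (u x) powr p)"

text \<open>No p-th root is taken. As the Bochner integral of a non-integrable function is 0, the
  statement carries information only when the differences lie in L^p.\<close>

definition Lp_lim :: "(nat \<Rightarrow> 'c \<Rightarrow> 'b::euclidean_space) \<Rightarrow> ('c \<Rightarrow> 'b) \<Rightarrow> bool" where
  "Lp_lim u v \<longleftrightarrow> (\<lambda>n. LINT x|M. norm (u n x - v x) powr p) \<longlonglongrightarrow> 0"

lemma Lp_fun_measurable [measurable_dest]: "Lp_fun u \<Longrightarrow> u \<in> borel_measurable M"
  and Lp_fun_integrable: "Lp_fun u \<Longrightarrow> integrable M (\<lambda>x. norm (u x) powr p)"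
  by (auto simp: Lp_fun_def)

lemma Lp_fun_bounded:
  assumes "u \<in> borel_measurable M" "AE x in M. norm (u x) \<le> B"
  shows "Lp_fun u"
  unfolding Lp_fun_def
proof (intro conjI)
  show "integrable M (\<lambda>x. norm (u x) powr p)"
  proof (rule integrable_const_bound)
    show "AE x in M. norm (norm (u x) powr p) \<le> B powr p"
      using assms(2) by eventually_elim (use p in \<open>auto intro: powr_mono2\<close>)
  qed (use assms(1) in measurable)
qed fact

lemma Lp_fun_add:
  assumes "Lp_fun u" "Lp_fun v"
  shows "Lp_fun (\<lambda>x. u x + v x)"
  unfolding Lp_fun_def
proof
  note [measurable] = Lp_fun_measurable[OF assms(1)] Lp_fun_measurable[OF assms(2)]
  show "(\<lambda>x. u x + v x) \<in> borel_measurable M" by measurable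
  show "integrable M (\<lambda>x. norm (u x + v x) powr p)"
  proof (rule Bochner_Integration.integrable_bound)
    show "integrable M (\<lambda>x. 2 powr p * (norm (u x) powr p + norm (v x) powr p))"
      using assms by (auto intro: Lp_fun_integrable)
    show "AE x in M. norm (norm (u x + v x) powr p) \<le> norm (2 powr p * (norm (u x) powr p + norm (v x) powr p))"
      using norm_powr_add_le[of p] p by (intro AE_I2) (simp add: abs_mult)
  qed measurable
qed

lemma Lp_fun_scaleR:
  assumes "Lp_fun u" shows "Lp_fun (\<lambda>x. c *\<^sub>R u x)"
  using assms unfolding Lp_fun_def by (auto simp: powr_mult)

lemma Lp_fun_diff:
  assumes "Lp_fun u" "Lp_fun v"
  shows "Lp_fun (\<lambda>x. u x - v x)"
  using Lp_fun_add[OF assms(1) Lp_fun_scaleR[OF assms(2), of "-1"]] by simp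

lemma Lp_fun_imp_integrable:
  assumes "Lp_fun u" shows "integrable M u"
proof (rule Bochner_Integration.integrable_bound)
  show "integrable M (\<lambda>x. 1 + norm (u x) powr p)"
    using assms by (auto intro: Lp_fun_integrable)
  show "AE x in M. norm (u x) \<le> norm (1 + norm (u x) powr p)"
    using le_eps_plus_powr[OF p zero_less_one] by (intro AE_I2) simp
qed (use assms in measurable)

lemma integral_norm_le_eps:
  assumes "Lp_fun u" "0 < \<epsilon>"
  shows "(LINT x|M. norm (u x)) \<le> \<epsilon> * measure M (space M) + \<epsilon> powr (1 - p) * (LINT x|M. norm (u x) powr p)"
proof -
  have "(LINT x|M. norm (u x)) \<le> (LINT x|M. \<epsilon> + \<epsilon> powr (1 - p) * norm (u x) powr p)"
    using assms le_eps_plus_powr[OF p assms(2)]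
    by (intro integral_mono Bochner_Integration.integrable_add integrable_mult_right)
      (auto intro: Lp_fun_integrable Lp_fun_imp_integrable)
  also have "\<dots> = \<epsilon> * measure M (space M) + \<epsilon> powr (1 - p) * (LINT x|M. norm (u x) powr p)"
    using assms by (subst Bochner_Integration.integral_add) (auto intro: Lp_fun_integrable)
  finally show ?thesis .
qed

lemma Lp_lim_imp_L1:
  assumes "\<And>n. Lp_fun (u n)" "Lp_fun v" "Lp_lim u v"
  shows "(\<lambda>n. LINT x|M. norm (u n x - v x)) \<longlonglongrightarrow> 0"
proof (rule tendsto_of_eps_bound)
  show "(\<lambda>n. LINT x|M. norm (u n x - v x) powr p) \<longlonglongrightarrow> 0" using assms(3) by (simp add: Lp_lim_def)
  show "\<exists>C. \<forall>n. \<bar>(LINT x|M. norm (u n x - v x)) - 0\<bar> \<le> \<epsilon> * measure M (space M) + C * (LINT x|M. norm (u n x - v x) powr p)"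
    if "\<epsilon> > 0" for \<epsilon>
    using integral_norm_le_eps[OF Lp_fun_diff[OF assms(1,2)] that]
    by (intro exI[of _ "\<epsilon> powr (1 - p)"]) (simp add: integral_nonneg_AE)
qed

lemma Lp_lim_norm:
  fixes v :: "'c \<Rightarrow> 'b::euclidean_space"
  assumes "\<And>n. Lp_fun (u n)" "Lp_fun v" "Lp_lim u v"
  shows "(\<lambda>n. LINT x|M. norm (u n x) powr p) \<longlonglongrightarrow> (LINT x|M. norm (v x) powr p)"
proof (rule tendsto_of_eps_bound)
  show "(\<lambda>n. LINT x|M. norm (u n x - v x) powr p) \<longlonglongrightarrow> 0" using assms(3) by (simp add: Lp_lim_def)
  fix \<epsilon> :: real assume \<epsilon>: "\<epsilon> > 0"
  obtain C where C: "\<And>a b :: 'b. \<bar>norm a powr p - norm b powr p\<bar> \<le> \<epsilon> * norm b powr p + C * norm (a - b) powr p"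
    using norm_powr_difference_eps[OF less_trans[OF zero_less_one p] \<epsilon>] by blast
  have "\<bar>(LINT x|M. norm (u n x) powr p) - (LINT x|M. norm (v x) powr p)\<bar>
      \<le> \<epsilon> * (LINT x|M. norm (v x) powr p) + C * (LINT x|M. norm (u n x - v x) powr p)" for n
  proof -
    note i = Lp_fun_integrable[OF assms(1)[of n]] Lp_fun_integrable[OF assms(2)]
      Lp_fun_integrable[OF Lp_fun_diff[OF assms(1)[of n] assms(2)]]
    have "\<bar>(LINT x|M. norm (u n x) powr p) - (LINT x|M. norm (v x) powr p)\<bar>
        = \<bar>LINT x|M. norm (u n x) powr p - norm (v x) powr p\<bar>"
      using i by simp
    also have "\<dots> \<le> (LINT x|M. \<bar>norm (u n x) powr p - norm (v x) powr p\<bar>)"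
      by (rule integral_abs_bound)
    also have "\<dots> \<le> (LINT x|M. \<epsilon> * norm (v x) powr p + C * norm (u n x - v x) powr p)"
      using i C by (intro integral_mono) auto
    also have "\<dots> = \<epsilon> * (LINT x|M. norm (v x) powr p) + C * (LINT x|M. norm (u n x - v x) powr p)"
      using i by (subst Bochner_Integration.integral_add) auto
    finally show ?thesis .
  qed
  then show "\<exists>C. \<forall>n. \<bar>(LINT x|M. norm (u n x) powr p) - (LINT x|M. norm (v x) powr p)\<bar>
      \<le> \<epsilon> * (LINT x|M. norm (v x) powr p) + C * (LINT x|M. norm (u n x - v x) powr p)"
    by blast
qed

lemma power_field_measurable [measurable]:
  fixes u :: "'c \<Rightarrow> 'b::euclidean_space"
  shows "u \<in> borel_measurable M \<Longrightarrow> (\<lambda>x. power_field p (u x)) \<in> borel_measurable M"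
  unfolding power_field_def by measurable

lemma power_field_inner_integrable:
  fixes u v :: "'c \<Rightarrow> 'b::euclidean_space"
  assumes "Lp_fun u" "Lp_fun v"
  shows "integrable M (\<lambda>x. power_field p (u x) \<bullet> v x)"
proof (rule Bochner_Integration.integrable_bound)
  show "integrable M (\<lambda>x. norm (u x) powr p + norm (v x) powr p)"
    using assms by (auto intro: Lp_fun_integrable)
  show "AE x in M. norm (power_field p (u x) \<bullet> v x) \<le> norm (norm (u x) powr p + norm (v x) powr p)"
    using power_field_inner_eps[OF p zero_less_one] by (intro AE_I2) auto
qed (use assms in \<open>measurable\<close>)

lemma Lp_lim_power_field_inner:
  fixes G :: "'c \<Rightarrow> 'b::euclidean_space"
  assumes G: "Lp_fun G" and "\<And>n. Lp_fun (u n)" "Lp_fun v" "Lp_lim u v"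
  shows "(\<lambda>n. LINT x|M. power_field p (G x) \<bullet> u n x) \<longlonglongrightarrow> (LINT x|M. power_field p (G x) \<bullet> v x)"
proof (rule tendsto_of_eps_bound)
  show "(\<lambda>n. LINT x|M. norm (u n x - v x) powr p) \<longlonglongrightarrow> 0" using assms(4) by (simp add: Lp_lim_def)
  fix \<epsilon> :: real assume \<epsilon>: "\<epsilon> > 0"
  have "\<bar>(LINT x|M. power_field p (G x) \<bullet> u n x) - (LINT x|M. power_field p (G x) \<bullet> v x)\<bar>
      \<le> \<epsilon> * (LINT x|M. norm (G x) powr p) + \<epsilon> powr (1 - p) * (LINT x|M. norm (u n x - v x) powr p)" for n
  proof -
    have d: "Lp_fun (\<lambda>x. u n x - v x)" using assms by (intro Lp_fun_diff)
    note i = Lp_fun_integrable[OF G] Lp_fun_integrable[OF d] power_field_inner_integrable[OF G d]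
      power_field_inner_integrable[OF G assms(2)[of n]] power_field_inner_integrable[OF G assms(3)]
    have "\<bar>(LINT x|M. power_field p (G x) \<bullet> u n x) - (LINT x|M. power_field p (G x) \<bullet> v x)\<bar>
        = \<bar>LINT x|M. power_field p (G x) \<bullet> (u n x - v x)\<bar>"
      using i by (simp add: inner_diff_right)
    also have "\<dots> \<le> (LINT x|M. \<bar>power_field p (G x) \<bullet> (u n x - v x)\<bar>)"
      by (rule integral_abs_bound)
    also have "\<dots> \<le> (LINT x|M. \<epsilon> * norm (G x) powr p + \<epsilon> powr (1 - p) * norm (u n x - v x) powr p)"
      using i power_field_inner_eps[OF p \<epsilon>]
      by (intro integral_mono Bochner_Integration.integrable_add integrable_mult_right integrable_abs) auto
    also have "\<dots> = \<epsilon> * (LINT x|M. norm (G x) powr p) + \<epsilon> powr (1 - p) * (LINT x|M. norm (u n x - v x) powr p)"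
      using i by (subst Bochner_Integration.integral_add) auto
    finally show ?thesis .
  qed
  then show "\<exists>C. \<forall>n. \<bar>(LINT x|M. power_field p (G x) \<bullet> u n x) - (LINT x|M. power_field p (G x) \<bullet> v x)\<bar>
      \<le> \<epsilon> * (LINT x|M. norm (G x) powr p) + C * (LINT x|M. norm (u n x - v x) powr p)"
    by blast
qed

lemma Lp_lim_imp_AE_subseq:
  assumes "\<And>n. Lp_fun (u n)" "Lp_fun v" "Lp_lim u v"
  obtains r :: "nat \<Rightarrow> nat" where "strict_mono r" "AE x in M. (\<lambda>n. u (r n) x) \<longlonglongrightarrow> v x"
proof -
  have "integrable M (\<lambda>x. u n x - v x)" for n
    using assms by (intro Lp_fun_imp_integrable Lp_fun_diff)
  from tendsto_L1_AE_subseq[OF this Lp_lim_imp_L1[OF assms]]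
  obtain r :: "nat \<Rightarrow> nat" where r: "strict_mono r" "AE x in M. (\<lambda>n. u (r n) x - v x) \<longlonglongrightarrow> 0" by blast
  show ?thesis
    by (rule that[OF r(1)]) (use r(2) in \<open>eventually_elim, subst (asm) LIM_zero_iff\<close>)
qed

lemma Lp_lim_subseq:
  assumes "Lp_lim u v" "strict_mono r"
  shows "Lp_lim (\<lambda>n. u (r n)) v"
  using LIMSEQ_subseq_LIMSEQ[OF assms(1)[unfolded Lp_lim_def] assms(2)]
  by (simp add: Lp_lim_def o_def)

lemma Lp_lim_dominated:
  assumes [measurable]: "\<And>n. u n \<in> borel_measurable M" "v \<in> borel_measurable M"
    and w: "Lp_fun w" and bd: "\<And>n. AE x in M. norm (u n x - v x) \<le> norm (w x)"
    and lim: "AE x in M. (\<lambda>n. u n x) \<longlonglongrightarrow> v x"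
  shows "Lp_lim u v"
proof -
  have "(\<lambda>n. LINT x|M. norm (u n x - v x) powr p) \<longlonglongrightarrow> (LINT x|M. 0)"
  proof (rule integral_dominated_convergence[OF _ _ Lp_fun_integrable[OF w]])
    show "AE x in M. (\<lambda>n. norm (u n x - v x) powr p) \<longlonglongrightarrow> 0"
      using lim
    proof eventually_elim
      case (elim x)
      then have "(\<lambda>n. norm (u n x - v x)) \<longlonglongrightarrow> 0"
        using LIM_zero tendsto_norm_zero by blast
      then show ?case
        using tendsto_powr'[of "\<lambda>n. norm (u n x - v x)" 0 sequentially "\<lambda>_. p" p] p by simp
    qed
    show "AE x in M. norm (norm (u n x - v x) powr p) \<le> norm (w x) powr p" for n
      using bd[of n] by eventually_elim (use p in \<open>auto intro: powr_mono2\<close>)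
  qed measurable
  then show ?thesis by (simp add: Lp_lim_def)
qed

lemma Lp_lim_trans:
  assumes "\<And>n. Lp_fun (u n)" "\<And>n. Lp_fun (v n)" "Lp_fun w"
    and uv: "(\<lambda>n. LINT x|M. norm (u n x - v n x) powr p) \<longlonglongrightarrow> 0" and vw: "Lp_lim v w"
  shows "Lp_lim u w"
  unfolding Lp_lim_def
proof (rule real_tendsto_sandwich[OF always_eventually always_eventually tendsto_const])
  show "\<forall>n. (0::real) \<le> (LINT x|M. norm (u n x - w x) powr p)" by simp
  show "(\<lambda>n. 2 powr p * ((LINT x|M. norm (u n x - v n x) powr p) + (LINT x|M. norm (v n x - w x) powr p))) \<longlonglongrightarrow> 0"
    using tendsto_mult[OF tendsto_const[of "2 powr p"] tendsto_add[OF uv vw[unfolded Lp_lim_def]]] by simp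
  show "\<forall>n. (LINT x|M. norm (u n x - w x) powr p)
      \<le> 2 powr p * ((LINT x|M. norm (u n x - v n x) powr p) + (LINT x|M. norm (v n x - w x) powr p))"
  proof
    fix n
    note i = Lp_fun_integrable[OF Lp_fun_diff[OF assms(1,2)]] Lp_fun_integrable[OF Lp_fun_diff[OF assms(2,3)]]
      Lp_fun_integrable[OF Lp_fun_diff[OF assms(1,3)]]
    have "(LINT x|M. norm (u n x - w x) powr p)
        \<le> (LINT x|M. 2 powr p * (norm (u n x - v n x) powr p + norm (v n x - w x) powr p))"
    proof (rule integral_mono)
      show "norm (u n x - w x) powr p \<le> 2 powr p * (norm (u n x - v n x) powr p + norm (v n x - w x) powr p)" for x
        using norm_powr_add_le[of p "u n x - v n x" "v n x - w x"] p by simp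
    qed (use i in auto)
    then show "(LINT x|M. norm (u n x - w x) powr p)
        \<le> 2 powr p * ((LINT x|M. norm (u n x - v n x) powr p) + (LINT x|M. norm (v n x - w x) powr p))"
      using i by simp
  qed
qed

text \<open>The Riesz-Fischer argument: the sequence is Cauchy in L^1 because the measure is finite,
  so a subsequence converges almost everywhere; Fatou's lemma along it bounds the distance from
  every late term to the limit.\<close>

lemma Lp_complete:
  fixes u :: "nat \<Rightarrow> 'c \<Rightarrow> 'b::euclidean_space"
  assumes u: "\<And>n. Lp_fun (u n)"
    and cauchy: "\<And>e. e > 0 \<Longrightarrow> \<exists>N. \<forall>m\<ge>N. \<forall>n\<ge>N. (LINT x|M. norm (u m x - u n x) powr p) < e"
  obtains v where "Lp_fun v" "Lp_lim u v"
proof -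
  note [measurable] = Lp_fun_measurable[OF u]
  have "\<exists>N. \<forall>i\<ge>N. \<forall>j\<ge>N. (LINT x|M. norm (u i x - u j x)) < e" if "e > 0" for e
  proof -
    \<comment> \<open>This makes the constant part of \<open>integral_norm_le_eps\<close> at most
      e/2; the added 1 covers a space of measure zero.\<close>
    define \<epsilon> where "\<epsilon> = e / (2 * (measure M (space M) + 1))"
    have pos: "measure M (space M) + 1 > 0" by (simp add: add_nonneg_pos)
    have \<epsilon>: "\<epsilon> > 0" using that pos by (simp add: \<epsilon>_def)
    have "\<epsilon> * measure M (space M) \<le> \<epsilon> * (measure M (space M) + 1)" using \<epsilon> by simp
    also have "\<dots> = e / 2" using pos by (simp add: \<epsilon>_def field_simps)
    finally have small: "\<epsilon> * measure M (space M) \<le> e / 2" .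
    have "e / 2 / \<epsilon> powr (1 - p) > 0" using that \<epsilon> by simp
    then obtain N where N: "\<And>i j. i \<ge> N \<Longrightarrow> j \<ge> N \<Longrightarrow> (LINT x|M. norm (u i x - u j x) powr p) < e / 2 / \<epsilon> powr (1 - p)"
      using cauchy by meson
    have "(LINT x|M. norm (u i x - u j x)) < e" if "i \<ge> N" "j \<ge> N" for i j
    proof -
      have "\<epsilon> powr (1 - p) * (LINT x|M. norm (u i x - u j x) powr p) < e / 2"
        using N[OF that] \<epsilon> by (simp add: pos_less_divide_eq mult.commute)
      then show ?thesis
        using integral_norm_le_eps[OF Lp_fun_diff[OF u u] \<epsilon>, of i j] small by linarith
    qed
    then show ?thesis by blast
  qed
  from cauchy_L1_AE_cauchy_subseq[OF Lp_fun_imp_integrable[OF u] this]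
  obtain r where r: "strict_mono r" "AE x in M. Cauchy (\<lambda>i. u (r i) x)" by blast
  define v where "v x = lim (\<lambda>i. u (r i) x)" for x
  have v [measurable]: "v \<in> borel_measurable M" unfolding v_def by measurable
  have lim: "AE x in M. (\<lambda>i. u (r i) x) \<longlonglongrightarrow> v x"
    using r(2) by eventually_elim (simp add: v_def Cauchy_convergent_iff convergent_LIMSEQ_iff)
  have key: "\<exists>N. \<forall>n\<ge>N. integrable M (\<lambda>x. norm (u n x - v x) powr p) \<and> (LINT x|M. norm (u n x - v x) powr p) \<le> e"
    if e: "e > 0" for e
  proof -
    obtain N where N: "\<And>i j. i \<ge> N \<Longrightarrow> j \<ge> N \<Longrightarrow> (LINT x|M. norm (u i x - u j x) powr p) < e"
      using cauchy[OF e] by blast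
    have "integrable M (\<lambda>x. norm (u n x - v x) powr p) \<and> (LINT x|M. norm (u n x - v x) powr p) \<le> e" if n: "n \<ge> N" for n
    proof -
      have "(\<integral>\<^sup>+x. ennreal (norm (u n x - v x) powr p) \<partial>M)
          = (\<integral>\<^sup>+x. liminf (\<lambda>i. ennreal (norm (u n x - u (r i) x) powr p)) \<partial>M)"
      proof (rule nn_integral_cong_AE)
        show "AE x in M. ennreal (norm (u n x - v x) powr p) = liminf (\<lambda>i. ennreal (norm (u n x - u (r i) x) powr p))"
          using lim
        proof eventually_elim
          case (elim x)
          have "(\<lambda>i. norm (u n x - u (r i) x) powr p) \<longlonglongrightarrow> norm (u n x - v x) powr p"
            using p elim by (intro tendsto_powr' tendsto_intros) auto
          then have "(\<lambda>i. ennreal (norm (u n x - u (r i) x) powr p)) \<longlonglongrightarrow> ennreal (norm (u n x - v x) powr p)"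
            by (rule tendsto_ennrealI)
          then show ?case
            by (rule lim_imp_Liminf[OF sequentially_bot, symmetric])
        qed
      qed
      also have "\<dots> \<le> liminf (\<lambda>i. \<integral>\<^sup>+x. ennreal (norm (u n x - u (r i) x) powr p) \<partial>M)"
        by (rule nn_integral_liminf) measurable
      also have "\<dots> \<le> ennreal e"
      proof (rule Liminf_le)
        show "eventually (\<lambda>i. (\<integral>\<^sup>+x. ennreal (norm (u n x - u (r i) x) powr p) \<partial>M) \<le> ennreal e) sequentially"
          using eventually_ge_at_top[of N]
        proof eventually_elim
          case (elim i)
          then have "r i \<ge> N" using seq_suble[OF r(1), of i] by simp
          then have "(LINT x|M. norm (u n x - u (r i) x) powr p) \<le> e"
            using N[OF n] by (simp add: less_imp_le)
          then show ?case
            using Lp_fun_integrable[OF Lp_fun_diff[OF u[of n] u[of "r i"]]]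
            by (subst nn_integral_eq_integral) (auto intro: ennreal_leI)
        qed
      qed simp
      finally have fin: "(\<integral>\<^sup>+x. ennreal (norm (u n x - v x) powr p) \<partial>M) \<le> ennreal e" .
      \<comment> \<open>Integrability has to be extracted from the nonnegative integral; a small
        Bochner integral alone would not place the difference in L^p.\<close>
      have int: "integrable M (\<lambda>x. norm (u n x - v x) powr p)"
        by (rule integrableI_bounded) (use fin in \<open>auto intro: le_less_trans\<close>)
      then show ?thesis
        using fin \<open>e > 0\<close> by (subst (asm) nn_integral_eq_integral) auto
    qed
    then show ?thesis by blast
  qed
  obtain n where "integrable M (\<lambda>x. norm (u n x - v x) powr p)" using key[of 1] by force
  then have "Lp_fun (\<lambda>x. u n x - v x)" by (simp add: Lp_fun_def)
  from Lp_fun_diff[OF u[of n] this] have "Lp_fun v" by simp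
  moreover have "Lp_lim u v"
    unfolding Lp_lim_def
  proof (rule LIMSEQ_I)
    fix e :: real assume "e > 0"
    then obtain N where "\<forall>n\<ge>N. (LINT x|M. norm (u n x - v x) powr p) \<le> e / 2"
      using key[of "e / 2"] by auto
    then show "\<exists>N. \<forall>n\<ge>N. norm ((LINT x|M. norm (u n x - v x) powr p) - 0) < e"
      using \<open>e > 0\<close> by (intro exI[of _ N]) force
  qed
  ultimately show ?thesis by (rule that)
qed

end

subsection \<open>The fundamental lemma of the calculus of variations\<close>

text \<open>A product over the coordinates of smooth steps that steepen with \<open>n\<close>. Steps
  vanish at nonpositive arguments, so each function is zero outside the open box, while at a point
  of the open box all factors equal 1 once \<open>n\<close> is large.\<close>

lemma smooth_box_indicator_exists:
  fixes a b :: "'a::euclidean_space"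
  obtains \<zeta> where "\<And>n. smooth (\<zeta> n)" "\<And>n x. x \<notin> cbox a b \<Longrightarrow> \<zeta> n x = (0::real)"
    "\<And>n x. \<bar>\<zeta> n x\<bar> \<le> 1" "\<And>x. (\<lambda>n. \<zeta> n x) \<longlonglongrightarrow> indicator (box a b) x"
proof -
  obtain S :: "real \<Rightarrow> real" where S: "smooth S" "\<And>t. 0 \<le> S t" "\<And>t. S t \<le> 1"
    "\<And>t. t \<le> 0 \<Longrightarrow> S t = 0" "\<And>t. t \<ge> 1 \<Longrightarrow> S t = 1"
    using smooth_step_exists by blast
  define f where "f n i x = S (real n * (x \<bullet> i - a \<bullet> i)) * S (real n * (b \<bullet> i - x \<bullet> i))" for n i x
  define \<zeta> where "\<zeta> n x = (\<Prod>i\<in>Basis. f n i x)" for n x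
  have zero: "\<zeta> n x = 0" if nb: "x \<notin> box a b" for n x
  proof -
    obtain i where i: "i \<in> Basis" "x \<bullet> i \<le> a \<bullet> i \<or> b \<bullet> i \<le> x \<bullet> i"
      using nb unfolding mem_box by (meson not_less)
    then have "f n i x = 0"
      using S(4)[of "real n * (x \<bullet> i - a \<bullet> i)"] S(4)[of "real n * (b \<bullet> i - x \<bullet> i)"]
      by (auto simp: f_def mult_nonneg_nonpos)
    then show ?thesis using i(1) by (auto simp: \<zeta>_def)
  qed
  show ?thesis
  proof (rule that[of \<zeta>])
    show "smooth (\<zeta> n)" for n
    proof -
      have lin: "smooth (\<lambda>x. x \<bullet> i)" for i :: 'a
        by (rule smooth_linear) (rule bounded_linear_inner_left)
      have "smooth (f n i)" for i
        unfolding f_def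
        by (intro smooth_mult smooth_compose[OF S(1)] smooth_const smooth_diff lin)
      then show ?thesis unfolding \<zeta>_def by (intro smooth_prod) auto
    qed
    show "\<zeta> n x = 0" if "x \<notin> cbox a b" for n x
      using zero that box_subset_cbox by blast
    show "\<bar>\<zeta> n x\<bar> \<le> 1" for n x
    proof -
      have f: "0 \<le> f n i x" "f n i x \<le> 1" for i
        using S(2,3) by (auto simp: f_def intro: mult_le_one)
      have "0 \<le> \<zeta> n x" unfolding \<zeta>_def using f by (intro prod_nonneg) auto
      moreover have "\<zeta> n x \<le> 1" unfolding \<zeta>_def using f by (intro prod_le_1) auto
      ultimately show ?thesis by simp
    qed
    show "(\<lambda>n. \<zeta> n x) \<longlonglongrightarrow> indicator (box a b) x" for x
    proof (cases "x \<in> box a b")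
      case True
      have "eventually (\<lambda>n. f n i x = 1) sequentially" if i: "i \<in> Basis" for i
      proof -
        have pos: "x \<bullet> i - a \<bullet> i > 0" "b \<bullet> i - x \<bullet> i > 0" using True i by (auto simp: mem_box)
        have large: "eventually (\<lambda>n. real n * c \<ge> 1) sequentially" if "c > 0" for c
        proof -
          have "eventually (\<lambda>n. n \<ge> nat \<lceil>1 / c\<rceil>) sequentially" by (rule eventually_ge_at_top)
          then show ?thesis
          proof eventually_elim
            case (elim n)
            then have "1 / c \<le> real n" by linarith
            then show ?case using \<open>c > 0\<close> by (simp add: divide_le_eq)
          qed
        qed
        show ?thesis using large[OF pos(1)] large[OF pos(2)]
          by eventually_elim (simp add: f_def S(5))
      qed
      then have "eventually (\<lambda>n. \<forall>i\<in>Basis. f n i x = 1) sequentially"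
        by (intro eventually_ball_finite) auto
      then have "eventually (\<lambda>n. \<zeta> n x = 1) sequentially"
        by eventually_elim (simp add: \<zeta>_def)
      then show ?thesis using True by (simp add: tendsto_eventually)
    qed (simp add: zero)
  qed
qed

lemma test_function_mult_integrable:
  fixes h :: "'a::euclidean_space \<Rightarrow> real"
  assumes "\<Omega> \<in> sets lebesgue" "C \<subseteq> \<Omega>" "h absolutely_integrable_on C"
    and \<phi>: "continuous_on UNIV \<phi>" "\<And>x. x \<notin> C \<Longrightarrow> \<phi> x = 0" "\<And>x. \<bar>\<phi> x\<bar> \<le> B"
  shows "integrable lebesgue (\<lambda>x. indicator C x * h x * \<phi> x)"
    and "integrable (lebesgue_on \<Omega>) (\<lambda>x. h x * \<phi> x)"
    and "(LINT x|lebesgue_on \<Omega>. h x * \<phi> x) = (LINT x|lebesgue. indicator C x * h x * \<phi> x)"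
proof -
  have h: "integrable lebesgue (\<lambda>x. indicator C x * h x)"
    using assms(3) by (simp add: set_integrable_def)
  have m: "\<phi> \<in> borel_measurable lebesgue"
    using \<phi>(1) by (intro measurable_completion) (simp add: borel_measurable_continuous_onI)
  have B: "0 \<le> B" using \<phi>(3)[of 0] by linarith
  show i: "integrable lebesgue (\<lambda>x. indicator C x * h x * \<phi> x)"
  proof (rule Bochner_Integration.integrable_bound[OF integrable_mult_left[OF h, of B]])
    show "(\<lambda>x. indicator C x * h x * \<phi> x) \<in> borel_measurable lebesgue"
      by (intro borel_measurable_times borel_measurable_integrable[OF h] m)
    show "AE x in lebesgue. norm (indicator C x * h x * \<phi> x) \<le> norm (indicator C x * h x * B)"
      using \<phi>(3) B by (intro AE_I2) (auto simp: abs_mult intro!: mult_left_mono)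
  qed
  have eq: "(\<lambda>x. indicator \<Omega> x *\<^sub>R (h x * \<phi> x)) = (\<lambda>x. indicator C x * h x * \<phi> x)"
    using assms(2) \<phi>(2) by (auto simp: indicator_def fun_eq_iff)
  have s: "\<Omega> \<inter> space lebesgue \<in> sets lebesgue" using assms(1) by simp
  show "integrable (lebesgue_on \<Omega>) (\<lambda>x. h x * \<phi> x)"
    unfolding integrable_restrict_space[OF s] eq by (rule i)
  show "(LINT x|lebesgue_on \<Omega>. h x * \<phi> x) = (LINT x|lebesgue. indicator C x * h x * \<phi> x)"
    unfolding integral_restrict_space[OF s] eq ..
qed

text \<open>Testing with the smooth approximations of the box indicator and passing to the limit by
  dominated convergence gives the integral over the open box, which differs from the closed one by a
  null set.\<close>

lemma integral_box_eq_0: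
  fixes h :: "'a::euclidean_space \<Rightarrow> real"
  assumes "\<Omega> \<in> sets lebesgue" and ab: "cbox a b \<subseteq> \<Omega>" and h: "h absolutely_integrable_on cbox a b"
    and ortho: "\<And>\<phi>. \<phi> \<in> test_functions \<Omega> \<Longrightarrow> (LINT x|lebesgue_on \<Omega>. h x * \<phi> x) = 0"
  shows "integral (cbox a b) h = 0"
proof -
  obtain \<zeta> :: "nat \<Rightarrow> 'a \<Rightarrow> real" where \<zeta>: "\<And>n. smooth (\<zeta> n)" "\<And>n x. x \<notin> cbox a b \<Longrightarrow> \<zeta> n x = 0"
    "\<And>n x. \<bar>\<zeta> n x\<bar> \<le> 1" "\<And>x. (\<lambda>n. \<zeta> n x) \<longlonglongrightarrow> indicator (box a b) x"
    using smooth_box_indicator_exists[of a b] by blast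
  have hi: "integrable lebesgue (\<lambda>x. indicator (cbox a b) x * h x)"
    using h by (simp add: set_integrable_def)
  note T = test_function_mult_integrable[OF assms(1) ab h smooth_imp_continuous[OF \<zeta>(1)] \<zeta>(2) \<zeta>(3)]
  have bm: "(indicator (box a b) :: 'a \<Rightarrow> real) \<in> borel_measurable lebesgue"
    by (intro borel_measurable_indicator) auto
  have "(\<lambda>n. LINT x|lebesgue. indicator (cbox a b) x * h x * \<zeta> n x)
      \<longlonglongrightarrow> (LINT x|lebesgue. indicator (cbox a b) x * h x * indicator (box a b) x)"
  proof (rule integral_dominated_convergence[where w = "\<lambda>x. \<bar>indicator (cbox a b) x * h x\<bar>"])
    show "(\<lambda>x. indicator (cbox a b) x * h x * indicator (box a b) x) \<in> borel_measurable lebesgue"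
      by (intro borel_measurable_times borel_measurable_integrable[OF hi] bm)
    show "(\<lambda>x. indicator (cbox a b) x * h x * \<zeta> n x) \<in> borel_measurable lebesgue" for n
      using T(1) by (rule borel_measurable_integrable)
    show "integrable lebesgue (\<lambda>x. \<bar>indicator (cbox a b) x * h x\<bar>)" using hi by (rule integrable_abs)
    show "AE x in lebesgue. (\<lambda>n. indicator (cbox a b) x * h x * \<zeta> n x)
        \<longlonglongrightarrow> indicator (cbox a b) x * h x * indicator (box a b) x"
      by (intro AE_I2 tendsto_intros \<zeta>(4))
    show "AE x in lebesgue. norm (indicator (cbox a b) x * h x * \<zeta> n x) \<le> \<bar>indicator (cbox a b) x * h x\<bar>" for n
      using \<zeta>(3) by (intro AE_I2) (auto simp: abs_mult intro: mult_left_le)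
  qed
  moreover have "(LINT x|lebesgue. indicator (cbox a b) x * h x * \<zeta> n x) = 0" for n
  proof -
    have "\<zeta> n \<in> test_functions \<Omega>"
      using \<zeta>(1,2) ab by (auto simp: test_functions_iff intro!: exI[of _ "cbox a b"])
    then show ?thesis using ortho T(3) by metis
  qed
  ultimately have "(LINT x|lebesgue. indicator (cbox a b) x * h x * indicator (box a b) x) = 0"
    by (simp add: LIMSEQ_const_iff)
  also have "(\<lambda>x. indicator (cbox a b) x * h x * indicator (box a b) x) = (\<lambda>x. indicator (box a b) x *\<^sub>R h x)"
    using box_subset_cbox[of a b] by (auto simp: indicator_def fun_eq_iff)
  finally have "set_lebesgue_integral lebesgue (box a b) h = 0"
    by (simp only: set_lebesgue_integral_def)
  moreover have "h absolutely_integrable_on box a b"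
    using h by (rule set_integrable_subset) (auto simp: box_subset_cbox)
  ultimately have "integral (box a b) h = 0"
    using set_lebesgue_integral_eq_integral(2)[of "box a b" h] by simp
  then show ?thesis by (simp add: integral_open_interval)
qed

text \<open>Lebesgue differentiation: off a null set the zero extension \<open>f\<close> is the
  limit of its averages over small cubes with corner \<open>x\<close>, and for \<open>x\<close> in
  the open box these cubes stay inside the closed one, where the averages vanish. The faces form a
  further null set.\<close>

lemma negligible_nonzero_on_box:
  fixes h :: "'a::euclidean_space \<Rightarrow> real"
  assumes h: "h absolutely_integrable_on cbox c d"
    and zero: "\<And>a b. cbox a b \<subseteq> cbox c d \<Longrightarrow> integral (cbox a b) h = 0"
  shows "negligible {x \<in> cbox c d. h x \<noteq> 0}"
proof -
  define f where "f x = (if x \<in> cbox c d then h x else 0)" for x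
  have "f integrable_on cbox a b" for a b
  proof -
    have "f absolutely_integrable_on UNIV"
      using h unfolding f_def[abs_def] by (simp add: absolutely_integrable_restrict_UNIV)
    then have "f absolutely_integrable_on cbox a b"
      by (rule set_integrable_subset) auto
    then show ?thesis by (rule set_lebesgue_integral_eq_integral(1))
  qed
  then obtain N where N: "negligible N" "\<And>x e. x \<notin> N \<Longrightarrow> 0 < e \<Longrightarrow>
      \<exists>\<delta>>0. \<forall>t. 0 < t \<and> t < \<delta> \<longrightarrow> norm (integral (cbox x (x + t *\<^sub>R One)) f /\<^sub>R t ^ DIM('a) - f x) < e"
    using integrable_ccontinuous_explicit[of f] by blast
  have "h x = 0" if x: "x \<in> box c d" "x \<notin> N" for x
  proof (rule ccontr)
    assume "h x \<noteq> 0"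
    then obtain \<delta> where \<delta>: "\<delta> > 0"
      "\<And>t. 0 < t \<Longrightarrow> t < \<delta> \<Longrightarrow> norm (integral (cbox x (x + t *\<^sub>R One)) f /\<^sub>R t ^ DIM('a) - f x) < \<bar>h x\<bar>"
      using N(2)[OF x(2), of "\<bar>h x\<bar>"] by auto
    have "((\<lambda>t. x + t *\<^sub>R One) \<longlongrightarrow> x + 0 *\<^sub>R One) (at_right 0)"
      by (intro tendsto_intros)
    then have "eventually (\<lambda>t. x + t *\<^sub>R One \<in> box c d) (at_right 0)"
      using x(1) by (intro topological_tendstoD) auto
    moreover have "eventually (\<lambda>t. 0 < t \<and> t < \<delta>) (at_right 0)"
      using \<delta>(1) eventually_at_right_less by (auto intro: eventually_conj simp: eventually_at_right)
    ultimately have "eventually (\<lambda>t. x + t *\<^sub>R One \<in> box c d \<and> (0 < t \<and> t < \<delta>)) (at_right 0)"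
      by (rule eventually_conj)
    then obtain t where t: "x + t *\<^sub>R One \<in> box c d" "0 < t" "t < \<delta>"
      using eventually_happens'[OF trivial_limit_at_right_real] by blast
    have sub: "cbox x (x + t *\<^sub>R One) \<subseteq> cbox c d"
      using x(1) t(1) by (auto simp: mem_box subset_box dest!: bspec intro: less_imp_le)
    then have "integral (cbox x (x + t *\<^sub>R One)) f = integral (cbox x (x + t *\<^sub>R One)) h"
      by (intro integral_cong) (auto simp: f_def)
    also have "\<dots> = 0" by (rule zero[OF sub])
    finally have "\<bar>f x\<bar> < \<bar>h x\<bar>" using \<delta>(2)[OF t(2,3)] by simp
    then show False using x(1) box_subset_cbox[of c d] by (auto simp: f_def split: if_splits)
  qed
  then have "{x \<in> cbox c d. h x \<noteq> 0} \<subseteq> N \<union> (cbox c d - box c d)" by blast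
  then show ?thesis
    using N(1) negligible_frontier_interval by (meson negligible_Un negligible_subset)
qed

text \<open>A countable cover of the open set by closed boxes inside it reduces the claim to a
  single box, on which every subbox has integral zero. Only local integrability is assumed, because
  that is what the definition of a weak gradient provides.\<close>

lemma fundamental_lemma:
  fixes h :: "'a::euclidean_space \<Rightarrow> real"
  assumes "open \<Omega>" and h: "\<And>C. compact C \<Longrightarrow> C \<subseteq> \<Omega> \<Longrightarrow> h absolutely_integrable_on C"
    and ortho: "\<And>\<phi>. \<phi> \<in> test_functions \<Omega> \<Longrightarrow> (LINT x|lebesgue_on \<Omega>. h x * \<phi> x) = 0"
  shows "AE x in lebesgue_on \<Omega>. h x = 0"
proof -
  have \<Omega>: "\<Omega> \<in> sets lebesgue" using assms(1) by auto
  obtain \<D> where \<D>: "countable \<D>" "\<D> \<subseteq> Pow \<Omega>" "\<And>X. X \<in> \<D> \<Longrightarrow> \<exists>a b. X = cbox a b" "\<Union>\<D> = \<Omega>"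
    using open_countable_Union_open_cbox[OF assms(1)] by metis
  have "negligible {x \<in> X. h x \<noteq> 0}" if X: "X \<in> \<D>" for X
  proof -
    obtain c d where cd: "X = cbox c d" using \<D>(3)[OF X] by blast
    have sub: "cbox c d \<subseteq> \<Omega>" using X \<D>(2) cd by blast
    have "integral (cbox a b) h = 0" if "cbox a b \<subseteq> cbox c d" for a b
      using that sub by (intro integral_box_eq_0[OF \<Omega> _ h ortho]) auto
    then show ?thesis unfolding cd
      by (intro negligible_nonzero_on_box h sub) auto
  qed
  then have "negligible (\<Union>X\<in>\<D>. {x \<in> X. h x \<noteq> 0})"
    using \<D>(1) by (intro negligible_countable_Union) auto
  then have "(\<Union>X\<in>\<D>. {x \<in> X. h x \<noteq> 0}) \<in> null_sets lebesgue"
    by (simp add: negligible_iff_null_sets)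
  moreover have "{x \<in> space lebesgue. \<not> (x \<in> \<Omega> \<longrightarrow> h x = 0)} \<subseteq> (\<Union>X\<in>\<D>. {x \<in> X. h x \<noteq> 0})"
    using \<D>(4) by auto
  ultimately have "AE x in lebesgue. x \<in> \<Omega> \<longrightarrow> h x = 0"
    by (rule AE_I')
  then show ?thesis using \<Omega> by (simp add: AE_restrict_space_iff)
qed

text \<open>The components of the difference are orthogonal to all test functions. This frees the
  later arguments from the choice made in \<open>weak_gradient\<close>: any weak gradient at hand
  may replace it under an integral.\<close>

lemma weak_gradient_unique:
  fixes \<Omega> :: "'a::euclidean_space set"
  assumes "open \<Omega>" and G: "has_weak_gradient \<Omega> u G" and H: "has_weak_gradient \<Omega> u H"
  shows "AE x in lebesgue_on \<Omega>. G x = H x"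
proof -
  have \<Omega>: "\<Omega> \<in> sets lebesgue" using assms(1) by auto
  have comp: "(\<lambda>x. F x \<bullet> i) absolutely_integrable_on C"
    if "has_weak_gradient \<Omega> u F" "compact C" "C \<subseteq> \<Omega>" for F C i
  proof -
    have "F absolutely_integrable_on C" using that unfolding has_weak_gradient_def by blast
    then show ?thesis by (rule absolutely_integrable_component)
  qed
  have "AE x in lebesgue_on \<Omega>. G x \<bullet> i - H x \<bullet> i = 0" if i: "i \<in> Basis" for i
  proof (rule fundamental_lemma[OF assms(1)])
    show "(\<lambda>x. G x \<bullet> i - H x \<bullet> i) absolutely_integrable_on C" if "compact C" "C \<subseteq> \<Omega>" for C
      using comp[OF G that] comp[OF H that] by (rule set_integral_diff(1))
    fix \<phi> assume \<phi>: "\<phi> \<in> test_functions \<Omega>"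
    then obtain C where C: "smooth \<phi>" "compact C" "C \<subseteq> \<Omega>" "\<And>x. x \<notin> C \<Longrightarrow> \<phi> x = 0"
        "\<And>x. x \<notin> C \<Longrightarrow> grad \<phi> x = 0"
      by (rule test_functionsE) blast
    obtain B where "B > 0" and B: "\<And>x. \<bar>\<phi> x\<bar> \<le> B" and "\<And>x. norm (grad \<phi> x) \<le> B"
      using test_functions_bounded[OF \<phi>] by blast
    have int: "integrable (lebesgue_on \<Omega>) (\<lambda>x. F x \<bullet> i * \<phi> x)" if F: "has_weak_gradient \<Omega> u F" for F
      by (rule test_function_mult_integrable(2)[OF \<Omega> C(3) comp[OF F C(2,3)] smooth_imp_continuous[OF C(1)] C(4) B])
    have "(LINT x|lebesgue_on \<Omega>. F x \<bullet> i * \<phi> x)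
        = - (LINT x|lebesgue_on \<Omega>. u x * frechet_derivative \<phi> (at x) i)" if "has_weak_gradient \<Omega> u F" for F
      using that \<phi> i unfolding has_weak_gradient_def by simp
    from this[OF G] this[OF H] show "(LINT x|lebesgue_on \<Omega>. (G x \<bullet> i - H x \<bullet> i) * \<phi> x) = 0"
      using int[OF G] int[OF H] by (simp add: left_diff_distrib)
  qed
  then have "AE x in lebesgue_on \<Omega>. \<forall>i\<in>Basis. G x \<bullet> i - H x \<bullet> i = 0"
    by (subst AE_ball_countable) (auto intro: countable_finite)
  then show ?thesis by eventually_elim (auto intro: euclidean_eqI)
qed

subsection \<open>Approximation in the Sobolev space\<close>

locale bounded_domain =
  fixes \<Omega> :: "'a::euclidean_space set" and p :: real
  assumes open_domain: "open \<Omega>" and bounded_dom: "bounded \<Omega>" and p1: "1 < p"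

sublocale bounded_domain \<subseteq> Lp "lebesgue_on \<Omega>" p
proof -
  have "finite_measure (lebesgue_on \<Omega>)"
    by (intro finite_measure_lebesgue_on lmeasurable_open bounded_dom open_domain)
  then show "Lp (lebesgue_on \<Omega>) p"
    using p1 by (intro Lp.intro Lp_axioms.intro)
qed

context bounded_domain
begin

abbreviation "\<mu> \<equiv> lebesgue_on \<Omega>"

lemma domain_sets [simp]: "\<Omega> \<in> sets lebesgue"
  using open_domain by auto

lemma domain_Int_sets: "\<Omega> \<inter> space lebesgue \<in> sets lebesgue"
  by simp

lemma Lp_functions_eq: "u \<in> Lp_functions \<Omega> p \<longleftrightarrow> Lp_fun u"
  by (simp add: Lp_functions_def Lp_fun_def)

lemma continuous_measurable:
  fixes f :: "'a \<Rightarrow> 'b::euclidean_space"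
  assumes "continuous_on UNIV f" shows "f \<in> borel_measurable (\<mu>)"
proof -
  have "f \<in> borel_measurable lborel"
    using assms by (simp add: borel_measurable_continuous_onI)
  then show ?thesis
    by (intro measurable_restrict_space1 measurable_completion)
qed

lemma test_function_Lp:
  assumes "\<phi> \<in> test_functions \<Omega>"
  shows "Lp_fun \<phi>" "Lp_fun (grad \<phi>)"
proof -
  obtain B where "B > 0" "\<And>x. \<bar>\<phi> x\<bar> \<le> B" "\<And>x. norm (grad \<phi> x) \<le> B"
    using test_functions_bounded[OF assms] by blast
  moreover have "smooth \<phi>" using assms by (rule test_functions_smooth)
  ultimately show "Lp_fun \<phi>" "Lp_fun (grad \<phi>)"
    by (auto intro!: Lp_fun_bounded[of _ B] AE_I2 continuous_measurable smooth_imp_continuous continuous_grad)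
qed

lemma integrable_imp_absolutely_integrable:
  fixes u :: "'a \<Rightarrow> 'b::euclidean_space"
  assumes "integrable (\<mu>) u" "compact S" "S \<subseteq> \<Omega>"
  shows "u absolutely_integrable_on S"
proof -
  have "set_integrable lebesgue \<Omega> u"
    using assms(1) unfolding integrable_restrict_space[OF domain_Int_sets] set_integrable_def .
  then show ?thesis
    using assms(2,3) by (elim set_integrable_subset) (auto intro: lmeasurable_compact fmeasurableD)
qed

lemma test_function_partial:
  "\<phi> \<in> test_functions \<Omega> \<Longrightarrow> frechet_derivative \<phi> (at x) i = grad \<phi> x \<bullet> i"
  by (intro grad_inner smooth_imp_differentiable test_functions_smooth)

lemma has_weak_gradientI:
  assumes "integrable (\<mu>) u" "integrable (\<mu>) G"
    and "\<And>\<phi> i. \<phi> \<in> test_functions \<Omega> \<Longrightarrow> i \<in> Basis \<Longrightarrow>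
      (LINT x|\<mu>. u x * (grad \<phi> x \<bullet> i)) = - (LINT x|\<mu>. (G x \<bullet> i) * \<phi> x)"
  shows "has_weak_gradient \<Omega> u G"
  unfolding has_weak_gradient_def
proof (intro conjI allI impI ballI)
  fix \<phi> and i :: 'a assume "\<phi> \<in> test_functions \<Omega>" "i \<in> Basis"
  then show "(LINT x|\<mu>. u x * frechet_derivative \<phi> (at x) i) = - (LINT x|\<mu>. (G x \<bullet> i) * \<phi> x)"
    using assms(3) by (simp only: test_function_partial)
qed (use integrable_imp_absolutely_integrable assms(1,2) in blast)+

lemma has_weak_gradientD:
  assumes "has_weak_gradient \<Omega> u G" "\<phi> \<in> test_functions \<Omega>" "i \<in> Basis"
  shows "(LINT x|\<mu>. u x * (grad \<phi> x \<bullet> i)) = - (LINT x|\<mu>. (G x \<bullet> i) * \<phi> x)"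
proof -
  have "(LINT x|\<mu>. u x * frechet_derivative \<phi> (at x) i) = - (LINT x|\<mu>. (G x \<bullet> i) * \<phi> x)"
    using assms unfolding has_weak_gradient_def by blast
  then show ?thesis by (simp only: test_function_partial[OF assms(2)])
qed

lemma weak_gradient_eq:
  assumes "has_weak_gradient \<Omega> u G"
  shows "AE x in \<mu>. weak_gradient \<Omega> u x = G x"
proof (rule weak_gradient_unique[OF open_domain _ assms])
  show "has_weak_gradient \<Omega> u (weak_gradient \<Omega> u)"
    unfolding weak_gradient_def using assms by (rule someI[of "has_weak_gradient \<Omega> u"])
qed

text \<open>Lebesgue measure is complete, so measurability passes across almost everywhere equality.
  This is how the chosen weak gradient, known to agree only almost everywhere with a member of L^p,
  is itself placed in L^p.\<close>

lemma Lp_fun_cong_AE: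
  fixes F G :: "'a \<Rightarrow> 'b::euclidean_space"
  assumes G: "Lp_fun G" and eq: "AE x in \<mu>. F x = G x"
  shows "Lp_fun F"
proof -
  have "(\<lambda>x. indicator \<Omega> x *\<^sub>R G x) \<in> borel_measurable lebesgue"
    using Lp_fun_measurable[OF G] unfolding borel_measurable_restrict_space_iff[OF domain_Int_sets] .
  moreover have "AE x in lebesgue. indicator \<Omega> x *\<^sub>R G x = indicator \<Omega> x *\<^sub>R F x"
    using eq unfolding AE_restrict_space_iff[OF domain_Int_sets]
    by eventually_elim (auto simp: indicator_def)
  ultimately have "(\<lambda>x. indicator \<Omega> x *\<^sub>R F x) \<in> borel_measurable lebesgue"
    by (rule borel_measurable_AE)
  then have F: "F \<in> borel_measurable (\<mu>)"
    unfolding borel_measurable_restrict_space_iff[OF domain_Int_sets] .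
  note [measurable] = F Lp_fun_measurable[OF G]
  have "integrable (\<mu>) (\<lambda>x. norm (F x) powr p)"
  proof (rule integrable_cong_AE_imp[OF Lp_fun_integrable[OF G]])
    show "AE x in \<mu>. norm (G x) powr p = norm (F x) powr p"
      using eq by eventually_elim simp
  qed measurable
  with F show ?thesis by (simp add: Lp_fun_def)
qed

lemma bounded_mult_integrable:
  fixes u :: "'a \<Rightarrow> real"
  assumes u: "integrable (\<mu>) u" and w [measurable]: "w \<in> borel_measurable (\<mu>)"
    and bd: "AE x in \<mu>. \<bar>w x\<bar> \<le> B"
  shows "integrable (\<mu>) (\<lambda>x. u x * w x)"
proof (rule Bochner_Integration.integrable_bound[OF integrable_mult_left[OF u, of B]])
  note [measurable] = borel_measurable_integrable[OF u]
  show "(\<lambda>x. u x * w x) \<in> borel_measurable (\<mu>)" by measurable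
  show "AE x in \<mu>. norm (u x * w x) \<le> norm (u x * B)"
    using bd by eventually_elim (auto simp: abs_mult intro!: mult_left_mono)
qed

lemma has_weak_gradient_test_diff:
  assumes u: "Lp_fun u" and G: "Lp_fun G" and w: "has_weak_gradient \<Omega> u G" and \<psi>: "\<psi> \<in> test_functions \<Omega>"
  shows "has_weak_gradient \<Omega> (\<lambda>x. u x - \<psi> x) (\<lambda>x. G x - grad \<psi> x)"
proof (rule has_weak_gradientI)
  show "integrable (\<mu>) (\<lambda>x. u x - \<psi> x)"
    by (intro Lp_fun_imp_integrable Lp_fun_diff u test_function_Lp[OF \<psi>])
  show "integrable (\<mu>) (\<lambda>x. G x - grad \<psi> x)"
    by (intro Lp_fun_imp_integrable Lp_fun_diff G test_function_Lp[OF \<psi>])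
  fix \<phi> and i :: 'a assume \<phi>: "\<phi> \<in> test_functions \<Omega>" and i: "i \<in> Basis"
  obtain B where "B > 0" and B: "\<And>x. \<bar>\<phi> x\<bar> \<le> B" "\<And>x. norm (grad \<phi> x) \<le> B"
    using test_functions_bounded[OF \<phi>] by blast
  have s: "smooth \<phi>" using \<phi> by (rule test_functions_smooth)
  have Bi: "\<bar>grad \<phi> x \<bullet> i\<bar> \<le> B" for x using Basis_le_norm[OF i, of "grad \<phi> x"] B(2)[of x] by linarith
  have m: "\<phi> \<in> borel_measurable (\<mu>)" "(\<lambda>x. grad \<phi> x \<bullet> i) \<in> borel_measurable (\<mu>)"
    by (intro continuous_measurable smooth_imp_continuous s)
      (intro continuous_measurable continuous_on_inner continuous_grad continuous_on_const s)
  have 1: "integrable (\<mu>) (\<lambda>x. f x * (grad \<phi> x \<bullet> i))" if "Lp_fun f" for f :: "'a \<Rightarrow> real"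
    using that Bi by (intro bounded_mult_integrable[where B=B] m Lp_fun_imp_integrable) auto
  have 2: "integrable (\<mu>) (\<lambda>x. (F x \<bullet> i) * \<phi> x)" if "Lp_fun F" for F :: "'a \<Rightarrow> 'a"
    using that B(1) by (intro bounded_mult_integrable[where B=B] m integrable_inner_left Lp_fun_imp_integrable) auto
  have "(LINT x|\<mu>. (u x - \<psi> x) * (grad \<phi> x \<bullet> i))
      = (LINT x|\<mu>. u x * (grad \<phi> x \<bullet> i)) - (LINT x|\<mu>. \<psi> x * (grad \<phi> x \<bullet> i))"
    using 1[OF u] 1[OF test_function_Lp(1)[OF \<psi>]] by (simp add: left_diff_distrib)
  also have "\<dots> = - (LINT x|\<mu>. (G x \<bullet> i) * \<phi> x) + (LINT x|\<mu>. (grad \<psi> x \<bullet> i) * \<phi> x)"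
    using has_weak_gradientD[OF w \<phi> i] integration_by_parts[OF domain_sets \<phi> test_functions_smooth[OF \<psi>], of i]
    by simp
  also have "\<dots> = - (LINT x|\<mu>. ((G x - grad \<psi> x) \<bullet> i) * \<phi> x)"
    using 2[OF G] 2[OF test_function_Lp(2)[OF \<psi>]] by (simp add: left_diff_distrib inner_diff_left)
  finally show "(LINT x|\<mu>. (u x - \<psi> x) * (grad \<phi> x \<bullet> i))
      = - (LINT x|\<mu>. ((G x - grad \<psi> x) \<bullet> i) * \<phi> x)" .
qed

text \<open>The norm refers to the chosen weak gradient of a difference. By uniqueness it can be
  computed from any weak gradient of \<open>u\<close> in L^p and the classical gradient of the test
  function, which turns approximation in the norm into two p-mean limits.\<close>

lemma sobolev_norm_test_diff:
  assumes u: "Lp_fun u" and G: "Lp_fun G" and w: "has_weak_gradient \<Omega> u G" and \<psi>: "\<psi> \<in> test_functions \<Omega>"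
  shows "sobolev_norm \<Omega> p (\<lambda>x. u x - \<psi> x) =
    ((LINT x|\<mu>. norm (\<psi> x - u x) powr p) + (LINT x|\<mu>. norm (grad \<psi> x - G x) powr p)) powr (1 / p)"
proof -
  note ae = weak_gradient_eq[OF has_weak_gradient_test_diff[OF assms]]
  have L: "Lp_fun (\<lambda>x. G x - grad \<psi> x)" using G test_function_Lp[OF \<psi>] by (intro Lp_fun_diff)
  note [measurable] = Lp_fun_measurable[OF L] Lp_fun_measurable[OF Lp_fun_cong_AE[OF L ae]]
  have "(LINT x|\<mu>. norm (weak_gradient \<Omega> (\<lambda>x. u x - \<psi> x) x) powr p)
      = (LINT x|\<mu>. norm (G x - grad \<psi> x) powr p)"
  proof (rule integral_cong_AE)
    show "AE x in \<mu>. norm (weak_gradient \<Omega> (\<lambda>x. u x - \<psi> x) x) powr p = norm (G x - grad \<psi> x) powr p"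
      using ae by eventually_elim simp
  qed measurable
  then show ?thesis
    unfolding sobolev_norm_def by (simp add: norm_minus_commute abs_minus_commute)
qed

text \<open>Integration by parts for \<open>\<zeta> n\<close> passes to the limit, because p-mean
  convergence implies L^1 convergence and the test function \<open>\<phi>\<close> and its partial
  derivatives are bounded. Hence the limit of the gradients is automatically a weak gradient of the
  limit.\<close>

lemma sobolev_space_0I:
  assumes \<zeta>: "\<And>n. \<zeta> n \<in> test_functions \<Omega>" and u: "Lp_fun u" "Lp_lim \<zeta> u"
    and G: "Lp_fun G" "Lp_lim (\<lambda>n. grad (\<zeta> n)) G"
  shows "has_weak_gradient \<Omega> u G" "u \<in> sobolev_space_0 \<Omega> p"
proof -
  note L\<zeta> = test_function_Lp[OF \<zeta>]
  show w: "has_weak_gradient \<Omega> u G"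
  proof (rule has_weak_gradientI)
    show "integrable (\<mu>) u" "integrable (\<mu>) G"
      using u G by (auto intro: Lp_fun_imp_integrable)
    fix \<phi> and i :: 'a assume \<phi>: "\<phi> \<in> test_functions \<Omega>" and i: "i \<in> Basis"
    obtain B where B: "B > 0" "\<And>x. \<bar>\<phi> x\<bar> \<le> B" "\<And>x. norm (grad \<phi> x) \<le> B"
      using test_functions_bounded[OF \<phi>] by blast
    have s: "smooth \<phi>" using \<phi> by (rule test_functions_smooth)
    have Bi: "\<bar>grad \<phi> x \<bullet> i\<bar> \<le> B" for x using Basis_le_norm[OF i, of "grad \<phi> x"] B(3)[of x] by linarith
    have m: "\<phi> \<in> borel_measurable (\<mu>)" "(\<lambda>x. grad \<phi> x \<bullet> i) \<in> borel_measurable (\<mu>)"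
      by (intro continuous_measurable smooth_imp_continuous s)
      (intro continuous_measurable continuous_on_inner continuous_grad continuous_on_const s)
    have lim: "(\<lambda>n. LINT x|\<mu>. f n x * w x) \<longlonglongrightarrow> (LINT x|\<mu>. g x * w x)"
      if f: "\<And>n. integrable (\<mu>) (f n)" and g: "integrable (\<mu>) g"
        and fg: "(\<lambda>n. LINT x|\<mu>. \<bar>f n x - g x\<bar>) \<longlonglongrightarrow> 0"
        and w: "w \<in> borel_measurable (\<mu>)" "\<And>x. \<bar>w x\<bar> \<le> B"
      for f :: "nat \<Rightarrow> 'a \<Rightarrow> real" and g w
    proof -
      have i: "integrable (\<mu>) (\<lambda>x. h x * w x)" if "integrable (\<mu>) h" for h
        using w by (intro bounded_mult_integrable[where B=B] that) auto
      have bd: "\<forall>n. norm ((LINT x|\<mu>. f n x * w x) - (LINT x|\<mu>. g x * w x))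
          \<le> B * (LINT x|\<mu>. \<bar>f n x - g x\<bar>)"
      proof
        fix n
        have "(LINT x|\<mu>. f n x * w x) - (LINT x|\<mu>. g x * w x)
            = (LINT x|\<mu>. (f n x - g x) * w x)"
          using i[OF f] i[OF g] by (simp add: left_diff_distrib)
        also have "norm \<dots> \<le> (LINT x|\<mu>. \<bar>(f n x - g x) * w x\<bar>)"
          using integral_abs_bound by simp
        also have "\<dots> \<le> (LINT x|\<mu>. B * \<bar>f n x - g x\<bar>)"
        proof (rule integral_mono)
          show "\<bar>(f n x - g x) * w x\<bar> \<le> B * \<bar>f n x - g x\<bar>" for x
            using mult_left_mono[OF w(2)[of x], of "\<bar>f n x - g x\<bar>"] by (simp add: abs_mult mult.commute)
        qed (use i[of "\<lambda>x. f n x - g x"] f g in \<open>auto intro!: integrable_mult_right\<close>)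
        also have "\<dots> = B * (LINT x|\<mu>. \<bar>f n x - g x\<bar>)" by simp
        finally show "norm ((LINT x|\<mu>. f n x * w x) - (LINT x|\<mu>. g x * w x))
          \<le> B * (LINT x|\<mu>. \<bar>f n x - g x\<bar>)" .
      qed
      have "(\<lambda>n. B * (LINT x|\<mu>. \<bar>f n x - g x\<bar>)) \<longlonglongrightarrow> 0"
        using tendsto_mult_right_zero[OF fg] .
      from Lim_null_comparison[OF always_eventually[OF bd] this]
      have "(\<lambda>n. (LINT x|\<mu>. f n x * w x) - (LINT x|\<mu>. g x * w x)) \<longlonglongrightarrow> 0" .
      then show ?thesis by (rule LIM_zero_cancel)
    qed
    have "(\<lambda>n. LINT x|\<mu>. \<bar>\<zeta> n x - u x\<bar>) \<longlonglongrightarrow> 0"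
      using Lp_lim_imp_L1[OF L\<zeta>(1) u] by simp
    then have 1: "(\<lambda>n. LINT x|\<mu>. \<zeta> n x * (grad \<phi> x \<bullet> i)) \<longlonglongrightarrow> (LINT x|\<mu>. u x * (grad \<phi> x \<bullet> i))"
      by (intro lim m Bi Lp_fun_imp_integrable L\<zeta> u)
    have "(\<lambda>n. LINT x|\<mu>. \<bar>grad (\<zeta> n) x \<bullet> i - G x \<bullet> i\<bar>) \<longlonglongrightarrow> 0"
    proof (rule Lim_null_comparison[OF always_eventually Lp_lim_imp_L1[OF L\<zeta>(2) G]], rule allI)
      fix n
      have L: "Lp_fun (\<lambda>x. grad (\<zeta> n) x - G x)" using L\<zeta> G by (intro Lp_fun_diff)
      have "(LINT x|\<mu>. \<bar>grad (\<zeta> n) x \<bullet> i - G x \<bullet> i\<bar>) \<le> (LINT x|\<mu>. norm (grad (\<zeta> n) x - G x))"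
      proof (rule integral_mono)
        show "\<bar>grad (\<zeta> n) x \<bullet> i - G x \<bullet> i\<bar> \<le> norm (grad (\<zeta> n) x - G x)" for x
          using Basis_le_norm[OF i, of "grad (\<zeta> n) x - G x"] by (simp add: inner_diff_left)
        show "integrable (\<mu>) (\<lambda>x. \<bar>grad (\<zeta> n) x \<bullet> i - G x \<bullet> i\<bar>)"
          using integrable_abs[OF integrable_inner_left[OF Lp_fun_imp_integrable[OF L], of i]]
          by (simp add: inner_diff_left)
      qed (rule integrable_norm[OF Lp_fun_imp_integrable[OF L]])
      then show "norm (LINT x|\<mu>. \<bar>grad (\<zeta> n) x \<bullet> i - G x \<bullet> i\<bar>) \<le> (LINT x|\<mu>. norm (grad (\<zeta> n) x - G x))"
        by simp
    qed
    then have 2: "(\<lambda>n. LINT x|\<mu>. (grad (\<zeta> n) x \<bullet> i) * \<phi> x) \<longlonglongrightarrow> (LINT x|\<mu>. (G x \<bullet> i) * \<phi> x)"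
      by (intro lim m B(2) integrable_inner_left Lp_fun_imp_integrable L\<zeta> G)
    have "(LINT x|\<mu>. \<zeta> n x * (grad \<phi> x \<bullet> i)) = - (LINT x|\<mu>. (grad (\<zeta> n) x \<bullet> i) * \<phi> x)" for n
      by (rule integration_by_parts[OF domain_sets \<phi> test_functions_smooth[OF \<zeta>]])
    with 1 have "(\<lambda>n. - (LINT x|\<mu>. (grad (\<zeta> n) x \<bullet> i) * \<phi> x)) \<longlonglongrightarrow> (LINT x|\<mu>. u x * (grad \<phi> x \<bullet> i))"
      by simp
    from LIMSEQ_unique[OF this tendsto_minus[OF 2]]
    show "(LINT x|\<mu>. u x * (grad \<phi> x \<bullet> i)) = - (LINT x|\<mu>. (G x \<bullet> i) * \<phi> x)" .
  qed
  have "(\<lambda>n. (LINT x|\<mu>. norm (\<zeta> n x - u x) powr p) + (LINT x|\<mu>. norm (grad (\<zeta> n) x - G x) powr p))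
      \<longlonglongrightarrow> 0 + 0"
    using u(2) G(2) unfolding Lp_lim_def by (rule tendsto_add)
  then have "(\<lambda>n. ((LINT x|\<mu>. norm (\<zeta> n x - u x) powr p)
      + (LINT x|\<mu>. norm (grad (\<zeta> n) x - G x) powr p)) powr (1 / p)) \<longlonglongrightarrow> (0 + 0) powr (1 / p)"
    using p1 by (intro tendsto_powr') auto
  then have "(\<lambda>n. sobolev_norm \<Omega> p (\<lambda>x. u x - \<zeta> n x)) \<longlonglongrightarrow> 0"
    using sobolev_norm_test_diff[OF u(1) G(1) w \<zeta>] by simp
  then have "eventually (\<lambda>n. sobolev_norm \<Omega> p (\<lambda>x. u x - \<zeta> n x) < \<epsilon>) sequentially" if "\<epsilon> > 0" for \<epsilon>
    using that by (rule order_tendstoD(2))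
  then have "\<exists>n. sobolev_norm \<Omega> p (\<lambda>x. u x - \<zeta> n x) < \<epsilon>" if "\<epsilon> > 0" for \<epsilon>
    using that eventually_happens'[OF sequentially_bot] by blast
  then have "\<forall>\<epsilon>>0. \<exists>\<phi>\<in>test_functions \<Omega>. sobolev_norm \<Omega> p (\<lambda>x. u x - \<phi> x) < \<epsilon>"
    using \<zeta> by meson
  then show "u \<in> sobolev_space_0 \<Omega> p"
    using u(1) G(1) w by (auto simp: sobolev_space_0_def sobolev_space_def Lp_functions_eq)
qed

lemma sobolev_space_0E:
  assumes "u \<in> sobolev_space_0 \<Omega> p"
  obtains \<zeta> where "\<And>n. \<zeta> n \<in> test_functions \<Omega>" "Lp_fun u" "Lp_lim \<zeta> u"
    "Lp_fun (weak_gradient \<Omega> u)" "Lp_lim (\<lambda>n. grad (\<zeta> n)) (weak_gradient \<Omega> u)"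
proof -
  obtain G where u: "Lp_fun u" and G: "Lp_fun G" "has_weak_gradient \<Omega> u G"
    using assms by (auto simp: sobolev_space_0_def sobolev_space_def Lp_functions_eq)
  note ae = weak_gradient_eq[OF G(2)]
  have W: "Lp_fun (weak_gradient \<Omega> u)" by (rule Lp_fun_cong_AE[OF G(1) ae])
  have w: "has_weak_gradient \<Omega> u (weak_gradient \<Omega> u)"
    unfolding weak_gradient_def using G(2) by (rule someI[of "has_weak_gradient \<Omega> u"])
  have "\<exists>\<phi>\<in>test_functions \<Omega>. sobolev_norm \<Omega> p (\<lambda>x. u x - \<phi> x) < 1 / real (Suc n)" for n
    using assms by (auto simp: sobolev_space_0_def)
  then obtain \<zeta> where \<zeta>: "\<And>n. \<zeta> n \<in> test_functions \<Omega>"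
    "\<And>n. sobolev_norm \<Omega> p (\<lambda>x. u x - \<zeta> n x) < 1 / real (Suc n)" by metis
  define A where "A n = (LINT x|\<mu>. norm (\<zeta> n x - u x) powr p)" for n
  define B where "B n = (LINT x|\<mu>. norm (grad (\<zeta> n) x - weak_gradient \<Omega> u x) powr p)" for n
  have nn: "A n \<ge> 0" "B n \<ge> 0" for n by (simp_all add: A_def B_def)
  have le: "A n + B n \<le> 1 / real (Suc n)" for n
  proof -
    have "(A n + B n) powr (1 / p) < 1 / real (Suc n)"
      using \<zeta>(2)[of n] sobolev_norm_test_diff[OF u W w \<zeta>(1)[of n]] by (simp add: A_def B_def)
    then have "((A n + B n) powr (1 / p)) powr p \<le> (1 / real (Suc n)) powr p"
      using p1 by (intro powr_mono2) auto
    \<comment> \<open>The base is at most 1 and p > 1, so the rate 1/(n+1) survives the removal of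
      the p-th root.\<close>
    also have "\<dots> \<le> (1 / real (Suc n)) powr 1"
      using p1 by (intro powr_mono') auto
    finally show ?thesis using p1 nn[of n] by (simp add: powr_powr)
  qed
  have inv: "(\<lambda>n. 1 / real (Suc n)) \<longlonglongrightarrow> 0" by (rule lim_1_over_n[THEN LIMSEQ_Suc])
  have A: "\<forall>n. norm (A n) \<le> 1 / real (Suc n)" and B: "\<forall>n. norm (B n) \<le> 1 / real (Suc n)"
    using le nn by (smt (verit) real_norm_def)+
  have "A \<longlonglongrightarrow> 0" "B \<longlonglongrightarrow> 0"
    by (rule Lim_null_comparison[OF always_eventually[OF A] inv],
        rule Lim_null_comparison[OF always_eventually[OF B] inv])
  then have "Lp_lim \<zeta> u" "Lp_lim (\<lambda>n. grad (\<zeta> n)) (weak_gradient \<Omega> u)"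
    by (simp_all add: Lp_lim_def A_def[abs_def] B_def[abs_def])
  then show ?thesis using that \<zeta>(1) u W by blast
qed

text \<open>With \<open>f\<close> and \<open>g\<close> only in L^1, approximants of a bounded test
  object must themselves stay bounded. They are obtained by smooth truncation of an almost
  everywhere convergent approximating sequence; at the values of \<open>u\<close> the truncation is
  the identity with derivative 1, so the limits are unchanged.\<close>

lemma bounded_approximation:
  assumes "u \<in> sobolev_space_0 \<Omega> p \<inter> Linfty_functions \<Omega>"
  obtains \<zeta> B where "\<And>n. \<zeta> n \<in> test_functions \<Omega>" "\<And>n x. \<bar>\<zeta> n x\<bar> \<le> B"
    "AE x in \<mu>. (\<lambda>n. \<zeta> n x) \<longlonglongrightarrow> u x" "Lp_fun (weak_gradient \<Omega> u)"
    "Lp_lim (\<lambda>n. grad (\<zeta> n)) (weak_gradient \<Omega> u)"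
proof -
  obtain \<phi> where \<phi>: "\<And>n. \<phi> n \<in> test_functions \<Omega>" "Lp_fun u" "Lp_lim \<phi> u"
    "Lp_fun (weak_gradient \<Omega> u)" "Lp_lim (\<lambda>n. grad (\<phi> n)) (weak_gradient \<Omega> u)"
    using sobolev_space_0E[of u] assms by blast
  obtain r where r: "strict_mono r" "AE x in \<mu>. (\<lambda>n. \<phi> (r n) x) \<longlonglongrightarrow> u x"
    using Lp_lim_imp_AE_subseq[OF test_function_Lp(1)[OF \<phi>(1)] \<phi>(2,3)] by blast
  obtain C where C: "AE x in \<mu>. \<bar>u x\<bar> \<le> C"
    using assms by (auto simp: Linfty_functions_def)
  \<comment> \<open>On an empty domain an essential bound \<open>C\<close> may be negative, whereas
    the truncation level has to be nonnegative.\<close>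
  define k where "k = \<bar>C\<bar>"
  have k: "k \<ge> 0" "AE x in \<mu>. \<bar>u x\<bar> \<le> k" using C by (auto simp: k_def)
  obtain \<psi> \<eta> :: "real \<Rightarrow> real" where \<psi>: "smooth \<psi>" "\<And>t. (\<psi> has_real_derivative \<eta> t) (at t)"
    "continuous_on UNIV \<eta>" "\<And>t. 0 \<le> \<eta> t" "\<And>t. \<eta> t \<le> 1" "\<And>t. \<bar>t\<bar> \<le> k \<Longrightarrow> \<eta> t = 1"
    "\<And>t. \<bar>t\<bar> \<le> k \<Longrightarrow> \<psi> t = t" "\<And>t. t \<ge> k \<Longrightarrow> k \<le> \<psi> t \<and> \<psi> t \<le> t"
    "\<And>t. t \<le> - k \<Longrightarrow> t \<le> \<psi> t \<and> \<psi> t \<le> - k" "\<And>t. \<bar>\<psi> t\<bar> \<le> k + 1"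
    by (rule smooth_truncation_exists[OF k(1)]) (rule that)
  define \<zeta> where "\<zeta> n x = \<psi> (\<phi> (r n) x)" for n x
  have \<zeta>: "\<zeta> n \<in> test_functions \<Omega>" for n
    unfolding \<zeta>_def[abs_def] by (rule test_functions_compose[OF \<phi>(1) \<psi>(1)]) (simp add: \<psi>(7) k(1))
  have g\<zeta>: "grad (\<zeta> n) x = \<eta> (\<phi> (r n) x) *\<^sub>R grad (\<phi> (r n)) x" for n x
    unfolding \<zeta>_def[abs_def] by (rule grad_compose[OF \<psi>(2) test_functions_smooth[OF \<phi>(1)]])
  \<comment> \<open>An intermediate sequence: the truncation factor of
    \<open>grad (\<zeta> n)\<close> applied to the limit gradient. It is no farther from
    \<open>grad (\<zeta> n)\<close> than the untruncated gradients are from their limit, and it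
    tends to the limit gradient by dominated convergence.\<close>
  define H where "H n x = \<eta> (\<phi> (r n) x) *\<^sub>R weak_gradient \<Omega> u x" for n x
  have [measurable]: "\<eta> \<in> borel_measurable borel" using \<psi>(3) by (rule borel_measurable_continuous_onI)
  note [measurable] = Lp_fun_measurable[OF \<phi>(4)] Lp_fun_measurable[OF test_function_Lp(1)[OF \<phi>(1)]]
  have Hm [measurable]: "H n \<in> borel_measurable (\<mu>)" for n unfolding H_def[abs_def] by measurable
  have LH: "Lp_fun (H n)" for n
    unfolding Lp_fun_def
  proof
    show "integrable (\<mu>) (\<lambda>x. norm (H n x) powr p)"
    proof (rule Bochner_Integration.integrable_bound[OF Lp_fun_integrable[OF \<phi>(4)]])
      show "AE x in \<mu>. norm (norm (H n x) powr p) \<le> norm (norm (weak_gradient \<Omega> u x) powr p)"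
        using \<psi>(4,5) p1 by (intro AE_I2) (auto simp: H_def intro!: powr_mono2 mult_left_le_one_le)
    qed measurable
  qed fact
  have 1: "(\<lambda>n. LINT x|\<mu>. norm (grad (\<zeta> n) x - H n x) powr p) \<longlonglongrightarrow> 0"
  proof (rule Lim_null_comparison[OF always_eventually Lp_lim_subseq[OF \<phi>(5) r(1), unfolded Lp_lim_def]], rule allI)
    fix n
    have "(LINT x|\<mu>. norm (grad (\<zeta> n) x - H n x) powr p)
        \<le> (LINT x|\<mu>. norm (grad (\<phi> (r n)) x - weak_gradient \<Omega> u x) powr p)"
    proof (rule integral_mono)
      show "integrable (\<mu>) (\<lambda>x. norm (grad (\<zeta> n) x - H n x) powr p)"
        by (intro Lp_fun_integrable Lp_fun_diff test_function_Lp(2) \<zeta> LH)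
      show "integrable (\<mu>) (\<lambda>x. norm (grad (\<phi> (r n)) x - weak_gradient \<Omega> u x) powr p)"
        by (intro Lp_fun_integrable Lp_fun_diff test_function_Lp(2) \<phi>)
      show "norm (grad (\<zeta> n) x - H n x) powr p \<le> norm (grad (\<phi> (r n)) x - weak_gradient \<Omega> u x) powr p" for x
        unfolding g\<zeta> H_def scaleR_diff_right[symmetric]
        using \<psi>(4,5) p1 by (auto intro!: powr_mono2 mult_left_le_one_le)
    qed
    then show "norm (LINT x|\<mu>. norm (grad (\<zeta> n) x - H n x) powr p)
        \<le> (LINT x|\<mu>. norm (grad (\<phi> (r n)) x - weak_gradient \<Omega> u x) powr p)"
      by simp
  qed
  have 2: "Lp_lim H (weak_gradient \<Omega> u)"
  proof (rule Lp_lim_dominated[OF Hm _ \<phi>(4)])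
    show "AE x in \<mu>. norm (H n x - weak_gradient \<Omega> u x) \<le> norm (weak_gradient \<Omega> u x)" for n
    proof (rule AE_I2)
      fix x
      have "H n x - weak_gradient \<Omega> u x = (\<eta> (\<phi> (r n) x) - 1) *\<^sub>R weak_gradient \<Omega> u x"
        by (simp add: H_def scaleR_diff_left)
      then show "norm (H n x - weak_gradient \<Omega> u x) \<le> norm (weak_gradient \<Omega> u x)"
        using \<psi>(4,5) by (auto intro!: mult_left_le_one_le simp: abs_le_iff)
    qed
    show "AE x in \<mu>. (\<lambda>n. H n x) \<longlonglongrightarrow> weak_gradient \<Omega> u x"
      using r(2) k(2)
    proof eventually_elim
      case (elim x)
      have "(\<lambda>n. \<eta> (\<phi> (r n) x)) \<longlonglongrightarrow> \<eta> (u x)"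
        using elim(1) \<psi>(3) by (intro continuous_on_tendsto_compose[OF \<psi>(3)]) auto
      then have "(\<lambda>n. \<eta> (\<phi> (r n) x)) \<longlonglongrightarrow> 1" using \<psi>(6)[OF elim(2)] by simp
      then have "(\<lambda>n. H n x) \<longlonglongrightarrow> 1 *\<^sub>R weak_gradient \<Omega> u x"
        unfolding H_def by (intro tendsto_intros)
      then show ?case by simp
    qed
  qed (use \<phi>(4) in measurable)
  have 3: "Lp_lim (\<lambda>n. grad (\<zeta> n)) (weak_gradient \<Omega> u)"
    by (rule Lp_lim_trans[OF test_function_Lp(2)[OF \<zeta>] LH \<phi>(4) 1 2])
  have 4: "AE x in \<mu>. (\<lambda>n. \<zeta> n x) \<longlonglongrightarrow> u x"
    using r(2) k(2)
  proof eventually_elim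
    case (elim x)
    have "(\<lambda>n. \<psi> (\<phi> (r n) x)) \<longlonglongrightarrow> \<psi> (u x)"
      using elim(1) by (intro continuous_on_tendsto_compose[OF smooth_imp_continuous[OF \<psi>(1), of UNIV]]) auto
    then show ?case using \<psi>(7)[OF elim(2)] by (simp add: \<zeta>_def)
  qed
  show ?thesis
    by (rule that[of \<zeta> "k + 1"]) (use \<zeta> \<psi>(10) 3 4 \<phi>(4) in \<open>simp_all add: \<zeta>_def[symmetric]\<close>, simp add: \<zeta>_def \<psi>(10))
qed

end

subsection \<open>Compactness\<close>

text \<open>The increment is the integral of the directional derivative along the segment from
  \<open>x\<close> to x + z. Exchanging the integrals and translating each slice back leaves |z|
  times the L^1 norm of the gradient. Nonnegative integrals avoid integrability side
  conditions.\<close>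

lemma L1_translation_estimate:
  fixes w :: "'a::euclidean_space \<Rightarrow> real"
  assumes w: "smooth w"
  shows "(\<integral>\<^sup>+x. ennreal \<bar>w (x + z) - w x\<bar> \<partial>lborel) \<le> ennreal (norm z) * (\<integral>\<^sup>+x. ennreal (norm (grad w x)) \<partial>lborel)"
proof -
  have [measurable]: "grad w \<in> borel_measurable borel"
    by (rule borel_measurable_continuous_onI) (rule continuous_grad[OF w])
  have pt: "ennreal \<bar>w (x + z) - w x\<bar>
      \<le> (\<integral>\<^sup>+t. ennreal (norm z) * (indicator {0..1} t * ennreal (norm (grad w (x + t *\<^sub>R z)))) \<partial>lborel)" for x
  proof -
    let ?f = "\<lambda>t. grad w (x + t *\<^sub>R z) \<bullet> z"
    have cont: "continuous_on {0..1} ?f"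
      by (intro continuous_intros continuous_on_compose2[OF continuous_grad[OF w, of UNIV]]) auto
    have "integral\<^sup>L lborel (\<lambda>t. indicator {0..1} t *\<^sub>R ?f t) = w (x + 1 *\<^sub>R z) - w (x + 0 *\<^sub>R z)"
    proof (rule integral_FTC_atLeastAtMost[OF _ _ cont])
      show "((\<lambda>t. w (x + t *\<^sub>R z)) has_vector_derivative ?f t) (at t within {0..1})" for t
        using line_derivative[OF w, of x z t]
        by (simp add: has_real_derivative_iff_has_vector_derivative has_vector_derivative_at_within)
    qed simp
    then have "ennreal \<bar>w (x + z) - w x\<bar> = ennreal (norm (integral\<^sup>L lborel (\<lambda>t. indicator {0..1} t *\<^sub>R ?f t)))"
      by simp
    also have "\<dots> \<le> (\<integral>\<^sup>+t. ennreal (norm (indicator {0..1} t *\<^sub>R ?f t)) \<partial>lborel)"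
      using borel_integrable_atLeastAtMost'[OF cont]
      by (intro integral_norm_bound_ennreal) (simp add: set_integrable_def)
    also have "\<dots> \<le> (\<integral>\<^sup>+t. ennreal (norm z) * (indicator {0..1} t * ennreal (norm (grad w (x + t *\<^sub>R z)))) \<partial>lborel)"
    proof (rule nn_integral_mono)
      fix t :: real
      have "\<bar>?f t\<bar> \<le> norm z * norm (grad w (x + t *\<^sub>R z))"
        using Cauchy_Schwarz_ineq2[of "grad w (x + t *\<^sub>R z)" z] by (simp add: mult.commute)
      then have "ennreal \<bar>?f t\<bar> \<le> ennreal (norm z) * ennreal (norm (grad w (x + t *\<^sub>R z)))"
        by (simp add: ennreal_leI flip: ennreal_mult)
      then show "ennreal (norm (indicator {0..1} t *\<^sub>R ?f t))
          \<le> ennreal (norm z) * (indicator {0..1} t * ennreal (norm (grad w (x + t *\<^sub>R z))))"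
        by (cases "t \<in> {0..1}") auto
    qed
    finally show ?thesis .
  qed
  have ps: "pair_sigma_finite (lborel :: 'a measure) (lborel :: real measure)"
    by (intro pair_sigma_finite.intro sigma_finite_lborel)
  have "(\<integral>\<^sup>+x. ennreal \<bar>w (x + z) - w x\<bar> \<partial>lborel)
      \<le> (\<integral>\<^sup>+x. (\<integral>\<^sup>+t. ennreal (norm z) * (indicator {0..1} t * ennreal (norm (grad w (x + t *\<^sub>R z)))) \<partial>lborel) \<partial>lborel)"
    by (rule nn_integral_mono) (rule pt)
  also have "\<dots> = (\<integral>\<^sup>+t. (\<integral>\<^sup>+x. ennreal (norm z) * (indicator {0..1} t * ennreal (norm (grad w (x + t *\<^sub>R z)))) \<partial>lborel) \<partial>lborel)"
    by (rule pair_sigma_finite.Fubini'[OF ps, symmetric]) measurable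
  also have "\<dots> = (\<integral>\<^sup>+t. ennreal (norm z) * (indicator {0..1} t * (\<integral>\<^sup>+x. ennreal (norm (grad w x)) \<partial>lborel)) \<partial>(lborel :: real measure))"
  proof (rule nn_integral_cong)
    fix t :: real
    have "(\<integral>\<^sup>+x. ennreal (norm (grad w (x + t *\<^sub>R z))) \<partial>lborel) = (\<integral>\<^sup>+x. ennreal (norm (grad w x)) \<partial>lborel)"
      using nn_integral_lborel_translation[of "\<lambda>x. ennreal (norm (grad w x))" "t *\<^sub>R z"] by (simp add: add.commute)
    then show "(\<integral>\<^sup>+x. ennreal (norm z) * (indicator {0..1} t * ennreal (norm (grad w (x + t *\<^sub>R z)))) \<partial>lborel)
        = ennreal (norm z) * (indicator {0..1} t * (\<integral>\<^sup>+x. ennreal (norm (grad w x)) \<partial>lborel))"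
      by (simp add: nn_integral_cmult)
  qed
  also have "\<dots> = ennreal (norm z) * (\<integral>\<^sup>+x. ennreal (norm (grad w x)) \<partial>lborel)"
    by (simp add: nn_integral_cmult nn_integral_multc)
  finally show ?thesis .
qed

text \<open>A Lipschitz kernel supported in the ball of radius \<open>r\<close>, serving as a
  mollifier. It is not normalised: its mass appears as a factor in the estimates for
  \<open>average\<close> and is divided out at the end of the compactness proof.\<close>

definition tent :: "real \<Rightarrow> 'a::euclidean_space \<Rightarrow> real" where
  "tent r y = max 0 (1 - norm y / r)"

definition average :: "real \<Rightarrow> ('a::euclidean_space \<Rightarrow> real) \<Rightarrow> 'a \<Rightarrow> real" where
  "average r w x = (LINT y|lborel. tent r (y - x) * w y)"

lemma continuous_tent [continuous_intros]:
  "continuous_on S f \<Longrightarrow> continuous_on S (\<lambda>x. tent r (f x))"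
  unfolding tent_def by (cases "r = 0") (auto intro!: continuous_intros)

lemma tent_measurable [measurable]: "tent r \<in> borel_measurable borel"
  by (intro borel_measurable_continuous_onI continuous_tent continuous_on_id)

lemma tent_bounds:
  assumes "r > 0"
  shows "0 \<le> tent r y" "tent r y \<le> 1" "norm y > r \<Longrightarrow> tent r y = 0"
    "\<bar>tent r y - tent r z\<bar> \<le> norm (y - z) / r"
proof -
  show "\<bar>tent r y - tent r z\<bar> \<le> norm (y - z) / r"
  proof -
    have "\<bar>tent r y - tent r z\<bar> \<le> \<bar>(1 - norm y / r) - (1 - norm z / r)\<bar>"
      unfolding tent_def by linarith
    also have "\<dots> = \<bar>norm y - norm z\<bar> / r"
      using assms by (simp add: diff_divide_distrib[symmetric] abs_minus_commute)
    also have "\<dots> \<le> norm (y - z) / r"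
      using assms norm_triangle_ineq3[of y z] by (intro divide_right_mono) auto
    finally show ?thesis .
  qed
qed (use assms in \<open>auto simp: tent_def field_simps\<close>)

lemma tent_integrable: "r > 0 \<Longrightarrow> integrable lborel (tent r)"
  by (rule compact_support_integrable[of _ "cball 0 r"])
    (auto intro!: continuous_intros tent_bounds(3))

lemma tent_integral_pos:
  assumes "r > 0" shows "(LINT y|lborel. tent r (y :: 'a::euclidean_space)) > 0"
proof -
  have "0 < (1 / 2) * measure lborel (ball (0::'a) (r / 2))"
    using assms content_ball_pos[of "r / 2" "0::'a"] by simp
  also have "\<dots> = (LINT y|lborel. (1 / 2) * indicator (ball (0::'a) (r / 2)) y)"
    by simp
  also have "\<dots> \<le> (LINT y|lborel. tent r (y :: 'a))"
  proof (rule integral_mono)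
    show "integrable lborel (\<lambda>y. (1 / 2) * indicator (ball (0::'a) (r / 2)) y :: real)"
      by (intro integrable_mult_right integrable_real_indicator)
        (simp_all add: emeasure_bounded_finite[unfolded infinity_ennreal_def])
    show "(1 / 2) * indicator (ball 0 (r / 2)) y \<le> tent r y" for y :: 'a
      using assms by (auto simp: tent_def indicator_def field_simps)
  qed (rule tent_integrable[OF assms])
  finally show ?thesis .
qed

text \<open>The difference is, up to sign, the tent-weighted integral of the increments w (x + y) -
  w x. After exchanging the integrals each increment costs |y| times the total gradient, and the
  tent vanishes for |y| > r.\<close>

lemma average_estimate:
  fixes w :: "'a::euclidean_space \<Rightarrow> real"
  assumes w: "smooth w" and C: "compact C" "\<And>x. x \<notin> C \<Longrightarrow> w x = 0" and r: "r > 0"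
  shows "(\<integral>\<^sup>+x. ennreal \<bar>(LINT y|lborel. tent r (y :: 'a)) * w x - average r w x\<bar> \<partial>lborel)
    \<le> ennreal ((LINT y|lborel. tent r (y :: 'a)) * r) * (\<integral>\<^sup>+x. ennreal (norm (grad w x)) \<partial>lborel)"
proof -
  have wm [measurable]: "w \<in> borel_measurable borel"
    by (rule borel_measurable_continuous_onI) (rule smooth_imp_continuous[OF w])
  let ?D = "\<integral>\<^sup>+x. ennreal (norm (grad w x)) \<partial>lborel"
  have pt: "ennreal \<bar>(LINT y|lborel. tent r (y :: 'a)) * w x - average r w x\<bar>
      \<le> (\<integral>\<^sup>+y. ennreal (tent r y) * ennreal \<bar>w (x + y) - w x\<bar> \<partial>lborel)" for x
  proof -
    have av: "average r w x = (LINT y|lborel. tent r y * w (x + y))"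
      using integral_lborel_translation[of "\<lambda>y. tent r (y - x) * w y" x] by (simp add: average_def)
    have i: "integrable lborel (\<lambda>y. tent r y * w (x + y))"
      using r by (intro compact_support_integrable[of _ "cball 0 r"] continuous_intros
          continuous_on_compose2[OF smooth_imp_continuous[OF w, of UNIV]]) (auto simp: tent_bounds(3))
    have "(LINT y|lborel. tent r (y :: 'a)) * w x - average r w x = (LINT y|lborel. tent r y * w x - tent r y * w (x + y))"
      using i tent_integrable[OF r, where 'a='a] by (simp add: av)
    then have "ennreal \<bar>(LINT y|lborel. tent r (y :: 'a)) * w x - average r w x\<bar>
        = ennreal (norm (LINT y|lborel. tent r y * w x - tent r y * w (x + y)))" by simp
    also have "\<dots> \<le> (\<integral>\<^sup>+y. ennreal (norm (tent r y * w x - tent r y * w (x + y))) \<partial>lborel)"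
      using i tent_integrable[OF r, where 'a='a]
      by (intro integral_norm_bound_ennreal Bochner_Integration.integrable_diff integrable_mult_left) auto
    also have "\<dots> = (\<integral>\<^sup>+y. ennreal (tent r y) * ennreal \<bar>w (x + y) - w x\<bar> \<partial>lborel)"
    proof (rule nn_integral_cong)
      fix y :: 'a
      have "norm (tent r y * w x - tent r y * w (x + y)) = tent r y * \<bar>w (x + y) - w x\<bar>"
        using tent_bounds(1)[OF r, of y]
        by (simp add: right_diff_distrib[symmetric] abs_mult abs_minus_commute)
      then show "ennreal (norm (tent r y * w x - tent r y * w (x + y))) = ennreal (tent r y) * ennreal \<bar>w (x + y) - w x\<bar>"
        using tent_bounds(1)[OF r, of y] by (simp add: ennreal_mult)
    qed
    finally show ?thesis .
  qed
  have ps: "pair_sigma_finite (lborel :: 'a measure) (lborel :: 'a measure)"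
    by (intro pair_sigma_finite.intro sigma_finite_lborel)
  have "(\<integral>\<^sup>+x. ennreal \<bar>(LINT y|lborel. tent r (y :: 'a)) * w x - average r w x\<bar> \<partial>lborel)
      \<le> (\<integral>\<^sup>+x. (\<integral>\<^sup>+y. ennreal (tent r y) * ennreal \<bar>w (x + y) - w x\<bar> \<partial>lborel) \<partial>lborel)"
    by (rule nn_integral_mono) (rule pt)
  also have "\<dots> = (\<integral>\<^sup>+y. (\<integral>\<^sup>+x. ennreal (tent r y) * ennreal \<bar>w (x + y) - w x\<bar> \<partial>lborel) \<partial>lborel)"
    by (rule pair_sigma_finite.Fubini'[OF ps, symmetric]) measurable
  also have "\<dots> \<le> (\<integral>\<^sup>+y. ennreal (tent r y) * (ennreal r * ?D) \<partial>(lborel :: 'a measure))"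
  proof (rule nn_integral_mono)
    fix y :: 'a
    have "(\<integral>\<^sup>+x. ennreal (tent r y) * ennreal \<bar>w (x + y) - w x\<bar> \<partial>lborel)
        = ennreal (tent r y) * (\<integral>\<^sup>+x. ennreal \<bar>w (x + y) - w x\<bar> \<partial>lborel)"
      by (rule nn_integral_cmult) measurable
    also have "\<dots> \<le> ennreal (tent r y) * (ennreal (norm y) * ?D)"
      by (intro mult_left_mono L1_translation_estimate[OF w]) simp
    also have "\<dots> \<le> ennreal (tent r y) * (ennreal r * ?D)"
    proof (cases "norm y \<le> r")
      case True
      then show ?thesis by (intro mult_left_mono mult_right_mono ennreal_leI) auto
    next
      case False
      then show ?thesis using tent_bounds(3)[OF r, of y] by simp
    qed
    finally show "(\<integral>\<^sup>+x. ennreal (tent r y) * ennreal \<bar>w (x + y) - w x\<bar> \<partial>lborel)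
        \<le> ennreal (tent r y) * (ennreal r * ?D)" .
  qed
  also have "\<dots> = ennreal (LINT y|lborel. tent r (y :: 'a)) * (ennreal r * ?D)"
  proof -
    have "(\<integral>\<^sup>+y. ennreal (tent r (y :: 'a)) \<partial>lborel) = ennreal (LINT y|lborel. tent r (y :: 'a))"
      by (rule nn_integral_eq_integral[OF tent_integrable[OF r]]) (simp add: tent_bounds(1)[OF r])
    then show ?thesis by (simp add: nn_integral_multc)
  qed
  also have "\<dots> = ennreal ((LINT y|lborel. tent r (y :: 'a)) * r) * ?D"
    using r tent_integral_pos[OF r, where 'a='a] by (simp add: ennreal_mult mult.assoc)
  finally show ?thesis .
qed

text \<open>The tent is at most 1 and has Lipschitz constant 1/r, so both bounds see
  \<open>w\<close> only through its L^1 norm. For fixed \<open>r\<close> the averages of an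
  L^1-bounded sequence are therefore uniformly bounded and equi-Lipschitz.\<close>

lemma average_bounds:
  fixes w :: "'a::euclidean_space \<Rightarrow> real"
  assumes w: "integrable lborel w" and r: "r > 0"
  shows "\<bar>average r w x\<bar> \<le> (LINT y|lborel. \<bar>w y\<bar>)"
    and "\<bar>average r w x - average r w z\<bar> \<le> norm (x - z) / r * (LINT y|lborel. \<bar>w y\<bar>)"
proof -
  note [measurable] = borel_measurable_integrable[OF w]
  have tn: "\<bar>tent r z\<bar> \<le> 1" for z :: 'a
    using tent_bounds(1,2)[OF r, of z] by linarith
  have i: "integrable lborel (\<lambda>y. tent r (y - x) * w y)" for x
  proof (rule Bochner_Integration.integrable_bound[OF w])
    show "AE y in lborel. norm (tent r (y - x) * w y) \<le> norm (w y)"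
      using tn by (intro AE_I2) (auto simp: abs_mult intro!: mult_left_le_one_le)
  qed measurable
  have "\<bar>average r w x\<bar> \<le> (LINT y|lborel. \<bar>tent r (y - x) * w y\<bar>)"
    unfolding average_def by (rule integral_abs_bound)
  also have "\<dots> \<le> (LINT y|lborel. \<bar>w y\<bar>)"
  proof (rule integral_mono)
    show "\<bar>tent r (y - x) * w y\<bar> \<le> \<bar>w y\<bar>" for y
      using tn[of "y - x"] by (auto simp: abs_mult intro!: mult_left_le_one_le)
  qed (use i w in auto)
  finally show "\<bar>average r w x\<bar> \<le> (LINT y|lborel. \<bar>w y\<bar>)" .
  have "average r w x - average r w z = (LINT y|lborel. tent r (y - x) * w y - tent r (y - z) * w y)"
    unfolding average_def using i by simp
  also have "\<bar>\<dots>\<bar> \<le> (LINT y|lborel. \<bar>tent r (y - x) * w y - tent r (y - z) * w y\<bar>)"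
    by (rule integral_abs_bound)
  also have "\<dots> \<le> (LINT y|lborel. norm (x - z) / r * \<bar>w y\<bar>)"
  proof (rule integral_mono)
    show "\<bar>tent r (y - x) * w y - tent r (y - z) * w y\<bar> \<le> norm (x - z) / r * \<bar>w y\<bar>" for y
    proof -
      have "\<bar>tent r (y - x) - tent r (y - z)\<bar> \<le> norm (x - z) / r"
        using tent_bounds(4)[OF r, of "y - x" "y - z"] by (simp add: norm_minus_commute)
      from mult_right_mono[OF this, of "\<bar>w y\<bar>"] show ?thesis
        by (simp add: left_diff_distrib[symmetric] abs_mult)
    qed
  qed (use i w in \<open>auto intro!: integrable_mult_right\<close>)
  finally show "\<bar>average r w x - average r w z\<bar> \<le> norm (x - z) / r * (LINT y|lborel. \<bar>w y\<bar>)"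
    by simp
qed

lemma average_continuous:
  fixes w :: "'a::euclidean_space \<Rightarrow> real"
  assumes w: "integrable lborel w" and r: "r > 0"
  shows "continuous_on UNIV (average r w)"
proof -
  define L where "L = (LINT y|lborel. \<bar>w y\<bar>) / r"
  have L: "L \<ge> 0" using r by (simp add: L_def)
  have "L-lipschitz_on UNIV (average r w)"
    using L average_bounds(2)[OF w r] by (intro lipschitz_onI) (auto simp: dist_norm L_def mult.commute)
  then show ?thesis by (rule lipschitz_on_continuous_on)
qed

text \<open>For fixed \<open>r\<close> the averages are equi-Lipschitz, so a diagonal sequence of them converges everywhere.\<close>

lemma averages_convergent_subsequence:
  fixes w :: "nat \<Rightarrow> 'a::euclidean_space \<Rightarrow> real"
  assumes w: "\<And>n. integrable lborel (w n)" and W: "\<And>n. (LINT y|lborel. \<bar>w n y\<bar>) \<le> W"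
  obtains s where "strict_mono (s :: nat \<Rightarrow> nat)"
    "\<And>j x. convergent (\<lambda>n. average (1 / real (Suc j)) (w (s n)) x)"
proof -
  obtain D :: "'a set" where D: "countable D" "\<And>X. open X \<Longrightarrow> X \<noteq> {} \<Longrightarrow> \<exists>d\<in>D. d \<in> X"
    using countable_dense_exists by metis
  \<comment> \<open>Pairs of a point of a countable dense set and a radius index form one countable
    index set, so a single diagonal extraction serves all radii.\<close>
  define f where "f n z = average (1 / real (Suc (snd z))) (w n) (fst z)" for n and z :: "'a \<times> nat"
  have W0: "W \<ge> 0" using W[of 0] by (rule order.trans[rotated]) simp
  have "countable (D \<times> (UNIV :: nat set))" using D(1) by auto
  moreover have "norm (f n z) \<le> W" if "z \<in> D \<times> UNIV" for n z
    using average_bounds(1)[OF w, of "1 / real (Suc (snd z))" n "fst z"] W[of n] by (simp add: f_def)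
  ultimately obtain s where s: "strict_mono (s :: nat \<Rightarrow> nat)"
    "\<And>z. z \<in> D \<times> UNIV \<Longrightarrow> \<exists>l. (\<lambda>n. f (s n) z) \<longlonglongrightarrow> l"
    using function_convergent_subsequence[of "D \<times> (UNIV :: nat set)" f W] by metis
  have "convergent (\<lambda>n. average (1 / real (Suc j)) (w (s n)) x)" for j x
  proof -
    have "Cauchy (\<lambda>n. average (1 / real (Suc j)) (w (s n)) x)"
    proof (rule metric_CauchyI)
      fix e :: real assume e: "e > 0"
      \<comment> \<open>The Lipschitz constants are at most (j + 1) W, so moving by less than
        \<delta> changes an average by at most e/3; writing W + 1 avoids a zero denominator.\<close>
      define \<delta> where "\<delta> = e / (3 * real (Suc j) * (W + 1))"
      have \<delta>: "\<delta> > 0" using e W0 by (simp add: \<delta>_def)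
      obtain d where d: "d \<in> D" "d \<in> ball x \<delta>" using D(2)[of "ball x \<delta>"] \<delta> by auto
      have near: "\<bar>average (1 / real (Suc j)) (w n) x - average (1 / real (Suc j)) (w n) d\<bar> \<le> e / 3" for n
      proof -
        have "\<bar>average (1 / real (Suc j)) (w n) x - average (1 / real (Suc j)) (w n) d\<bar>
            \<le> norm (x - d) / (1 / real (Suc j)) * (LINT y|lborel. \<bar>w n y\<bar>)"
          by (rule average_bounds(2)[OF w]) simp
        also have "\<dots> \<le> (\<delta> * real (Suc j)) * (W + 1)"
          using d(2) W[of n] \<delta> by (intro mult_mono) (auto simp: dist_norm intro!: mult_right_mono)
        also have "\<dots> = e / 3"
        proof -
          have "W + 1 \<noteq> 0" "real (Suc j) \<noteq> 0" using W0 by auto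
          moreover have "e / (3 * a * b) * a * b = e / 3" if "a \<noteq> 0" "b \<noteq> 0" for a b :: real
            using that by simp
          ultimately show ?thesis unfolding \<delta>_def by blast
        qed
        finally show ?thesis .
      qed
      obtain l where "(\<lambda>n. f (s n) (d, j)) \<longlonglongrightarrow> l" using s(2)[of "(d, j)"] d(1) by auto
      then have "Cauchy (\<lambda>n. average (1 / real (Suc j)) (w (s n)) d)"
        using LIMSEQ_imp_Cauchy by (simp add: f_def)
      from metric_CauchyD[OF this, of "e / 3"] e obtain N where
        N: "\<And>m n. m \<ge> N \<Longrightarrow> n \<ge> N \<Longrightarrow>
          dist (average (1 / real (Suc j)) (w (s m)) d) (average (1 / real (Suc j)) (w (s n)) d) < e / 3"
        by auto
      have "dist (average (1 / real (Suc j)) (w (s m)) x) (average (1 / real (Suc j)) (w (s n)) x) < e"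
        if "m \<ge> N" "n \<ge> N" for m n
        using N[OF that] near[of "s m"] near[of "s n"] unfolding dist_real_def by linarith
      then show "\<exists>N. \<forall>m\<ge>N. \<forall>n\<ge>N. dist (average (1 / real (Suc j)) (w (s m)) x) (average (1 / real (Suc j)) (w (s n)) x) < e"
        by blast
    qed
    then show ?thesis by (simp only: Cauchy_convergent_iff)
  qed
  with s(1) show ?thesis using that by blast
qed

context bounded_domain
begin

lemma test_function_integral_lborel:
  assumes "continuous_on UNIV f" "\<And>x. x \<notin> \<Omega> \<Longrightarrow> f x = 0"
  shows "(LINT x|\<mu>. f x) = (LINT x|lborel. f x :: real)"
    "integrable (\<mu>) f \<longleftrightarrow> integrable lborel f"
  using assms by (simp_all add: integrable_lebesgue_on_iff_lborel borel_measurable_continuous_onI)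

text \<open>The gradient bound keeps every function close in L^1 to its averages of small radius,
  uniformly in \<open>n\<close>, while the averages converge pointwise and boundedly along a
  subsequence. That subsequence is thus Cauchy in L^1, and a further one converges almost
  everywhere.\<close>

lemma rellich:
  assumes \<phi>: "\<And>n. \<phi> n \<in> test_functions \<Omega>" and k: "\<And>n x. \<bar>\<phi> n x\<bar> \<le> k"
    and E: "\<And>n. (LINT x|\<mu>. norm (grad (\<phi> n) x) powr p) \<le> E"
  obtains s where "strict_mono (s :: nat \<Rightarrow> nat)" "AE x in \<mu>. convergent (\<lambda>n. \<phi> (s n) x)"
proof -
  have out: "\<phi> n x = 0" "grad (\<phi> n) x = 0" if "x \<notin> \<Omega>" for n x
    using test_functionsE[OF \<phi>[of n]] that by (metis subsetD)+
  have sm: "smooth (\<phi> n)" for n by (rule test_functions_smooth[OF \<phi>])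
  have cont: "continuous_on UNIV (\<phi> n)" "continuous_on UNIV (\<lambda>x. \<bar>\<phi> n x\<bar>)" "continuous_on UNIV (\<lambda>x. norm (grad (\<phi> n) x))" for n
    by (intro continuous_intros smooth_imp_continuous continuous_grad sm)+
  have Mint: "integrable \<mu> (\<phi> n)" for n
    by (intro Lp_fun_imp_integrable test_function_Lp \<phi>)
  have int: "integrable lborel (\<phi> n)" for n
    using Mint[of n] test_function_integral_lborel(2)[OF cont(1)[of n] out(1)] by simp
  define W where "W = k * measure \<mu> (space \<mu>)"
  have W: "(LINT y|lborel. \<bar>\<phi> n y\<bar>) \<le> W" for n
  proof -
    have "(LINT y|lborel. \<bar>\<phi> n y\<bar>) = (LINT y|\<mu>. \<bar>\<phi> n y\<bar>)"
      by (rule test_function_integral_lborel(1)[symmetric, OF cont(2)]) (simp add: out)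
    also have "\<dots> \<le> (LINT y|\<mu>. k)" using k Mint by (intro integral_mono) auto
    finally show ?thesis by (simp add: W_def mult.commute)
  qed
  have W0: "W \<ge> 0" using W[of 0] by (rule order.trans[rotated]) simp
  define D where "D = measure \<mu> (space \<mu>) + E"
  have D: "(LINT x|lborel. norm (grad (\<phi> n) x)) \<le> D" for n
  proof -
    have "(LINT x|lborel. norm (grad (\<phi> n) x)) = (LINT x|\<mu>. norm (grad (\<phi> n) x))"
      by (rule test_function_integral_lborel(1)[symmetric, OF cont(3)]) (simp add: out)
    also have "\<dots> \<le> D"
      using integral_norm_le_eps[OF test_function_Lp(2)[OF \<phi>] zero_less_one, of n] E[of n] by (simp add: D_def)
    finally show ?thesis .
  qed
  have D0: "D \<ge> 0" using D[of 0] by (rule order.trans[rotated]) simp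
  have Dnn: "(\<integral>\<^sup>+x. ennreal (norm (grad (\<phi> n) x)) \<partial>lborel) \<le> ennreal D" for n
  proof -
    have "integrable lborel (\<lambda>x. norm (grad (\<phi> n) x))"
      using integrable_norm[OF Lp_fun_imp_integrable[OF test_function_Lp(2)[OF \<phi>]], of n]
        test_function_integral_lborel(2)[OF cont(3)[of n]] out by simp
    then show ?thesis using D[of n] by (subst nn_integral_eq_integral) (auto intro: ennreal_leI)
  qed
  obtain s where s: "strict_mono (s :: nat \<Rightarrow> nat)"
    "\<And>j x. convergent (\<lambda>n. average (1 / real (Suc j)) (\<phi> (s n)) x)"
    using averages_convergent_subsequence[of \<phi> W, OF int W] by blast
  have "\<exists>N. \<forall>i\<ge>N. \<forall>j\<ge>N. (LINT x|\<mu>. norm (\<phi> (s i) x - \<phi> (s j) x)) < e" if e: "e > 0" for e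
  proof -
    \<comment> \<open>The radius 1/(j+1) makes r D <= e/8. With the mass \<open>c\<close> of the
      tent, the two averaging errors of size c e / 8 and the two tails below c e / 4 add up to less
      than c e, and \<open>c\<close> cancels.\<close>
    obtain j where j: "(8 * (D + 1)) / e < real (Suc j)"
      using reals_Archimedean2 by (metis less_trans of_nat_less_iff lessI)
    define r where "r = 1 / real (Suc j)"
    have r: "r > 0" by (simp add: r_def)
    have rD: "r * D \<le> e / 8"
    proof -
      have "8 * (D + 1) < real (Suc j) * e" using j e by (simp add: pos_divide_less_eq)
      then have "8 * D < real (Suc j) * e" by simp
      then show ?thesis by (simp add: r_def field_simps)
    qed
    define c where "c = (LINT y|lborel. tent r (y :: 'a))"
    have c: "c > 0" unfolding c_def by (rule tent_integral_pos[OF r])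
    define a where "a x = lim (\<lambda>n. average r (\<phi> (s n)) x)" for x
    have a: "(\<lambda>n. average r (\<phi> (s n)) x) \<longlonglongrightarrow> a x" for x
      using s(2)[of j x] unfolding a_def r_def by (rule convergent_LIMSEQ_iff[THEN iffD1])
    have mav [measurable]: "average r (\<phi> n) \<in> borel_measurable \<mu>" for n
      by (rule continuous_measurable[OF average_continuous[OF int r]])
    have ma [measurable]: "a \<in> borel_measurable \<mu>"
      by (rule borel_measurable_LIMSEQ_real[OF a]) measurable
    have bav: "\<bar>average r (\<phi> n) x\<bar> \<le> W" for n x
      using average_bounds(1)[OF int r] W order.trans by blast
    have ba: "\<bar>a x\<bar> \<le> W" for x
      by (rule Lim_bounded[OF tendsto_rabs[OF a]]) (use bav in blast)
    have iav: "integrable \<mu> (average r (\<phi> n))" for n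
      by (rule integrable_const_bound[where B=W]) (use bav in auto)
    have ia: "integrable \<mu> a"
      by (rule integrable_const_bound[where B=W]) (use ba in auto)
    have "(\<lambda>n. LINT x|\<mu>. \<bar>average r (\<phi> (s n)) x - a x\<bar>) \<longlonglongrightarrow> (LINT x|\<mu>. 0)"
    proof (rule integral_dominated_convergence[where w="\<lambda>_. 2 * W"])
      show "AE x in \<mu>. (\<lambda>n. \<bar>average r (\<phi> (s n)) x - a x\<bar>) \<longlonglongrightarrow> 0"
        using a by (intro AE_I2 tendsto_rabs_zero LIM_zero)
      show "AE x in \<mu>. norm \<bar>average r (\<phi> (s n)) x - a x\<bar> \<le> 2 * W" for n
      proof (rule AE_I2)
        fix x show "norm \<bar>average r (\<phi> (s n)) x - a x\<bar> \<le> 2 * W"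
          using bav[of "s n" x] ba[of x] by simp
      qed
    qed auto
    then have "eventually (\<lambda>n. (LINT x|\<mu>. \<bar>average r (\<phi> (s n)) x - a x\<bar>) < c * e / 4) sequentially"
      using c e by (intro order_tendstoD(2)) auto
    then obtain N where N: "\<And>n. n \<ge> N \<Longrightarrow> (LINT x|\<mu>. \<bar>average r (\<phi> (s n)) x - a x\<bar>) < c * e / 4"
      unfolding eventually_sequentially by blast
    have close: "(LINT x|\<mu>. \<bar>c * \<phi> n x - average r (\<phi> n) x\<bar>) \<le> c * e / 8" for n
    proof -
      obtain C where C: "smooth (\<phi> n)" "compact C" "C \<subseteq> \<Omega>" "\<And>x. x \<notin> C \<Longrightarrow> \<phi> n x = 0"
        "\<And>x. x \<notin> C \<Longrightarrow> grad (\<phi> n) x = 0"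
        using \<phi>[of n] by (rule test_functionsE) blast
      have conth: "continuous_on UNIV (\<lambda>x. \<bar>c * \<phi> n x - average r (\<phi> n) x\<bar>)"
        by (intro continuous_intros cont average_continuous[OF int r])
      have "(LINT x|\<mu>. \<bar>c * \<phi> n x - average r (\<phi> n) x\<bar>) = (LINT x|lebesgue. indicator \<Omega> x *\<^sub>R \<bar>c * \<phi> n x - average r (\<phi> n) x\<bar>)"
        by (rule integral_restrict_space) simp
      also have "\<dots> = enn2real (\<integral>\<^sup>+x. ennreal (indicator \<Omega> x *\<^sub>R \<bar>c * \<phi> n x - average r (\<phi> n) x\<bar>) \<partial>lebesgue)"
      proof (rule integral_eq_nn_integral)
        show "(\<lambda>x. indicator \<Omega> x *\<^sub>R \<bar>c * \<phi> n x - average r (\<phi> n) x\<bar>) \<in> borel_measurable lebesgue"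
          using continuous_measurable[OF conth] unfolding borel_measurable_restrict_space_iff[OF domain_Int_sets] .
      qed simp
      also have "\<dots> \<le> enn2real (ennreal (c * e / 8))"
      proof (rule enn2real_mono)
        have "(\<integral>\<^sup>+x. ennreal (indicator \<Omega> x *\<^sub>R \<bar>c * \<phi> n x - average r (\<phi> n) x\<bar>) \<partial>lebesgue)
            \<le> (\<integral>\<^sup>+x. ennreal \<bar>c * \<phi> n x - average r (\<phi> n) x\<bar> \<partial>lebesgue)"
          by (intro nn_integral_mono) (auto simp: indicator_def)
        also have "\<dots> = (\<integral>\<^sup>+x. ennreal \<bar>c * \<phi> n x - average r (\<phi> n) x\<bar> \<partial>lborel)"
          by (rule nn_integral_completion)
        also have "\<dots> \<le> ennreal (c * r) * (\<integral>\<^sup>+x. ennreal (norm (grad (\<phi> n) x)) \<partial>lborel)"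
          unfolding c_def by (rule average_estimate[OF sm C(2,4) r])
        also have "\<dots> \<le> ennreal (c * r) * ennreal D"
          by (intro mult_left_mono Dnn) simp
        also have "\<dots> = ennreal (c * (r * D))"
          using c r D0 by (simp add: ennreal_mult mult.assoc)
        also have "\<dots> \<le> ennreal (c * e / 8)"
          using mult_left_mono[OF rD, of c] c by (intro ennreal_leI) simp
        finally show "(\<integral>\<^sup>+x. ennreal (indicator \<Omega> x *\<^sub>R \<bar>c * \<phi> n x - average r (\<phi> n) x\<bar>) \<partial>lebesgue)
            \<le> ennreal (c * e / 8)" .
      qed simp
      also have "\<dots> = c * e / 8" using c e by simp
      finally show ?thesis .
    qed
    have "(LINT x|\<mu>. norm (\<phi> (s m) x - \<phi> (s n) x)) < e" if mn: "m \<ge> N" "n \<ge> N" for m n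
    proof -
      have i1: "integrable \<mu> (\<lambda>x. \<bar>c * \<phi> n x - average r (\<phi> n) x\<bar>)" for n
        using Mint iav by (intro integrable_abs Bochner_Integration.integrable_diff integrable_mult_right)
      have i2: "integrable \<mu> (\<lambda>x. \<bar>average r (\<phi> n) x - a x\<bar>)" for n
        using ia iav by (intro integrable_abs Bochner_Integration.integrable_diff)
      have "c * (LINT x|\<mu>. norm (\<phi> (s m) x - \<phi> (s n) x)) = (LINT x|\<mu>. c * norm (\<phi> (s m) x - \<phi> (s n) x))"
        by simp
      also have "\<dots> \<le> (LINT x|\<mu>. (\<bar>c * \<phi> (s m) x - average r (\<phi> (s m)) x\<bar> + \<bar>average r (\<phi> (s m)) x - a x\<bar>)
          + (\<bar>c * \<phi> (s n) x - average r (\<phi> (s n)) x\<bar> + \<bar>average r (\<phi> (s n)) x - a x\<bar>))"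
      proof (rule integral_mono)
        show "integrable \<mu> (\<lambda>x. c * norm (\<phi> (s m) x - \<phi> (s n) x))"
          using Mint by (intro integrable_mult_right integrable_norm Bochner_Integration.integrable_diff)
        show "c * norm (\<phi> (s m) x - \<phi> (s n) x)
            \<le> (\<bar>c * \<phi> (s m) x - average r (\<phi> (s m)) x\<bar> + \<bar>average r (\<phi> (s m)) x - a x\<bar>)
              + (\<bar>c * \<phi> (s n) x - average r (\<phi> (s n)) x\<bar> + \<bar>average r (\<phi> (s n)) x - a x\<bar>)" for x
        proof -
          have "c * norm (\<phi> (s m) x - \<phi> (s n) x) = \<bar>c * \<phi> (s m) x - c * \<phi> (s n) x\<bar>"
            using c by (simp add: right_diff_distrib[symmetric] abs_mult)
          then show ?thesis by linarith
        qed
      qed (intro Bochner_Integration.integrable_add i1 i2)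
      also have "\<dots> = ((LINT x|\<mu>. \<bar>c * \<phi> (s m) x - average r (\<phi> (s m)) x\<bar>) + (LINT x|\<mu>. \<bar>average r (\<phi> (s m)) x - a x\<bar>))
          + ((LINT x|\<mu>. \<bar>c * \<phi> (s n) x - average r (\<phi> (s n)) x\<bar>) + (LINT x|\<mu>. \<bar>average r (\<phi> (s n)) x - a x\<bar>))"
        using i1 i2 by (simp add: Bochner_Integration.integral_add Bochner_Integration.integrable_add)
      also have "\<dots> < c * e"
        using close[of "s m"] close[of "s n"] N[OF mn(1)] N[OF mn(2)] mult_pos_pos[OF c e] by linarith
      finally show ?thesis using c by simp
    qed
    then show ?thesis by blast
  qed
  from cauchy_L1_AE_cauchy_subseq[of \<mu> "\<lambda>n. \<phi> (s n)", OF Mint this]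
  obtain t where t: "strict_mono t" "AE x in \<mu>. Cauchy (\<lambda>i. \<phi> (s (t i)) x)" by blast
  show ?thesis
  proof (rule that[of "s \<circ> t"])
    show "strict_mono (s \<circ> t)" using s(1) t(1) by (rule strict_mono_o)
    show "AE x in \<mu>. convergent (\<lambda>n. \<phi> ((s \<circ> t) n) x)"
      using t(2) by eventually_elim (simp add: Cauchy_convergent_iff)
  qed
qed

end

subsection \<open>The lower order terms\<close>

text \<open>The antiderivative in \<open>s\<close>, zero at 0, of a s - w |s|^(p-2) s - b; the
  numbers \<open>a\<close>, \<open>w\<close>, \<open>b\<close> are the values at a point of g, of
  the singular coefficient and of f.\<close>

definition potential :: "real \<Rightarrow> real \<Rightarrow> real \<Rightarrow> real \<Rightarrow> real \<Rightarrow> real" where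
  "potential p a w b s = a * s\<^sup>2 / 2 - w * \<bar>s\<bar> powr p / p - b * s"

lemma abs_powr_lipschitz:
  fixes s t p R :: real
  assumes "1 < p" "\<bar>s\<bar> \<le> R" "\<bar>t\<bar> \<le> R"
  shows "\<bar>\<bar>s\<bar> powr p - \<bar>t\<bar> powr p\<bar> \<le> p * (R powr (p - 1) * \<bar>s - t\<bar>)"
proof -
  have *: "\<bar>v\<bar> powr p - \<bar>u\<bar> powr p \<le> p * (R powr (p - 1) * \<bar>v - u\<bar>)" if "\<bar>v\<bar> \<le> R" for u v :: real
  proof -
    have "\<bar>v\<bar> powr p - \<bar>u\<bar> powr p \<le> p * (power_field p v \<bullet> (v - u))"
      using norm_powr_subgradient[OF assms(1), of v u] by (simp add: inner_diff_right right_diff_distrib)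
    also have "\<dots> \<le> p * (norm (power_field p v) * norm (v - u))"
      by (rule mult_left_mono[OF norm_cauchy_schwarz]) (use assms(1) in simp)
    also have "\<dots> \<le> p * (R powr (p - 1) * \<bar>v - u\<bar>)"
      unfolding norm_power_field using assms(1) that
      by (intro mult_left_mono mult_mono powr_mono2) auto
    finally show ?thesis .
  qed
  from *[OF assms(2), of t] *[OF assms(3), of s] show ?thesis
    by (simp add: abs_le_iff abs_minus_commute)
qed

text \<open>One summand of the constant for each term of the potential. All coefficients are
  multiples of \<open>a\<close> at most, so after integration the single weight g controls the lower
  order part; in the power term the derivative's factor p cancels the 1/p.\<close>

lemma potential_lipschitz:
  assumes p: "1 < p" and w: "0 \<le> w" "w \<le> a" and b: "\<bar>b\<bar> \<le> m * a"
    and st: "\<bar>s\<bar> \<le> R" "\<bar>t\<bar> \<le> R"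
  shows "\<bar>potential p a w b s - potential p a w b t\<bar> \<le> (R + R powr (p - 1) + m) * (a * \<bar>s - t\<bar>)"
proof -
  have 1: "\<bar>a * s\<^sup>2 / 2 - a * t\<^sup>2 / 2\<bar> \<le> R * (a * \<bar>s - t\<bar>)"
  proof -
    have "a * s\<^sup>2 / 2 - a * t\<^sup>2 / 2 = ((s + t) / 2) * (a * (s - t))"
      by (simp add: power2_eq_square field_simps)
    also have "\<bar>\<dots>\<bar> = \<bar>(s + t) / 2\<bar> * (a * \<bar>s - t\<bar>)" using w by (simp add: abs_mult)
    also have "\<dots> \<le> R * (a * \<bar>s - t\<bar>)" using st w by (intro mult_right_mono) auto
    finally show ?thesis .
  qed
  have 2: "\<bar>w * \<bar>s\<bar> powr p / p - w * \<bar>t\<bar> powr p / p\<bar> \<le> R powr (p - 1) * (a * \<bar>s - t\<bar>)"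
  proof -
    have "\<bar>w * \<bar>s\<bar> powr p / p - w * \<bar>t\<bar> powr p / p\<bar> = w / p * \<bar>\<bar>s\<bar> powr p - \<bar>t\<bar> powr p\<bar>"
      using w p by (simp add: abs_mult right_diff_distrib[symmetric] diff_divide_distrib[symmetric])
    also have "\<dots> \<le> w / p * (p * (R powr (p - 1) * \<bar>s - t\<bar>))"
      using w p by (intro mult_left_mono abs_powr_lipschitz st) auto
    also have "\<dots> = w * (R powr (p - 1) * \<bar>s - t\<bar>)" using p by simp
    also have "\<dots> \<le> a * (R powr (p - 1) * \<bar>s - t\<bar>)" using w by (intro mult_right_mono) auto
    finally show ?thesis by (simp add: mult.left_commute)
  qed
  have 3: "\<bar>b * s - b * t\<bar> \<le> m * (a * \<bar>s - t\<bar>)"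
    using mult_right_mono[OF b, of "\<bar>s - t\<bar>"] by (simp add: right_diff_distrib[symmetric] abs_mult mult.assoc)
  show ?thesis
    using 1 2 3 unfolding potential_def distrib_right abs_le_iff by (elim conjE) (intro conjI; linarith)
qed

text \<open>The function x^2 / 2 - x^p / p has derivative x - x^(p-1), which is nonnegative for x >=
  1 because p - 1 <= 1. Here the restriction to p at most 2 enters.\<close>

lemma powr_div_diff_le_square_diff:
  fixes s t p :: real
  assumes "1 < p" "p \<le> 2" "1 \<le> t" "t \<le> s"
  shows "s powr p / p - t powr p / p \<le> s\<^sup>2 / 2 - t\<^sup>2 / 2"
proof -
  have "t\<^sup>2 / 2 - t powr p / p \<le> s\<^sup>2 / 2 - s powr p / p"
  proof (rule DERIV_nonneg_imp_nondecreasing[OF assms(4)])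
    fix x assume x: "t \<le> x" "x \<le> s"
    have "((\<lambda>x. x\<^sup>2 / 2 - x powr p / p) has_real_derivative (x - x powr (p - 1))) (at x)"
      using x assms by (auto intro!: derivative_eq_intros)
    moreover have "x powr (p - 1) \<le> x powr 1" using x assms by (intro powr_mono) auto
    ultimately show "\<exists>y. ((\<lambda>x. x\<^sup>2 / 2 - x powr p / p) has_real_derivative y) (at x) \<and> 0 \<le> y"
      using x assms by (intro exI[of _ "x - x powr (p - 1)"]) auto
  qed
  then show ?thesis by simp
qed

text \<open>Formally, the derivative at s >= k is at least a s - (a / K) s^(p-1) - m a >= a ((1 -
  1/K) s - m), which the two conditions on \<open>k\<close> make nonnegative. The proof carries this
  out for increments.\<close>

lemma potential_mono:
  assumes p: "1 < p" "p \<le> 2" and K: "K > 1" and w: "0 \<le> w" "K * w \<le> a" and b: "\<bar>b\<bar> \<le> m * a"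
    and k: "1 \<le> k" "m * K \<le> k * (K - 1)" and st: "k \<le> t" "t \<le> s"
  shows "potential p a w b t \<le> potential p a w b s"
proof -
  define D where "D = (s\<^sup>2 - t\<^sup>2) / 2"
  have D: "k * (s - t) \<le> D"
  proof -
    have "D = ((s + t) / 2) * (s - t)" by (simp add: D_def power2_eq_square field_simps)
    moreover have "k * (s - t) \<le> ((s + t) / 2) * (s - t)"
      using st by (intro mult_right_mono) auto
    ultimately show ?thesis by simp
  qed
  have D0: "0 \<le> D"
    using D k st by (smt (verit) mult_nonneg_nonneg)
  have a0: "0 \<le> a" using w K by (smt (verit) mult_nonneg_nonneg)
  have "w * (s powr p / p - t powr p / p) \<le> w * D"
    using powr_div_diff_le_square_diff[OF p, of t s] st k w by (intro mult_left_mono) (auto simp: D_def diff_divide_distrib)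
  also have "w * D \<le> (a / K) * D"
    using w K D0 by (intro mult_right_mono) (auto simp: field_simps)
  finally have 1: "w * (s powr p / p - t powr p / p) \<le> (a / K) * D" .
  have "b * (s - t) \<le> \<bar>b\<bar> * (s - t)" using st by (intro mult_right_mono) auto
  also have "\<dots> \<le> m * a * (s - t)" using b st by (intro mult_right_mono) auto
  \<comment> \<open>With a factor 1/K extracted, the condition on \<open>k\<close> applies: the term
    with \<open>b\<close> consumes at most the fraction 1 - 1/K of the quadratic increment a D, and
    the remaining fraction 1/K pays for the power term.\<close>
  also have "m * a * (s - t) = (a / K) * (s - t) * (m * K)" using K by simp
  also have "\<dots> \<le> (a / K) * (s - t) * (k * (K - 1))"
    using k a0 K st by (intro mult_left_mono) auto
  also have "\<dots> = (a / K * (K - 1)) * (k * (s - t))" by simp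
  also have "\<dots> \<le> (a / K * (K - 1)) * D"
    using D a0 K by (intro mult_left_mono) auto
  also have "\<dots> = a * D - (a / K) * D" using K by (simp add: field_simps)
  finally have 2: "b * (s - t) \<le> a * D - (a / K) * D" .
  have "potential p a w b s - potential p a w b t
      = a * D - w * (s powr p / p - t powr p / p) - b * (s - t)"
    using st k by (simp add: potential_def D_def field_simps)
  with 1 2 show ?thesis by linarith
qed

lemma potential_minus: "potential p a w b (- s) = potential p a w (- b) s"
  by (simp add: potential_def)

lemma potential_truncation:
  assumes p: "1 < p" "p \<le> 2" and K: "K > 1" and w: "0 \<le> w" "K * w \<le> a" and b: "\<bar>b\<bar> \<le> m * a"
    and k: "1 \<le> k" "m * K \<le> k * (K - 1)"
    and \<psi>: "\<bar>s\<bar> \<le> k \<Longrightarrow> \<psi> s = s" "s \<ge> k \<Longrightarrow> k \<le> \<psi> s \<and> \<psi> s \<le> s" "s \<le> - k \<Longrightarrow> s \<le> \<psi> s \<and> \<psi> s \<le> - k"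
  shows "potential p a w b (\<psi> s) \<le> potential p a w b s"
proof -
  consider "\<bar>s\<bar> \<le> k" | "s \<ge> k" | "s \<le> - k" by linarith
  then show ?thesis
  proof cases
    case 2
    with \<psi>(2) show ?thesis by (intro potential_mono[OF p K w b k]) auto
  next
    case 3
    have "\<bar>- b\<bar> \<le> m * a" using b by simp
    from potential_mono[OF p K w this k, of "- \<psi> s" "- s"] 3 \<psi>(3) show ?thesis
      by (simp flip: potential_minus)
  qed (simp add: \<psi>(1))
qed

text \<open>The singular term is concave, so the potential lies below its second order expansion.\<close>

lemma potential_upper:
  assumes p: "1 < p" and w: "0 \<le> w"
  shows "potential p a w b (s + h * t)
    \<le> potential p a w b s + h * ((a * s - w * power_field p s - b) * t) + h\<^sup>2 * (a * t\<^sup>2 / 2)"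
proof -
  have "\<bar>s\<bar> powr p + p * (power_field p s * (h * t)) \<le> \<bar>s + h * t\<bar> powr p"
    using norm_powr_subgradient[OF p, of s "s + h * t"] by simp
  then have "w / p * (\<bar>s\<bar> powr p + p * (power_field p s * (h * t))) \<le> w / p * \<bar>s + h * t\<bar> powr p"
    using w p by (intro mult_left_mono) auto
  also have "w / p * (\<bar>s\<bar> powr p + p * (power_field p s * (h * t))) = w * \<bar>s\<bar> powr p / p + w * power_field p s * (h * t)"
    using p by (simp add: field_simps)
  finally have *: "w * \<bar>s\<bar> powr p / p + w * power_field p s * (h * t) \<le> w * \<bar>s + h * t\<bar> powr p / p" by simp
  have sq: "a * (s + h * t)\<^sup>2 / 2 = a * s\<^sup>2 / 2 + h * (a * s * t) + h\<^sup>2 * (a * t\<^sup>2 / 2)"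
    by (simp add: power2_eq_square field_simps)
  show ?thesis
    unfolding potential_def sq using * by (simp add: algebra_simps)
qed

text \<open>For p < 2 the factor |v|^(p-2) blows up at 0, so the limit there is taken through the
  norm, which is |v|^(p-1) with positive exponent.\<close>

lemma power_field_tendsto:
  fixes v :: "'b::real_normed_vector"
  assumes p: "1 < p" and lim: "(f \<longlongrightarrow> v) A"
  shows "((\<lambda>n. power_field p (f n)) \<longlongrightarrow> power_field p v) A"
proof (cases "v = 0")
  case True
  have "((\<lambda>n. norm (f n) powr (p - 1)) \<longlongrightarrow> norm v powr (p - 1)) A"
    using p lim by (intro tendsto_powr' tendsto_intros) auto
  then have "((\<lambda>n. norm (power_field p (f n))) \<longlongrightarrow> 0) A"
    using True p by (simp add: norm_power_field)
  then show ?thesis using True by (simp add: power_field_def[of p 0] tendsto_norm_zero_iff)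
next
  case False
  then show ?thesis unfolding power_field_def using lim by (intro tendsto_intros) auto
qed

subsection \<open>The minimization problem\<close>

text \<open>The weight \<open>w\<close> stands for the coefficient \<lambda> / |x|^p and
  \<open>m\<close> for the constant \<open>M\<close> of the theorem. Abstracting from the formula
  isolates what the minimization uses: \<open>w\<close> is measurable, nonnegative and dominated by
  g with a factor K > 1 to spare.\<close>

locale singular_problem = bounded_domain \<Omega> p for \<Omega> :: "'a::euclidean_space set" and p :: real +
  fixes w f g :: "'a \<Rightarrow> real" and m K :: real
  assumes p2: "p \<le> 2"
    and f_int: "integrable (lebesgue_on \<Omega>) f" and g_int: "integrable (lebesgue_on \<Omega>) g"
    and w_meas: "w \<in> borel_measurable (lebesgue_on \<Omega>)"
    and m_pos: "m > 0" and K1: "K > 1"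
    and w_nonneg: "AE x in lebesgue_on \<Omega>. 0 \<le> w x"
    and w_bound: "AE x in lebesgue_on \<Omega>. K * w x \<le> g x"
    and f_bound: "AE x in lebesgue_on \<Omega>. \<bar>f x\<bar> \<le> m * g x"
begin

lemma meas [measurable]:
  "f \<in> borel_measurable \<mu>" "g \<in> borel_measurable \<mu>" "w \<in> borel_measurable \<mu>"
  using f_int g_int w_meas by (auto intro: borel_measurable_integrable)

lemma data_bounds:
  "AE x in \<mu>. 0 \<le> w x \<and> K * w x \<le> g x \<and> w x \<le> g x \<and> \<bar>f x\<bar> \<le> m * g x \<and> 0 \<le> g x"
  using w_nonneg w_bound f_bound
proof eventually_elim
  case (elim x)
  have "1 * w x \<le> K * w x" using elim K1 by (intro mult_right_mono) auto
  with elim show ?case by auto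
qed

lemma w_int: "integrable \<mu> w"
  by (rule Bochner_Integration.integrable_bound[OF g_int])
    (use data_bounds in \<open>measurable, eventually_elim, auto\<close>)

definition lower :: "('a \<Rightarrow> real) \<Rightarrow> real" where
  "lower v = (LINT x|\<mu>. potential p (g x) (w x) (f x) (v x))"

definition lip :: "real \<Rightarrow> real" where
  "lip R = R + R powr (p - 1) + m"

lemma potential_measurable [measurable]:
  assumes [measurable]: "v \<in> borel_measurable \<mu>"
  shows "(\<lambda>x. potential p (g x) (w x) (f x) (v x)) \<in> borel_measurable \<mu>"
  unfolding potential_def by measurable

lemma potential_integrable:
  assumes [measurable]: "v \<in> borel_measurable \<mu>" and R: "AE x in \<mu>. \<bar>v x\<bar> \<le> R"
  shows "integrable \<mu> (\<lambda>x. potential p (g x) (w x) (f x) (v x))"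
proof (rule Bochner_Integration.integrable_bound[OF integrable_mult_right[OF g_int, of "lip R * R"]])
  show "AE x in \<mu>. norm (potential p (g x) (w x) (f x) (v x)) \<le> norm (lip R * R * g x)"
    using R data_bounds
  proof eventually_elim
    case (elim x)
    have "0 \<le> R" using elim by linarith
    then have L: "0 \<le> lip R" using m_pos by (simp add: lip_def)
    have "\<bar>potential p (g x) (w x) (f x) (v x)\<bar> \<le> lip R * (g x * \<bar>v x\<bar>)"
      using potential_lipschitz[OF p1, of "w x" "g x" "f x" m "v x" R 0] elim \<open>0 \<le> R\<close> p1
      by (simp add: lip_def potential_def)
    also have "\<dots> \<le> lip R * (g x * R)"
      using elim L by (intro mult_left_mono) auto
    finally show ?case using elim L \<open>0 \<le> R\<close> by (simp add: abs_mult mult.assoc mult.commute mult.left_commute)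
  qed
qed measurable

lemma weighted_integrable:
  assumes [measurable]: "u \<in> borel_measurable \<mu>" "v \<in> borel_measurable \<mu>"
    and R: "AE x in \<mu>. \<bar>u x\<bar> \<le> R" "AE x in \<mu>. \<bar>v x\<bar> \<le> R"
  shows "integrable \<mu> (\<lambda>x. g x * \<bar>u x - v x\<bar>)"
proof (rule bounded_mult_integrable[OF g_int])
  show "AE x in \<mu>. \<bar>\<bar>u x - v x\<bar>\<bar> \<le> 2 * R" using R by eventually_elim auto
qed measurable

lemma lower_lipschitz:
  assumes [measurable]: "u \<in> borel_measurable \<mu>" "v \<in> borel_measurable \<mu>"
    and R: "AE x in \<mu>. \<bar>u x\<bar> \<le> R" "AE x in \<mu>. \<bar>v x\<bar> \<le> R"
  shows "\<bar>lower u - lower v\<bar> \<le> lip R * (LINT x|\<mu>. g x * \<bar>u x - v x\<bar>)"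
proof -
  note i = potential_integrable[OF assms(1) R(1)] potential_integrable[OF assms(2) R(2)]
  have "\<bar>lower u - lower v\<bar> = \<bar>LINT x|\<mu>. potential p (g x) (w x) (f x) (u x) - potential p (g x) (w x) (f x) (v x)\<bar>"
    unfolding lower_def using i by simp
  also have "\<dots> \<le> (LINT x|\<mu>. \<bar>potential p (g x) (w x) (f x) (u x) - potential p (g x) (w x) (f x) (v x)\<bar>)"
    by (rule integral_abs_bound)
  also have "\<dots> \<le> (LINT x|\<mu>. lip R * (g x * \<bar>u x - v x\<bar>))"
  proof (rule integral_mono_AE)
    show "AE x in \<mu>. \<bar>potential p (g x) (w x) (f x) (u x) - potential p (g x) (w x) (f x) (v x)\<bar>
        \<le> lip R * (g x * \<bar>u x - v x\<bar>)"
      using R data_bounds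
    proof eventually_elim
      case (elim x)
      show ?case unfolding lip_def
        by (rule potential_lipschitz[OF p1]) (use elim in blast)+
    qed
    show "integrable \<mu> (\<lambda>x. \<bar>potential p (g x) (w x) (f x) (u x) - potential p (g x) (w x) (f x) (v x)\<bar>)"
      by (rule integrable_abs[OF Bochner_Integration.integrable_diff[OF i]])
    show "integrable \<mu> (\<lambda>x. lip R * (g x * \<bar>u x - v x\<bar>))"
      using weighted_integrable[OF assms] by (rule integrable_mult_right)
  qed
  also have "\<dots> = lip R * (LINT x|\<mu>. g x * \<bar>u x - v x\<bar>)" by simp
  finally show ?thesis .
qed

definition dirichlet :: "('a \<Rightarrow> 'a) \<Rightarrow> real" where
  "dirichlet V = (LINT x|\<mu>. norm (V x) powr p)"

definition energy :: "('a \<Rightarrow> real) \<Rightarrow> real" where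
  "energy \<phi> = dirichlet (grad \<phi>) / p + lower \<phi>"

lemma dirichlet_nonneg: "dirichlet V \<ge> 0"
  by (simp add: dirichlet_def)

definition bound :: real where
  "bound = max 1 (m * K / (K - 1))"

lemma bound_props: "1 \<le> bound" "m * K \<le> bound * (K - 1)"
proof -
  show "1 \<le> bound" by (simp add: bound_def)
  have "m * K / (K - 1) \<le> bound" by (simp add: bound_def)
  then show "m * K \<le> bound * (K - 1)" using K1 by (simp add: pos_divide_le_eq)
qed

lemma test_measurable: "\<phi> \<in> test_functions \<Omega> \<Longrightarrow> \<phi> \<in> borel_measurable \<mu>"
  using test_function_Lp(1) by (rule Lp_fun_measurable)

lemma test_potential_integrable:
  assumes "\<phi> \<in> test_functions \<Omega>"
  shows "integrable \<mu> (\<lambda>x. potential p (g x) (w x) (f x) (\<phi> x))"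
proof -
  obtain B where "B > 0" "\<And>x. \<bar>\<phi> x\<bar> \<le> B" "\<And>x. norm (grad \<phi> x) \<le> B"
    using test_functions_bounded[OF assms] by blast
  then show ?thesis
    by (intro potential_integrable[where R=B] test_measurable assms AE_I2) auto
qed

text \<open>Neither integrand increases pointwise: the gradient is multiplied by a factor in [0, 1],
  and the potential is monotone in modulus beyond \<open>bound\<close>. The summand 1 in
  \<open>bound + 1\<close> is the transition zone of the smooth truncation.\<close>

lemma energy_truncation:
  assumes \<phi>: "\<phi> \<in> test_functions \<Omega>"
  obtains \<psi> where "\<psi> \<in> test_functions \<Omega>" "\<And>x. \<bar>\<psi> x\<bar> \<le> bound + 1" "energy \<psi> \<le> energy \<phi>"
proof -
  have b0: "bound \<ge> 0" using bound_props by simp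
  obtain \<theta> \<eta> :: "real \<Rightarrow> real" where \<theta>: "smooth \<theta>" "\<And>t. (\<theta> has_real_derivative \<eta> t) (at t)"
    "continuous_on UNIV \<eta>" "\<And>t. 0 \<le> \<eta> t" "\<And>t. \<eta> t \<le> 1" "\<And>t. \<bar>t\<bar> \<le> bound \<Longrightarrow> \<eta> t = 1"
    "\<And>t. \<bar>t\<bar> \<le> bound \<Longrightarrow> \<theta> t = t" "\<And>t. t \<ge> bound \<Longrightarrow> bound \<le> \<theta> t \<and> \<theta> t \<le> t"
    "\<And>t. t \<le> - bound \<Longrightarrow> t \<le> \<theta> t \<and> \<theta> t \<le> - bound" "\<And>t. \<bar>\<theta> t\<bar> \<le> bound + 1"
    by (rule smooth_truncation_exists[OF b0]) (rule that)
  define \<psi> where "\<psi> x = \<theta> (\<phi> x)" for x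
  have \<psi>: "\<psi> \<in> test_functions \<Omega>"
    unfolding \<psi>_def[abs_def] by (rule test_functions_compose[OF \<phi> \<theta>(1)]) (simp add: \<theta>(7) b0)
  have g\<psi>: "grad \<psi> x = \<eta> (\<phi> x) *\<^sub>R grad \<phi> x" for x
    unfolding \<psi>_def[abs_def] by (rule grad_compose[OF \<theta>(2) test_functions_smooth[OF \<phi>]])
  have "dirichlet (grad \<psi>) \<le> dirichlet (grad \<phi>)"
    unfolding dirichlet_def
  proof (rule integral_mono)
    show "norm (grad \<psi> x) powr p \<le> norm (grad \<phi> x) powr p" for x
      using \<theta>(4)[of "\<phi> x"] \<theta>(5)[of "\<phi> x"] p1 by (auto simp: g\<psi> intro!: powr_mono2 mult_left_le_one_le)
  qed (intro Lp_fun_integrable test_function_Lp \<phi> \<psi>)+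
  moreover have "lower \<psi> \<le> lower \<phi>"
    unfolding lower_def
  proof (rule integral_mono_AE)
    show "AE x in \<mu>. potential p (g x) (w x) (f x) (\<psi> x) \<le> potential p (g x) (w x) (f x) (\<phi> x)"
      using data_bounds
    proof eventually_elim
      case (elim x)
      show ?case unfolding \<psi>_def
        by (rule potential_truncation[OF p1 p2 K1 _ _ _ bound_props \<theta>(7) \<theta>(8) \<theta>(9)]) (use elim in auto)
    qed
  qed (intro test_potential_integrable \<phi> \<psi>)+
  ultimately have "energy \<psi> \<le> energy \<phi>"
    unfolding energy_def using p1 by (intro add_mono divide_right_mono) auto
  then show ?thesis using that[of \<psi>] \<psi> \<theta>(10) by (simp add: \<psi>_def)
qed

text \<open>The Lipschitz estimate for \<open>lower\<close> between 0, where it vanishes, and a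
  function bounded by \<open>bound + 1\<close>.\<close>

definition floor_bound :: real where
  "floor_bound = lip (bound + 1) * (LINT x|\<mu>. g x * (bound + 1))"

lemma lower_bounded:
  assumes [measurable]: "v \<in> borel_measurable \<mu>" and v: "AE x in \<mu>. \<bar>v x\<bar> \<le> bound + 1"
  shows "\<bar>lower v\<bar> \<le> floor_bound"
proof -
  have z: "AE x in \<mu>. \<bar>0::real\<bar> \<le> bound + 1" using bound_props by simp
  have "\<bar>lower v - lower (\<lambda>_. 0)\<bar> \<le> lip (bound + 1) * (LINT x|\<mu>. g x * \<bar>v x - 0\<bar>)"
    by (rule lower_lipschitz[OF _ _ v z]) measurable
  also have "\<dots> \<le> floor_bound"
    unfolding floor_bound_def
  proof (rule mult_left_mono)
    show "(LINT x|\<mu>. g x * \<bar>v x - 0\<bar>) \<le> (LINT x|\<mu>. g x * (bound + 1))"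
    proof (rule integral_mono_AE)
      show "AE x in \<mu>. g x * \<bar>v x - 0\<bar> \<le> g x * (bound + 1)"
        using v data_bounds by eventually_elim (auto intro: mult_left_mono)
      show "integrable \<mu> (\<lambda>x. g x * \<bar>v x - 0\<bar>)" by (rule weighted_integrable[OF _ _ v z]) measurable
    qed (rule integrable_mult_left[OF g_int])
    show "0 \<le> lip (bound + 1)" using bound_props m_pos by (simp add: lip_def)
  qed
  finally show ?thesis using p1 by (simp add: lower_def potential_def)
qed

definition infimum :: real where
  "infimum = (INF \<phi>\<in>test_functions \<Omega>. energy \<phi>)"

text \<open>A test function may exceed every fixed level, so \<open>lower_bounded\<close> does not
  apply to it directly; it applies to the truncation, whose energy is no larger.\<close>

lemma energy_ge: "\<phi> \<in> test_functions \<Omega> \<Longrightarrow> - floor_bound \<le> energy \<phi>"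
proof -
  assume "\<phi> \<in> test_functions \<Omega>"
  then obtain \<psi> where \<psi>: "\<psi> \<in> test_functions \<Omega>" "\<And>x. \<bar>\<psi> x\<bar> \<le> bound + 1" "energy \<psi> \<le> energy \<phi>"
    using energy_truncation by blast
  have "\<bar>lower \<psi>\<bar> \<le> floor_bound" by (intro lower_bounded test_measurable AE_I2 \<psi>)
  moreover have "0 \<le> dirichlet (grad \<psi>) / p" using dirichlet_nonneg p1 by simp
  ultimately show ?thesis using \<psi>(3) by (simp add: energy_def)
qed

lemma infimum_le: "\<phi> \<in> test_functions \<Omega> \<Longrightarrow> infimum \<le> energy \<phi>"
  unfolding infimum_def using energy_ge by (intro cINF_lower bdd_belowI2[of _ "- floor_bound"])

lemma minimizing_sequence:
  obtains \<phi> where "\<And>n. \<phi> n \<in> test_functions \<Omega>" "\<And>n x. \<bar>\<phi> n x\<bar> \<le> bound + 1"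
    "\<And>n. energy (\<phi> n) \<le> infimum + 1 / real (Suc n)"
proof -
  have "\<exists>\<phi>. \<phi> \<in> test_functions \<Omega> \<and> (\<forall>x. \<bar>\<phi> x\<bar> \<le> bound + 1) \<and> energy \<phi> \<le> infimum + 1 / real (Suc n)" for n
  proof -
    have "infimum < infimum + 1 / real (Suc n)" by simp
    then obtain \<phi> where \<phi>: "\<phi> \<in> test_functions \<Omega>" "energy \<phi> < infimum + 1 / real (Suc n)"
      unfolding infimum_def
      using cINF_less_iff[of "test_functions \<Omega>" energy] test_functions_zero energy_ge
      by (metis bdd_belowI2 empty_iff)
    obtain \<psi> where "\<psi> \<in> test_functions \<Omega>" "\<And>x. \<bar>\<psi> x\<bar> \<le> bound + 1" "energy \<psi> \<le> energy \<phi>"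
      using energy_truncation[OF \<phi>(1)] by blast
    then show ?thesis using \<phi>(2) by (intro exI[of _ \<psi>]) auto
  qed
  then show ?thesis using that by metis
qed

text \<open>The minimizing sequence is delivered along with its limit: \<open>u\<close> is in
  general not a test function, so later variations of \<open>u\<close> can be compared with the
  infimum only through the approximants.\<close>

lemma minimizer_exists:
  obtains \<phi> u G where "\<And>n. \<phi> n \<in> test_functions \<Omega>" "\<And>n x. \<bar>\<phi> n x\<bar> \<le> bound + 1"
    "u \<in> borel_measurable \<mu>" "AE x in \<mu>. \<bar>u x\<bar> \<le> bound + 1"
    "AE x in \<mu>. (\<lambda>n. \<phi> n x) \<longlonglongrightarrow> u x" "(\<lambda>n. LINT x|\<mu>. g x * \<bar>\<phi> n x - u x\<bar>) \<longlonglongrightarrow> 0"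
    "Lp_fun G" "Lp_lim (\<lambda>n. grad (\<phi> n)) G" "dirichlet G / p + lower u = infimum"
proof -
  let ?B = "bound + 1"
  have B: "?B \<ge> 0" using bound_props by simp
  obtain \<psi> where \<psi>: "\<And>n. \<psi> n \<in> test_functions \<Omega>" "\<And>n x. \<bar>\<psi> n x\<bar> \<le> ?B"
    "\<And>n. energy (\<psi> n) \<le> infimum + 1 / real (Suc n)"
    using minimizing_sequence by blast
  \<comment> \<open>The energies are at most \<open>infimum + 1\<close> and the lower order parts at
    least \<open>- floor_bound\<close>, which leaves this much for the Dirichlet integral.\<close>
  define E where "E = p * (infimum + 1 + floor_bound)"
  have E\<psi>: "dirichlet (grad (\<psi> n)) \<le> E" for n
  proof -
    have "\<bar>lower (\<psi> n)\<bar> \<le> floor_bound" by (intro lower_bounded test_measurable AE_I2 \<psi>)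
    moreover have "1 / real (Suc n) \<le> 1" by simp
    ultimately have "dirichlet (grad (\<psi> n)) / p \<le> infimum + 1 + floor_bound"
      using \<psi>(3)[of n] unfolding energy_def by linarith
    then show ?thesis using p1 by (simp add: E_def pos_divide_le_eq mult.commute)
  qed
  obtain s where s: "strict_mono (s :: nat \<Rightarrow> nat)" "AE x in \<mu>. convergent (\<lambda>n. \<psi> (s n) x)"
    by (rule rellich[of \<psi> ?B E, OF \<psi>(1) \<psi>(2) E\<psi>[unfolded dirichlet_def]]) (rule that)
  define \<phi> where "\<phi> n = \<psi> (s n)" for n
  have \<phi>: "\<phi> n \<in> test_functions \<Omega>" "\<bar>\<phi> n x\<bar> \<le> ?B" for n x using \<psi> by (auto simp: \<phi>_def)
  have E\<phi>: "dirichlet (grad (\<phi> n)) \<le> E" for n using E\<psi> by (simp add: \<phi>_def)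
  have J: "energy (\<phi> n) \<le> infimum + 1 / real (Suc n)" for n
  proof -
    have "n \<le> s n" using s(1) by (rule seq_suble)
    then have "1 / real (Suc (s n)) \<le> 1 / real (Suc n)" by (intro divide_left_mono) auto
    then show ?thesis using \<psi>(3)[of "s n"] by (simp add: \<phi>_def)
  qed
  note m\<phi> [measurable] = test_measurable[OF \<phi>(1)]
  define u where "u x = lim (\<lambda>n. \<phi> n x)" for x
  have u [measurable]: "u \<in> borel_measurable \<mu>" unfolding u_def by measurable
  have lim: "AE x in \<mu>. (\<lambda>n. \<phi> n x) \<longlonglongrightarrow> u x"
    using s(2) by eventually_elim (simp add: u_def \<phi>_def convergent_LIMSEQ_iff)
  have ub: "AE x in \<mu>. \<bar>u x\<bar> \<le> ?B"
    using lim
  proof eventually_elim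
    case (elim x)
    show ?case by (rule Lim_bounded[OF tendsto_rabs[OF elim]]) (use \<phi>(2) in blast)
  qed
  define a where "a n = (LINT x|\<mu>. g x * \<bar>\<phi> n x - u x\<bar>)" for n
  have a: "a \<longlonglongrightarrow> 0"
  proof -
    have "(\<lambda>n. LINT x|\<mu>. g x * \<bar>\<phi> n x - u x\<bar>) \<longlonglongrightarrow> (LINT x|\<mu>. 0)"
    proof (rule integral_dominated_convergence[where w="\<lambda>x. g x * (2 * ?B)"])
      show "AE x in \<mu>. (\<lambda>n. g x * \<bar>\<phi> n x - u x\<bar>) \<longlonglongrightarrow> 0"
        using lim
      proof eventually_elim
        case (elim x)
        show ?case by (rule tendsto_mult_right_zero[OF tendsto_rabs_zero[OF LIM_zero[OF elim]]])
      qed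
      show "AE x in \<mu>. norm (g x * \<bar>\<phi> n x - u x\<bar>) \<le> g x * (2 * ?B)" for n
        using ub data_bounds
      proof eventually_elim
        case (elim x)
        have "\<bar>\<phi> n x - u x\<bar> \<le> 2 * ?B" 
          by (rule order.trans[OF abs_triangle_ineq4]) (use elim(1) \<phi>(2)[of n x] in simp)
        then show ?case using elim by (auto simp: abs_mult intro!: mult_left_mono)
      qed
    qed (use g_int in \<open>auto intro!: integrable_mult_left\<close>)
    then show ?thesis by (simp add: a_def[abs_def])
  qed
  have low: "\<bar>lower (\<phi> n) - lower u\<bar> \<le> lip ?B * a n" for n
    unfolding a_def by (rule lower_lipschitz[OF m\<phi> u AE_I2[OF \<phi>(2)] ub])
  have low': "lower u - lower (\<phi> n) \<le> lip ?B * a n" for n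
    using low[of n] unfolding abs_le_iff by simp
  have lip0: "lip ?B \<ge> 0" using B m_pos by (simp add: lip_def)
  have L\<phi>: "Lp_fun (grad (\<phi> n))" for n by (rule test_function_Lp(2)[OF \<phi>(1)])
  \<comment> \<open>The error contributed by one index to the gap of a pair: half of its excess over
    the infimum, plus the Lipschitz estimate for replacing \<open>\<phi> n\<close> by
    \<open>u\<close> in the lower order part, all times p because of the factor 1/p in the
    energy.\<close>
  define c where "c n = p * (1 / real (Suc n) / 2 + lip ?B * a n)" for n
  have c: "c \<longlonglongrightarrow> 0"
  proof -
    have "(\<lambda>n. p * (1 / real (Suc n) / 2 + lip ?B * a n)) \<longlonglongrightarrow> p * (0 / 2 + lip ?B * 0)"
      by (intro tendsto_intros a lim_1_over_n[THEN LIMSEQ_Suc]) auto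
    then show ?thesis by (simp add: c_def[abs_def])
  qed
  have gap_int: "integrable \<mu> (\<lambda>x. convexity_gap p (grad (\<phi> i) x) (grad (\<phi> j) x))"
    and gap: "(LINT x|\<mu>. convexity_gap p (grad (\<phi> i) x) (grad (\<phi> j) x)) \<le> c i + c j" for i j
  proof -
    \<comment> \<open>The midpoint is again a test function, so its energy is at least the infimum;
      its gradient is the midpoint of the gradients, so the Dirichlet integrals combine to the
      convexity gap.\<close>
    define h where "h x = (1 / 2) * (\<phi> i x + \<phi> j x)" for x
    have h: "h \<in> test_functions \<Omega>"
      unfolding h_def[abs_def] by (intro test_functions_cmult test_functions_add \<phi>)
    have sm: "smooth (\<phi> n)" for n by (rule test_functions_smooth[OF \<phi>(1)])
    have gh: "grad h x = (1 / 2) *\<^sub>R (grad (\<phi> i) x + grad (\<phi> j) x)" for x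
      unfolding h_def[abs_def] grad_cmult[OF smooth_add[OF sm sm]] grad_add[OF sm sm] ..
    note [measurable] = test_measurable[OF h]
    have i1: "integrable \<mu> (\<lambda>x. norm (grad (\<phi> n) x) powr p)" for n by (rule Lp_fun_integrable[OF L\<phi>])
    have i2: "integrable \<mu> (\<lambda>x. norm ((1 / 2) *\<^sub>R (grad (\<phi> i) x + grad (\<phi> j) x)) powr p)"
      using Lp_fun_integrable[OF test_function_Lp(2)[OF h]] by (simp add: gh)
    show "integrable \<mu> (\<lambda>x. convexity_gap p (grad (\<phi> i) x) (grad (\<phi> j) x))"
      unfolding convexity_gap_def
      by (intro Bochner_Integration.integrable_diff integrable_divide Bochner_Integration.integrable_add i1 i2)
    have "(LINT x|\<mu>. convexity_gap p (grad (\<phi> i) x) (grad (\<phi> j) x))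
        = (dirichlet (grad (\<phi> i)) + dirichlet (grad (\<phi> j))) / 2 - dirichlet (grad h)"
      unfolding convexity_gap_def dirichlet_def gh
      by (subst Bochner_Integration.integral_diff[OF integrable_divide[OF Bochner_Integration.integrable_add[OF i1 i1]] i2])
        (simp add: i1)
    also have "\<dots> = p * ((energy (\<phi> i) + energy (\<phi> j)) / 2 - energy h + (lower h - (lower (\<phi> i) + lower (\<phi> j)) / 2))"
      using p1 by (simp add: energy_def field_simps)
    also have "\<dots> \<le> p * ((1 / real (Suc i) / 2 + lip ?B * a i) + (1 / real (Suc j) / 2 + lip ?B * a j))"
    proof (rule mult_left_mono)
      have hb: "AE x in \<mu>. \<bar>h x\<bar> \<le> ?B"
      proof (rule AE_I2)
        fix x show "\<bar>h x\<bar> \<le> ?B" using \<phi>(2)[of i x] \<phi>(2)[of j x] by (simp add: h_def)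
      qed
      have wi: "integrable \<mu> (\<lambda>x. g x * \<bar>\<phi> n x - u x\<bar>)" for n
        by (rule weighted_integrable[OF m\<phi> u AE_I2[OF \<phi>(2)] ub])
      have "(LINT x|\<mu>. g x * \<bar>h x - u x\<bar>) \<le> (LINT x|\<mu>. (g x * \<bar>\<phi> i x - u x\<bar> + g x * \<bar>\<phi> j x - u x\<bar>) / 2)"
      proof (rule integral_mono_AE)
        show "AE x in \<mu>. g x * \<bar>h x - u x\<bar> \<le> (g x * \<bar>\<phi> i x - u x\<bar> + g x * \<bar>\<phi> j x - u x\<bar>) / 2"
          using data_bounds
        proof eventually_elim
          case (elim x)
          have "\<bar>h x - u x\<bar> \<le> (\<bar>\<phi> i x - u x\<bar> + \<bar>\<phi> j x - u x\<bar>) / 2"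
            unfolding h_def by (simp add: field_simps abs_le_iff) linarith
          then have "g x * \<bar>h x - u x\<bar> \<le> g x * ((\<bar>\<phi> i x - u x\<bar> + \<bar>\<phi> j x - u x\<bar>) / 2)"
            using elim by (intro mult_left_mono) auto
          then show ?case by (simp add: distrib_left)
        qed
        show "integrable \<mu> (\<lambda>x. g x * \<bar>h x - u x\<bar>)"
          by (rule weighted_integrable[OF _ u hb ub]) measurable
      qed (intro integrable_divide Bochner_Integration.integrable_add wi)
      also have "\<dots> = (a i + a j) / 2" using wi by (simp add: a_def)
      finally have "lip ?B * (LINT x|\<mu>. g x * \<bar>h x - u x\<bar>) \<le> lip ?B * ((a i + a j) / 2)"
        using lip0 by (rule mult_left_mono)
      moreover have "\<bar>lower h - lower u\<bar> \<le> lip ?B * (LINT x|\<mu>. g x * \<bar>h x - u x\<bar>)"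
        by (rule lower_lipschitz[OF _ u hb ub]) measurable
      ultimately have lh: "lower h - lower u \<le> lip ?B * a i / 2 + lip ?B * a j / 2"
        by (simp add: distrib_left add_divide_distrib)
      \<comment> \<open>Arithmetic in which \<open>I\<close> is the infimum, \<open>s\<close> and
        \<open>t\<close> are the excesses, and \<open>X\<close> and \<open>Y\<close> bound the lower
        order errors. Half of X + Y comes from the midpoint, the other half from the two given
        functions.\<close>
      have key: "(Ei + Ej) / 2 - Eh + (Lh - (Li + Lj) / 2) \<le> (s / 2 + X) + (t / 2 + Y)"
        if "Lh - Lu \<le> X / 2 + Y / 2" "Ei \<le> I + s" "Ej \<le> I + t" "I \<le> Eh" "Lu - Li \<le> X" "Lu - Lj \<le> Y"
        for Lh Lu X Y Ei Ej Li Lj s t I Eh :: real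
        using that by (simp add: field_simps)
      show "(energy (\<phi> i) + energy (\<phi> j)) / 2 - energy h + (lower h - (lower (\<phi> i) + lower (\<phi> j)) / 2)
          \<le> (1 / real (Suc i) / 2 + lip ?B * a i) + (1 / real (Suc j) / 2 + lip ?B * a j)"
        by (rule key[OF lh J J infimum_le[OF h] low' low'])
    qed (use p1 in simp)
    also have "\<dots> = c i + c j" by (simp add: c_def distrib_left)
    finally show "(LINT x|\<mu>. convexity_gap p (grad (\<phi> i) x) (grad (\<phi> j) x)) \<le> c i + c j" .
  qed
  have E0: "E \<ge> 0" using E\<phi>[of 0] dirichlet_nonneg[of "grad (\<phi> 0)"] by linarith
  have "\<exists>N. \<forall>i\<ge>N. \<forall>j\<ge>N. (LINT x|\<mu>. norm (grad (\<phi> i) x - grad (\<phi> j) x) powr p) < e" if e: "e > 0" for e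
  proof -
    \<comment> \<open>The two Dirichlet integrals are at most \<open>E\<close> each, so the epsilon
      part is at most e/2; the gap adds less than e/4 for each index.\<close>
    define \<epsilon> where "\<epsilon> = e / (4 * (E + 1))"
    have \<epsilon>: "\<epsilon> > 0" using e E0 by (simp add: \<epsilon>_def)
    have "\<epsilon> * (2 * E) \<le> \<epsilon> * (2 * (E + 1))" using \<epsilon> by (intro mult_left_mono) auto
    also have "\<dots> = e / 2" using E0 by (simp add: \<epsilon>_def field_simps)
    finally have \<epsilon>E: "\<epsilon> * (2 * E) \<le> e / 2" .
    obtain C where C: "C \<ge> 0" "\<And>a b :: 'a.
        norm (a - b) powr p \<le> \<epsilon> * (norm a powr p + norm b powr p) + C * convexity_gap p a b"
      using uniform_convexity[OF p1 \<epsilon>, where 'a='a] by blast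
    have "(\<lambda>n. C * c n) \<longlonglongrightarrow> 0" using tendsto_mult_right_zero[OF c] .
    then have "eventually (\<lambda>n. C * c n < e / 4) sequentially" using e by (intro order_tendstoD(2)) auto
    then obtain N where N: "\<And>n. n \<ge> N \<Longrightarrow> C * c n < e / 4" unfolding eventually_sequentially by blast
    have "(LINT x|\<mu>. norm (grad (\<phi> i) x - grad (\<phi> j) x) powr p) < e" if ij: "i \<ge> N" "j \<ge> N" for i j
    proof -
      note i1 = Lp_fun_integrable[OF L\<phi>]
      have "(LINT x|\<mu>. norm (grad (\<phi> i) x - grad (\<phi> j) x) powr p)
          \<le> (LINT x|\<mu>. \<epsilon> * (norm (grad (\<phi> i) x) powr p + norm (grad (\<phi> j) x) powr p)
              + C * convexity_gap p (grad (\<phi> i) x) (grad (\<phi> j) x))"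
      proof (rule integral_mono)
        show "integrable \<mu> (\<lambda>x. norm (grad (\<phi> i) x - grad (\<phi> j) x) powr p)"
          by (intro Lp_fun_integrable Lp_fun_diff L\<phi>)
      qed (intro Bochner_Integration.integrable_add integrable_mult_right i1 gap_int, rule C(2))
      also have "\<dots> = \<epsilon> * (dirichlet (grad (\<phi> i)) + dirichlet (grad (\<phi> j)))
          + C * (LINT x|\<mu>. convexity_gap p (grad (\<phi> i) x) (grad (\<phi> j) x))"
        using i1 gap_int unfolding dirichlet_def by simp
      also have "\<dots> \<le> \<epsilon> * (2 * E) + C * (c i + c j)"
        using E\<phi>[of i] E\<phi>[of j] gap[of i j] C(1) \<epsilon> by (intro add_mono mult_left_mono) auto
      also have "\<dots> < e"
        using \<epsilon>E N[OF ij(1)] N[OF ij(2)] unfolding distrib_left by linarith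
      finally show ?thesis .
    qed
    then show ?thesis by blast
  qed
  from Lp_complete[OF L\<phi> this] obtain G where G: "Lp_fun G" "Lp_lim (\<lambda>n. grad (\<phi> n)) G" by blast
  have "dirichlet G / p + lower u = infimum"
  proof (rule LIMSEQ_unique)
    have "(\<lambda>n. lower (\<phi> n)) \<longlonglongrightarrow> lower u"
    proof -
      have "(\<lambda>n. lip ?B * a n) \<longlonglongrightarrow> 0" using tendsto_mult_right_zero[OF a] .
      then have "(\<lambda>n. lower (\<phi> n) - lower u) \<longlonglongrightarrow> 0"
        by (rule Lim_null_comparison[rotated]) (use low in simp)
      then show ?thesis by (rule LIM_zero_cancel)
    qed
    then show "(\<lambda>n. energy (\<phi> n)) \<longlonglongrightarrow> dirichlet G / p + lower u"
      unfolding energy_def dirichlet_def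
      using p1 by (intro tendsto_add tendsto_divide Lp_lim_norm[OF L\<phi> G]) auto
    show "(\<lambda>n. energy (\<phi> n)) \<longlonglongrightarrow> infimum"
    proof (rule real_tendsto_sandwich[OF always_eventually always_eventually tendsto_const])
      show "\<forall>n. infimum \<le> energy (\<phi> n)" using infimum_le \<phi>(1) by blast
      show "\<forall>n. energy (\<phi> n) \<le> infimum + 1 / real (Suc n)" using J by blast
      show "(\<lambda>n. infimum + 1 / real (Suc n)) \<longlonglongrightarrow> infimum"
        using tendsto_add[OF tendsto_const[of infimum] lim_1_over_n[THEN LIMSEQ_Suc]] by simp
    qed
  qed
  then show ?thesis
    using that[OF \<phi>(1) \<phi>(2) u ub lim a[unfolded a_def[abs_def]] G] by blast
qed

end

section \<open>The Euler-Lagrange equation of the minimizer\<close>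

context singular_problem
begin

lemma residual_integrable:
  assumes u [measurable]: "u \<in> borel_measurable \<mu>" and ub: "AE x in \<mu>. \<bar>u x\<bar> \<le> B"
  shows "integrable \<mu> (\<lambda>x. g x * u x)" "integrable \<mu> (\<lambda>x. w x * power_field p (u x))"
proof -
  show "integrable \<mu> (\<lambda>x. g x * u x)" by (rule bounded_mult_integrable[OF g_int u ub])
  show "integrable \<mu> (\<lambda>x. w x * power_field p (u x))"
  proof (rule bounded_mult_integrable[OF w_int])
    show "AE x in \<mu>. \<bar>power_field p (u x)\<bar> \<le> B powr (p - 1)"
      using ub
    proof eventually_elim
      case (elim x)
      then show ?case
        using norm_power_field[of p "u x"] p1 by (auto intro!: powr_mono2)
    qed
  qed measurable
qed

text \<open>The integrated form of \<open>potential_upper\<close>. An upper bound suffices, since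
  minimality supplies the inequality from below; boundedness of \<open>z\<close> keeps the
  coefficient of the quadratic remainder finite.\<close>

lemma lower_expansion:
  assumes u [measurable]: "u \<in> borel_measurable \<mu>" and ub: "AE x in \<mu>. \<bar>u x\<bar> \<le> B"
    and z [measurable]: "z \<in> borel_measurable \<mu>" and zb: "\<And>x. \<bar>z x\<bar> \<le> R"
  shows "lower (\<lambda>x. u x + h * z x) \<le> lower u
    + h * (LINT x|\<mu>. (g x * u x - w x * power_field p (u x) - f x) * z x) + h\<^sup>2 * (LINT x|\<mu>. g x * (z x)\<^sup>2 / 2)"
proof -
  let ?r = "\<lambda>x. (g x * u x - w x * power_field p (u x) - f x) * z x"
  have R: "0 \<le> R" using zb[of undefined] by linarith
  have i1: "integrable \<mu> (\<lambda>x. potential p (g x) (w x) (f x) (u x))" by (rule potential_integrable[OF u ub])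
  have i2: "integrable \<mu> ?r"
    by (rule bounded_mult_integrable[OF _ z AE_I2[OF zb]])
      (intro Bochner_Integration.integrable_diff residual_integrable[OF u ub] f_int)
  have i3: "integrable \<mu> (\<lambda>x. g x * (z x)\<^sup>2 / 2)"
  proof -
    have "\<bar>(z x)\<^sup>2\<bar> \<le> R\<^sup>2" for x using zb[of x] by (simp add: abs_le_square_iff[symmetric] R)
    then have "integrable \<mu> (\<lambda>x. g x * (z x)\<^sup>2)"
      by (intro bounded_mult_integrable[OF g_int] AE_I2) auto
    then show ?thesis by (rule integrable_divide)
  qed
  have ib: "AE x in \<mu>. \<bar>u x + h * z x\<bar> \<le> B + \<bar>h\<bar> * R"
    using ub
  proof eventually_elim
    case (elim x)
    have "\<bar>h * z x\<bar> \<le> \<bar>h\<bar> * R" unfolding abs_mult by (intro mult_left_mono zb) simp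
    then show ?case by (rule order.trans[OF abs_triangle_ineq add_mono[OF elim]])
  qed
  have "lower (\<lambda>x. u x + h * z x) \<le> (LINT x|\<mu>. potential p (g x) (w x) (f x) (u x) + h * ?r x + h\<^sup>2 * (g x * (z x)\<^sup>2 / 2))"
    unfolding lower_def
  proof (rule integral_mono_AE)
    show "integrable \<mu> (\<lambda>x. potential p (g x) (w x) (f x) (u x + h * z x))"
      by (rule potential_integrable[OF _ ib]) measurable
    show "AE x in \<mu>. potential p (g x) (w x) (f x) (u x + h * z x)
        \<le> potential p (g x) (w x) (f x) (u x) + h * ?r x + h\<^sup>2 * (g x * (z x)\<^sup>2 / 2)"
      using w_nonneg
    proof eventually_elim
      case (elim x)
      show ?case by (rule potential_upper[OF p1 elim])
    qed
  qed (intro Bochner_Integration.integrable_add integrable_mult_right i1 i2 i3)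
  also have "\<dots> = lower u + h * (LINT x|\<mu>. ?r x) + h\<^sup>2 * (LINT x|\<mu>. g x * (z x)\<^sup>2 / 2)"
    unfolding lower_def
    by (subst Bochner_Integration.integral_add[OF Bochner_Integration.integrable_add[OF i1 integrable_mult_right[OF i2]] integrable_mult_right[OF i3]],
        subst Bochner_Integration.integral_add[OF i1 integrable_mult_right[OF i2]])
      (simp only: integral_mult_right_zero)
  finally show ?thesis .
qed

text \<open>The subgradient inequality is taken at the perturbed gradient and evaluated at
  \<open>G\<close>. The field therefore sits at G + h D, and letting h tend to 0 requires continuity
  of the field but no differentiation of the integral.\<close>

lemma dirichlet_expansion:
  assumes G: "Lp_fun G" and D: "Lp_fun D"
  shows "dirichlet (\<lambda>x. G x + h *\<^sub>R D x)
    \<le> dirichlet G + p * (h * (LINT x|\<mu>. power_field p (G x + h *\<^sub>R D x) \<bullet> D x))"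
proof -
  have L: "Lp_fun (\<lambda>x. G x + h *\<^sub>R D x)" by (intro Lp_fun_add Lp_fun_scaleR G D)
  note i = Lp_fun_integrable[OF G] power_field_inner_integrable[OF L D]
  have "dirichlet (\<lambda>x. G x + h *\<^sub>R D x)
      \<le> (LINT x|\<mu>. norm (G x) powr p + p * (h * (power_field p (G x + h *\<^sub>R D x) \<bullet> D x)))"
    unfolding dirichlet_def
  proof (rule integral_mono)
    show "norm (G x + h *\<^sub>R D x) powr p
        \<le> norm (G x) powr p + p * (h * (power_field p (G x + h *\<^sub>R D x) \<bullet> D x))" for x
      using norm_powr_subgradient[OF p1, of "G x + h *\<^sub>R D x" "G x"] by simp
  qed (use i Lp_fun_integrable[OF L] in auto)
  also have "\<dots> = dirichlet G + p * (h * (LINT x|\<mu>. power_field p (G x + h *\<^sub>R D x) \<bullet> D x))"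
    using i unfolding dirichlet_def by simp
  finally show ?thesis .
qed

text \<open>Dominated convergence; the restriction to |h n| <= 1 provides a dominating function
  independent of \<open>n\<close>.\<close>

lemma power_field_inner_tendsto:
  assumes G: "Lp_fun G" and D: "Lp_fun D" and h: "h \<longlonglongrightarrow> 0" "\<And>n. \<bar>h n\<bar> \<le> (1::real)"
  shows "(\<lambda>n. LINT x|\<mu>. power_field p (G x + h n *\<^sub>R D x) \<bullet> D x) \<longlonglongrightarrow> (LINT x|\<mu>. power_field p (G x) \<bullet> D x)"
proof (rule integral_dominated_convergence)
  note [measurable] = Lp_fun_measurable[OF G] Lp_fun_measurable[OF D]
  show "(\<lambda>x. power_field p (G x) \<bullet> D x) \<in> borel_measurable \<mu>"
    "(\<lambda>x. power_field p (G x + h n *\<^sub>R D x) \<bullet> D x) \<in> borel_measurable \<mu>" for n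
    by measurable
  show "integrable \<mu> (\<lambda>x. 2 powr p * (norm (G x) powr p + norm (D x) powr p) + norm (D x) powr p)"
    by (intro Bochner_Integration.integrable_add integrable_mult_right Lp_fun_integrable G D)
  show "AE x in \<mu>. (\<lambda>n. power_field p (G x + h n *\<^sub>R D x) \<bullet> D x) \<longlonglongrightarrow> power_field p (G x) \<bullet> D x"
  proof (rule AE_I2)
    fix x
    have "(\<lambda>n. G x + h n *\<^sub>R D x) \<longlonglongrightarrow> G x + 0 *\<^sub>R D x"
      by (intro tendsto_intros h)
    then have "(\<lambda>n. G x + h n *\<^sub>R D x) \<longlonglongrightarrow> G x" by simp
    from power_field_tendsto[OF p1 this]
    show "(\<lambda>n. power_field p (G x + h n *\<^sub>R D x) \<bullet> D x) \<longlonglongrightarrow> power_field p (G x) \<bullet> D x"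
      by (intro tendsto_inner tendsto_const)
  qed
  show "AE x in \<mu>. norm (power_field p (G x + h n *\<^sub>R D x) \<bullet> D x)
      \<le> 2 powr p * (norm (G x) powr p + norm (D x) powr p) + norm (D x) powr p" for n
  proof (rule AE_I2)
    fix x
    have "norm (h n *\<^sub>R D x) powr p \<le> norm (D x) powr p"
      using h(2)[of n] p1 by (auto intro!: powr_mono2 mult_left_le_one_le)
    then have "2 powr p * (norm (G x) powr p + norm (h n *\<^sub>R D x) powr p) \<le> 2 powr p * (norm (G x) powr p + norm (D x) powr p)"
      by (intro mult_left_mono add_left_mono) auto
    moreover have "norm (G x + h n *\<^sub>R D x) powr p \<le> 2 powr p * (norm (G x) powr p + norm (h n *\<^sub>R D x) powr p)"
      using p1 by (intro norm_powr_add_le) auto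
    moreover have "\<bar>power_field p (G x + h n *\<^sub>R D x) \<bullet> D x\<bar> \<le> norm (G x + h n *\<^sub>R D x) powr p + norm (D x) powr p"
      using power_field_inner_eps[OF p1 zero_less_one, of "G x + h n *\<^sub>R D x" "D x"] by simp
    ultimately show "norm (power_field p (G x + h n *\<^sub>R D x) \<bullet> D x)
        \<le> 2 powr p * (norm (G x) powr p + norm (D x) powr p) + norm (D x) powr p"
      unfolding real_norm_def by linarith
  qed
qed

lemma solution_exists:
  obtains u where "u \<in> sobolev_space_0 \<Omega> p" "u \<in> Linfty_functions \<Omega>" "integrable \<mu> (\<lambda>x. g x * u x)"
    "\<And>\<phi>. \<phi> \<in> sobolev_space_0 \<Omega> p \<inter> Linfty_functions \<Omega> \<Longrightarrow>
      (LINT x|\<mu>. power_field p (weak_gradient \<Omega> u x) \<bullet> weak_gradient \<Omega> \<phi> x) + (LINT x|\<mu>. g x * u x * \<phi> x)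
      = (LINT x|\<mu>. w x * power_field p (u x) * \<phi> x) + (LINT x|\<mu>. f x * \<phi> x)"
proof -
  let ?B = "bound + 1"
  obtain \<phi> u G where \<phi>: "\<And>n. \<phi> n \<in> test_functions \<Omega>" "\<And>n x. \<bar>\<phi> n x\<bar> \<le> ?B"
    and u [measurable]: "u \<in> borel_measurable \<mu>" and ub: "AE x in \<mu>. \<bar>u x\<bar> \<le> ?B"
    and lim: "AE x in \<mu>. (\<lambda>n. \<phi> n x) \<longlonglongrightarrow> u x" and wlim: "(\<lambda>n. LINT x|\<mu>. g x * \<bar>\<phi> n x - u x\<bar>) \<longlonglongrightarrow> 0"
    and G: "Lp_fun G" "Lp_lim (\<lambda>n. grad (\<phi> n)) G" and inf: "dirichlet G / p + lower u = infimum"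
    by (rule minimizer_exists) (rule that)
  have B: "?B \<ge> 0" using bound_props by simp
  note m\<phi> [measurable] = test_measurable[OF \<phi>(1)]
  have Lu: "Lp_fun u" by (rule Lp_fun_bounded[OF u]) (use ub in simp)
  have Llim: "Lp_lim \<phi> u"
  proof (rule Lp_lim_dominated[OF m\<phi> u _ _ lim])
    show "Lp_fun (\<lambda>x. 2 * ?B)" by (rule Lp_fun_bounded[of _ "2 * ?B"]) (use B in auto)
    show "AE x in \<mu>. norm (\<phi> n x - u x) \<le> norm (2 * ?B)" for n
      using ub
    proof eventually_elim
      case (elim x)
      have "norm (\<phi> n x - u x) \<le> \<bar>\<phi> n x\<bar> + \<bar>u x\<bar>" by simp
      also have "\<dots> \<le> ?B + ?B" by (rule add_mono[OF \<phi>(2) elim])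
      finally show ?case using B by simp
    qed
  qed
  note W = sobolev_space_0I[OF \<phi>(1) Lu Llim G]
  define r where "r x = g x * u x - w x * power_field p (u x) - f x" for x
  have r: "integrable \<mu> r"
    unfolding r_def[abs_def] by (intro Bochner_Integration.integrable_diff residual_integrable[OF u ub] f_int)
  \<comment> \<open>The first variation at \<open>u\<close>. The gradient is a separate argument, so
    that the classical gradient of a test function and the chosen weak gradient of a Sobolev
    function can both be inserted.\<close>
  define A where "A z D = (LINT x|\<mu>. power_field p (G x) \<bullet> D x) + (LINT x|\<mu>. r x * z x)" for z and D :: "'a \<Rightarrow> 'a"
  have A_nonneg: "0 \<le> A z (grad z)" if z: "z \<in> test_functions \<Omega>" for z
  proof -
    obtain R where R: "R > 0" "\<And>x. \<bar>z x\<bar> \<le> R" "\<And>x. norm (grad z x) \<le> R"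
      using test_functions_bounded[OF z] by blast
    have mz [measurable]: "z \<in> borel_measurable \<mu>" by (rule test_measurable[OF z])
    have D: "Lp_fun (grad z)" by (rule test_function_Lp(2)[OF z])
    have step: "0 \<le> (LINT x|\<mu>. power_field p (G x + h *\<^sub>R grad z x) \<bullet> grad z x) + (LINT x|\<mu>. r x * z x)
        + h * (LINT x|\<mu>. g x * (z x)\<^sup>2 / 2)" if h: "0 < h" for h :: real
    proof -
      \<comment> \<open>The variation is applied to the approximants, since the infimum is taken
        over test functions. The differences to the varied limits do not involve \<open>z\<close>,
        so the convergence of values and of gradients carries over.\<close>
      define v where "v n x = \<phi> n x + h * z x" for n x
      have v: "v n \<in> test_functions \<Omega>" for n
        unfolding v_def[abs_def] by (intro test_functions_add test_functions_cmult \<phi> z)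
      have gv: "grad (v n) x = grad (\<phi> n) x + h *\<^sub>R grad z x" for n x
        unfolding v_def[abs_def]
          grad_add[OF test_functions_smooth[OF \<phi>(1)] test_functions_smooth[OF test_functions_cmult[OF z]]]
          grad_cmult[OF test_functions_smooth[OF z]] ..
      have LG: "Lp_fun (\<lambda>x. G x + h *\<^sub>R grad z x)" by (intro Lp_fun_add Lp_fun_scaleR G D)
      have "Lp_lim (\<lambda>n. grad (v n)) (\<lambda>x. G x + h *\<^sub>R grad z x)"
        using G(2) unfolding Lp_lim_def gv by simp
      from Lp_lim_norm[OF test_function_Lp(2)[OF v] LG this]
      have 1: "(\<lambda>n. dirichlet (grad (v n))) \<longlonglongrightarrow> dirichlet (\<lambda>x. G x + h *\<^sub>R grad z x)"
        unfolding dirichlet_def .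
      have hz: "\<bar>h * z x\<bar> \<le> h * R" for x
        using mult_left_mono[OF R(2)[of x], of h] h by (simp add: abs_mult)
      have vb: "AE x in \<mu>. \<bar>v n x\<bar> \<le> ?B + h * R" for n
      proof (rule AE_I2)
        fix x show "\<bar>v n x\<bar> \<le> ?B + h * R"
          unfolding v_def by (rule order.trans[OF abs_triangle_ineq add_mono[OF \<phi>(2) hz]])
      qed
      have uvb: "AE x in \<mu>. \<bar>u x + h * z x\<bar> \<le> ?B + h * R"
        using ub
      proof eventually_elim
        case (elim x)
        show ?case by (rule order.trans[OF abs_triangle_ineq add_mono[OF elim hz]])
      qed
      have d: "v n x - (u x + h * z x) = \<phi> n x - u x" for n x by (simp add: v_def)
      have "(\<lambda>x. u x + h * z x) \<in> borel_measurable \<mu>" by measurable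
      from lower_lipschitz[OF test_measurable[OF v] this vb uvb]
      have "\<bar>lower (v n) - lower (\<lambda>x. u x + h * z x)\<bar> \<le> lip (?B + h * R) * (LINT x|\<mu>. g x * \<bar>\<phi> n x - u x\<bar>)" for n
        by (simp only: d)
      then have "(\<lambda>n. lower (v n) - lower (\<lambda>x. u x + h * z x)) \<longlonglongrightarrow> 0"
        by (intro Lim_null_comparison[OF _ tendsto_mult_right_zero[OF wlim]] always_eventually allI)
          (simp only: real_norm_def)
      then have 2: "(\<lambda>n. lower (v n)) \<longlonglongrightarrow> lower (\<lambda>x. u x + h * z x)" by (rule LIM_zero_cancel)
      have "(\<lambda>n. energy (v n)) \<longlonglongrightarrow> dirichlet (\<lambda>x. G x + h *\<^sub>R grad z x) / p + lower (\<lambda>x. u x + h * z x)"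
        unfolding energy_def using p1 by (intro tendsto_add tendsto_divide 1 2 tendsto_const) auto
      then have "infimum \<le> dirichlet (\<lambda>x. G x + h *\<^sub>R grad z x) / p + lower (\<lambda>x. u x + h * z x)"
        by (rule LIMSEQ_le_const) (use infimum_le[OF v] in blast)
      also have "\<dots> \<le> (dirichlet G + p * (h * (LINT x|\<mu>. power_field p (G x + h *\<^sub>R grad z x) \<bullet> grad z x))) / p
          + (lower u + h * (LINT x|\<mu>. r x * z x) + h\<^sup>2 * (LINT x|\<mu>. g x * (z x)\<^sup>2 / 2))"
        unfolding r_def using p1
        by (intro add_mono divide_right_mono dirichlet_expansion[OF G(1) D] lower_expansion[OF u ub mz R(2)]) auto
      also have "\<dots> = infimum + h * ((LINT x|\<mu>. power_field p (G x + h *\<^sub>R grad z x) \<bullet> grad z x) + (LINT x|\<mu>. r x * z x)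
          + h * (LINT x|\<mu>. g x * (z x)\<^sup>2 / 2))"
        using p1 inf by (simp add: add_divide_distrib power2_eq_square algebra_simps)
      finally have "0 \<le> h * ((LINT x|\<mu>. power_field p (G x + h *\<^sub>R grad z x) \<bullet> grad z x) + (LINT x|\<mu>. r x * z x)
          + h * (LINT x|\<mu>. g x * (z x)\<^sup>2 / 2))" by simp
      then show ?thesis using h by (simp add: zero_le_mult_iff)
    qed
    have h0: "(\<lambda>n. 1 / real (Suc n)) \<longlonglongrightarrow> 0" by (rule lim_1_over_n[THEN LIMSEQ_Suc])
    have h1: "\<bar>1 / real (Suc n)\<bar> \<le> 1" for n by simp
    have "(\<lambda>n. (LINT x|\<mu>. power_field p (G x + (1 / real (Suc n)) *\<^sub>R grad z x) \<bullet> grad z x) + (LINT x|\<mu>. r x * z x)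
        + (1 / real (Suc n)) * (LINT x|\<mu>. g x * (z x)\<^sup>2 / 2))
        \<longlonglongrightarrow> (LINT x|\<mu>. power_field p (G x) \<bullet> grad z x) + (LINT x|\<mu>. r x * z x) + 0 * (LINT x|\<mu>. g x * (z x)\<^sup>2 / 2)"
      by (intro tendsto_add tendsto_mult tendsto_const power_field_inner_tendsto[OF G(1) D h0 h1] h0)
    then have "0 \<le> (LINT x|\<mu>. power_field p (G x) \<bullet> grad z x) + (LINT x|\<mu>. r x * z x) + 0 * (LINT x|\<mu>. g x * (z x)\<^sup>2 / 2)"
      by (rule LIMSEQ_le_const) (intro exI[of _ 0] allI impI step, simp)
    then show ?thesis by (simp add: A_def)
  qed
  have A_zero: "A z (grad z) = 0" if z: "z \<in> test_functions \<Omega>" for z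
  proof -
    \<comment> \<open>The variation is linear and -z is admissible as well, so the inequality
      becomes an equality.\<close>
    have "0 \<le> A (\<lambda>x. - 1 * z x) (grad (\<lambda>x. - 1 * z x))"
      by (rule A_nonneg[OF test_functions_cmult[OF z]])
    also have "\<dots> = - A z (grad z)"
      unfolding A_def grad_cmult[OF test_functions_smooth[OF z]] by simp
    finally show ?thesis using A_nonneg[OF z] by simp
  qed
  note ae = weak_gradient_eq[OF W(1)]
  have LW: "Lp_fun (weak_gradient \<Omega> u)" by (rule Lp_fun_cong_AE[OF G(1) ae])
  show ?thesis
  proof (rule that[OF W(2)])
    show "u \<in> Linfty_functions \<Omega>" using u ub by (auto simp: Linfty_functions_def)
    show gu: "integrable \<mu> (\<lambda>x. g x * u x)" by (rule residual_integrable[OF u ub])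
    fix v assume v: "v \<in> sobolev_space_0 \<Omega> p \<inter> Linfty_functions \<Omega>"
    \<comment> \<open>The uniform bound \<open>R\<close> is essential: \<open>r\<close> is only in
      L^1, and the dominating function for the products with \<open>z n\<close> is R |r|.\<close>
    obtain z R where z: "\<And>n. z n \<in> test_functions \<Omega>" "\<And>n x. \<bar>z n x\<bar> \<le> R"
      "AE x in \<mu>. (\<lambda>n. z n x) \<longlonglongrightarrow> v x" "Lp_fun (weak_gradient \<Omega> v)"
      "Lp_lim (\<lambda>n. grad (z n)) (weak_gradient \<Omega> v)"
      by (rule bounded_approximation[OF v]) (rule that)
    note [measurable] = test_measurable[OF z(1)] borel_measurable_integrable[OF r]
    have mv [measurable]: "v \<in> borel_measurable \<mu>" using v by (auto simp: Linfty_functions_def)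
    have 1: "(\<lambda>n. LINT x|\<mu>. power_field p (G x) \<bullet> grad (z n) x) \<longlonglongrightarrow> (LINT x|\<mu>. power_field p (G x) \<bullet> weak_gradient \<Omega> v x)"
      by (rule Lp_lim_power_field_inner[OF G(1) test_function_Lp(2)[OF z(1)] z(4,5)])
    have 2: "(\<lambda>n. LINT x|\<mu>. r x * z n x) \<longlonglongrightarrow> (LINT x|\<mu>. r x * v x)"
    proof (rule integral_dominated_convergence[where w="\<lambda>x. \<bar>r x\<bar> * R"])
      show "integrable \<mu> (\<lambda>x. \<bar>r x\<bar> * R)" by (rule integrable_mult_left[OF integrable_abs[OF r]])
      show "AE x in \<mu>. (\<lambda>n. r x * z n x) \<longlonglongrightarrow> r x * v x"
        using z(3)
      proof eventually_elim
        case (elim x)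
        show ?case by (rule tendsto_mult[OF tendsto_const elim])
      qed
      show "AE x in \<mu>. norm (r x * z n x) \<le> \<bar>r x\<bar> * R" for n
      proof (rule AE_I2)
        fix x show "norm (r x * z n x) \<le> \<bar>r x\<bar> * R"
          unfolding real_norm_def abs_mult by (rule mult_left_mono[OF z(2)]) simp
      qed
    qed measurable
    have "(\<lambda>n. A (z n) (grad (z n))) \<longlonglongrightarrow> A v (weak_gradient \<Omega> v)"
      unfolding A_def by (rule tendsto_add[OF 1 2])
    then have A0: "A v (weak_gradient \<Omega> v) = 0"
      using A_zero[OF z(1)] by (simp add: LIMSEQ_const_iff)
    have pf: "(LINT x|\<mu>. power_field p (weak_gradient \<Omega> u x) \<bullet> weak_gradient \<Omega> v x)
        = (LINT x|\<mu>. power_field p (G x) \<bullet> weak_gradient \<Omega> v x)"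
    proof (rule integral_cong_AE)
      show "AE x in \<mu>. power_field p (weak_gradient \<Omega> u x) \<bullet> weak_gradient \<Omega> v x = power_field p (G x) \<bullet> weak_gradient \<Omega> v x"
        using ae by eventually_elim simp
    qed (intro borel_measurable_integrable power_field_inner_integrable LW G(1) z(4))+
    obtain C where C: "AE x in \<mu>. \<bar>v x\<bar> \<le> C" using v by (auto simp: Linfty_functions_def)
    have i: "integrable \<mu> (\<lambda>x. g x * u x * v x)" "integrable \<mu> (\<lambda>x. w x * power_field p (u x) * v x)"
      "integrable \<mu> (\<lambda>x. f x * v x)"
      by (rule bounded_mult_integrable[OF residual_integrable(1)[OF u ub] mv C],
          rule bounded_mult_integrable[OF residual_integrable(2)[OF u ub] mv C],
          rule bounded_mult_integrable[OF f_int mv C])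
    have "(LINT x|\<mu>. r x * v x) = (LINT x|\<mu>. g x * u x * v x - w x * power_field p (u x) * v x - f x * v x)"
      by (simp add: r_def left_diff_distrib)
    also have "\<dots> = (LINT x|\<mu>. g x * u x * v x) - (LINT x|\<mu>. w x * power_field p (u x) * v x) - (LINT x|\<mu>. f x * v x)"
      using i by simp
    finally show "(LINT x|\<mu>. power_field p (weak_gradient \<Omega> u x) \<bullet> weak_gradient \<Omega> v x) + (LINT x|\<mu>. g x * u x * v x)
      = (LINT x|\<mu>. w x * power_field p (u x) * v x) + (LINT x|\<mu>. f x * v x)"
      using A0 unfolding A_def pf by simp
  qed
qed

end

theorem theorem4:
  fixes \<Omega> :: "'a::euclidean_space set"
    and p lam M K :: real
    and f g :: "'a \<Rightarrow> real"
  assumes "open \<Omega>" and "connected \<Omega>" and "\<Omega> \<noteq> {}" and "bounded \<Omega>"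
    and "1 < p" and "p \<le> 2" and "p < real DIM('a)"
    and "0 < lam" and "lam < ((real DIM('a) - p) / p) powr p"
    and "integrable (lebesgue_on \<Omega>) f"
    and "integrable (lebesgue_on \<Omega>) g"
    and "AE x in lebesgue_on \<Omega>. 0 \<le> g x"
    and "M > 0" and "K > 1"
    and "AE x in lebesgue_on \<Omega>. \<bar>f x\<bar> \<le> M * g x"
    and "AE x in lebesgue_on \<Omega>. K * (lam / norm x powr p) \<le> g x"
  shows "\<exists>u \<in> sobolev_space_0 \<Omega> p \<inter> Linfty_functions \<Omega>. weak_solution \<Omega> p lam f g u"
proof -
  have dom: "bounded_domain \<Omega> p" using assms by unfold_locales
  \<comment> \<open>The quotient is a Borel function on the whole space, with value 0 at the origin
    by the convention for division by zero.\<close>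
  have "(\<lambda>x::'a. lam / norm x powr p) \<in> borel_measurable (lebesgue_on \<Omega>)"
    by (intro measurable_restrict_space1 measurable_completion) measurable
  then interpret singular_problem \<Omega> p "\<lambda>x. lam / norm x powr p" f g M K
    using assms by (intro singular_problem.intro dom singular_problem_axioms.intro) auto
  obtain u where "u \<in> sobolev_space_0 \<Omega> p" "u \<in> Linfty_functions \<Omega>" "integrable (lebesgue_on \<Omega>) (\<lambda>x. g x * u x)"
    "\<And>\<phi>. \<phi> \<in> sobolev_space_0 \<Omega> p \<inter> Linfty_functions \<Omega> \<Longrightarrow>
      (LINT x|lebesgue_on \<Omega>. power_field p (weak_gradient \<Omega> u x) \<bullet> weak_gradient \<Omega> \<phi> x)
        + (LINT x|lebesgue_on \<Omega>. g x * u x * \<phi> x)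
      = (LINT x|lebesgue_on \<Omega>. lam / norm x powr p * power_field p (u x) * \<phi> x)
        + (LINT x|lebesgue_on \<Omega>. f x * \<phi> x)"
    by (rule solution_exists) (rule that)
  then have "weak_solution \<Omega> p lam f g u" unfolding weak_solution_def by blast
  with \<open>u \<in> sobolev_space_0 \<Omega> p\<close> \<open>u \<in> Linfty_functions \<Omega>\<close> show ?thesis by blast
qed

end
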